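(* Let $A\in\mathbb{R}^{n\times n}$, $B\in\mathbb{R}^{n\times m}$, $C\in\mathbb{R}^{p\times n}$ and consider the system $(\star)$: $x_{t+1}=Ax_t+Bu_t$, $y_t=Cx_t$. Assume that $(A,B)$ is controllable and that $(A,C)$ and $(A,Q_x^{1/2})$ are observable, where $Q_x=C^\top QC$. Let $(\zeta_t,E,\mathcal{A},\mathcal{B},n_\zeta,n_v)$ be as in Case 1 or Case 2 of the context, so that $x_t=E\zeta_t$. Suppose $\Pi\in\mathbb{R}^{n_\zeta\times n_v}$ satisfies $\operatorname{im}(\Pi)=\operatorname{im}(\mathcal{R}(\mathcal{A},\mathcal{B}))$ and that $\zeta_t=\Pi v_t$. Then the state $x_t$ can be uniquely expressed in terms of $v_t$, namely $x_t=E\Pi v_t=:Fv_t$, where $F=E\Pi$ has full row rank. Furthermore, the system $$v_{t+1}=\Pi^\dagger\mathcal{A}\Pi v_t+\Pi^\dagger\mathcal{B}u_t,\qquad y_t=CE\Pi v_t$$ is consistent with $(\star)$ and is controllable.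
   Context: Here $p\le n$, $C$ has full row rank, $Q\in\mathbb{R}^{p\times p}$ is symmetric positive semidefinite, and $(\cdot)^\dagger$ is the Moore-Penrose pseudo-inverse. $\mathcal{R}(\mathcal{A},\mathcal{B}):=[\mathcal{A}^{d-1}\mathcal{B},\dots,\mathcal{A}\mathcal{B},\mathcal{B}]$ with $d$ the state dimension is the controllability matrix. $n_v$ is the rank of $\mathcal{R}(\mathcal{A},\mathcal{B})$. Case 1 (delayed input-output). $\zeta_t=\xi_t:=[u_{t-n}^\top,\dots,u_{t-1}^\top,y_{t-n}^\top,\dots,y_{t-1}^\top]^\top$, $n_\zeta=(m+p)n$, $n_v=mn+n$. Let $\mathcal{R}_n:=[A^{n-1}B,\dots,AB,B]$, $\mathcal{O}_n:=[C^\top,(CA)^\top,\dots,(CA^{n-1})^\top]^\top$, and $\mathcal{T}_n$ the $pn\times mn$ block matrix whose $(i,j)$ block is $CA^{i-j-1}B$ for $i>j$ and $\mathbf 0$ otherwise. $E=M:=[\mathcal{R}_n-A^n\mathcal{O}_n^\dagger\mathcal{T}_n,\;A^n\mathcal{O}_n^\dagger]$. $\mathcal{A}=\Omega+\Gamma CM$ and $\mathcal{B}=\mathcal{B}_m$, where $\mathcal{B}_m:=[\mathbf 0_{m\times m(n-1)},I_m,\mathbf 0_{m\times pn}]^\top$, $\Gamma:=[\mathbf 0_{p\times(mn+p(n-1))},I_p]^\top$, $\Omega:=\operatorname{diag}(\Omega_m,\Omega_p)$ with $\Omega_k:=\begin{bmatrix}\mathbf 0_{k(n-1)\times k}&I_{k(n-1)}\\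 \mathbf 0_{k\times k}&\mathbf 0\end{bmatrix}\in\mathbb{R}^{kn\times kn}$. Case 2 (input-output filter). $L\in\mathbb{R}^{n\times p}$ is a user-defined gain of the observer $x^c_{t+1}=(A-LC)x^c_t+Bu_t+Ly_t$, $\epsilon_t:=x_t-x_t^c$. Write $\det(zI_n-(A-LC))=z^n+a_{n-1}z^{n-1}+\dots+a_0$, $a_n:=1$, $D_i:=\sum_{j=1}^{n-i}a_{n-j+1}(A-LC)^{n-i-j}$ ($0\le i\le n-1$), $\mathcal{D}:=[D_0,\dots,D_{n-1}]$. $A_\epsilon\in\mathbb{R}^{n\times n}$ is user-chosen with the same eigenvalues as $A-LC$; $\mathcal{D}^\epsilon$ is defined as $\mathcal{D}$ with $A_\epsilon$ in place of $A-LC$; $\eta_0^\epsilon\in\mathbb{R}^n$ is user-chosen with $S_{\epsilon_\eta}:=\mathcal{D}^\epsilon(I_n\otimes\eta_0^\epsilon)$ invertible. With $B_i,L_j$ the columns of $B,L$: $E=S:=[\mathcal{D}(I_n\otimes B_1),\dots,\mathcal{D}(I_n\otimes B_m),\mathcal{D}(I_n\otimes L_1),\dots,\mathcal{D}(I_n\otimes L_p),\mathcal{D}(I_n\otimes\epsilon_0)S_{\epsilon_\eta}^{-1}]$. $A_s$ is the $n\times n$ companion matrix with $I_{n-1}$ on the superdiagonal and last row $(-a_0,\dots,-a_{n-1})$, $b_s:=(0,\dots,0,1)^\top$, $\mathcal{A}_s:=\operatorname{diag}(I_{m+p}\otimes A_s,A_\epsilon)$, $\mathcal{B}_s:=\operatorname{diag}(I_{m+p}\otimes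 b_s,\mathbf 0_{n\times1})$, $\mathcal{B}_s^u$ = first $m$ columns of $\mathcal{B}_s$, $\mathcal{B}_s^y$ = columns $m+1,\dots,m+p$. $\zeta_t=\eta_t$ is generated by $\eta_{t+1}=\mathcal{A}_s\eta_t+\mathcal{B}_s^uu_t+\mathcal{B}_s^yy_t$, $\eta_0=[\mathbf 0_{1\times(m+p)n},(\eta_0^\epsilon)^\top]^\top$; $n_\zeta=(m+p+1)n$; $\mathcal{A}=\mathcal{A}_s+\mathcal{B}_s^yCS$, $\mathcal{B}=\mathcal{B}_s^u$; $n_v=mn+\mathbf 1_{\{\lambda(A-LC)\neq\mathbf 0\}}n+n$, where the indicator is $0$ if all eigenvalues of $A-LC$ are zero and $1$ otherwise. Consistency: a system $v_{t+1}=\mathcal{A}'v_t+\mathcal{B}'u_t$, $y_t=\mathcal{C}'v_t$ is consistent with $(\star)$ if for any input $\{u_t\}$ there exists a state trajectory $\{v_t\}$ such that the corresponding input-output trajectory $\{u_t,y_t\}$ generated by this system is identical to that generated by $(\star)$.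
   Formalization: In Case 2 with A−LC having a nonzero eigenvalue, n_v is taken as the rank of R(𝒜,ℬ) instead of mn+2n: the last n rows of R vanish, so mn+2n exceeds the rank and the reduced system would not be controllable. *)

theory Defs
  imports
    "Jordan_Normal_Form.DL_Rank"
    "Jordan_Normal_Form.Gauss_Jordan_Elimination"
    "Jordan_Normal_Form.Spectral_Radius"
begin

section \<open>Matrix notions\<close>

text \<open>Blocks are indexed from 0; every block \<open>f i j\<close> is of size \<open>br \<times> bc\<close>.\<close>

definition block_mat :: "nat \<Rightarrow> nat \<Rightarrow> nat \<Rightarrow> nat \<Rightarrow> (nat \<Rightarrow> nat \<Rightarrow> real mat) \<Rightarrow> real mat" where
  "block_mat nbr nbc br bc f =
     mat (nbr * br) (nbc * bc) (\<lambda>(i, j). f (i div br) (j div bc) $$ (i mod br, j mod bc))"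

definition hcat :: "real mat \<Rightarrow> real mat \<Rightarrow> real mat" where
  "hcat X Y = four_block_mat X Y (0\<^sub>m 0 (dim_col X)) (0\<^sub>m 0 (dim_col Y))"

definition kron :: "real mat \<Rightarrow> real mat \<Rightarrow> real mat" where
  "kron X Y = block_mat (dim_row X) (dim_col X) (dim_row Y) (dim_col Y) (\<lambda>i j. X $$ (i, j) \<cdot>\<^sub>m Y)"

definition col_mat :: "real vec \<Rightarrow> real mat" where
  "col_mat v = mat_of_cols (dim_vec v) [v]"

definition mat_im :: "real mat \<Rightarrow> real vec set" where
  "mat_im X = (\<lambda>w. X *\<^sub>v w) ` carrier_vec (dim_col X)"

definition mat_rank :: "real mat \<Rightarrow> nat" where
  "mat_rank X = vec_space.rank (dim_row X) X"

definition is_pinv :: "real mat \<Rightarrow> real mat \<Rightarrow> bool" where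
  "is_pinv X Y \<longleftrightarrow> Y \<in> carrier_mat (dim_col X) (dim_row X) \<and>
     X * Y * X = X \<and> Y * X * Y = Y \<and>
     transpose_mat (X * Y) = X * Y \<and> transpose_mat (Y * X) = Y * X"

definition pinv :: "real mat \<Rightarrow> real mat" where
  "pinv X = (THE Y. is_pinv X Y)"

definition sym_psd :: "nat \<Rightarrow> real mat \<Rightarrow> bool" where
  "sym_psd k X \<longleftrightarrow> X \<in> carrier_mat k k \<and> transpose_mat X = X \<and>
     (\<forall>w \<in> carrier_vec k. 0 \<le> w \<bullet> (X *\<^sub>v w))"

definition psd_sqrt :: "real mat \<Rightarrow> real mat" where
  "psd_sqrt X = (THE Y. sym_psd (dim_row X) Y \<and> Y * Y = X)"

text \<open>Complex eigenvalues, counted with algebraic multiplicity.\<close>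

definition eigvals :: "real mat \<Rightarrow> complex multiset" where
  "eigvals X = proots (char_poly (map_mat complex_of_real X))"


section \<open>Linear systems\<close>

definition ctrb :: "real mat \<Rightarrow> real mat \<Rightarrow> real mat" where
  "ctrb A B = block_mat 1 (dim_row A) (dim_row A) (dim_col B)
     (\<lambda>_ j. A ^\<^sub>m (dim_row A - 1 - j) * B)"

definition obsv :: "real mat \<Rightarrow> real mat \<Rightarrow> real mat" where
  "obsv A C = block_mat (dim_row A) 1 (dim_row C) (dim_row A) (\<lambda>i _. C * A ^\<^sub>m i)"

definition controllable :: "real mat \<Rightarrow> real mat \<Rightarrow> bool" where
  "controllable A B \<longleftrightarrow> mat_rank (ctrb A B) = dim_row A"

definition observable :: "real mat \<Rightarrow> real mat \<Rightarrow> bool" where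
  "observable A C \<longleftrightarrow> mat_rank (obsv A C) = dim_row A"

definition lti_trajectory ::
  "real mat \<Rightarrow> real mat \<Rightarrow> real mat \<Rightarrow>
   (nat \<Rightarrow> real vec) \<Rightarrow> (nat \<Rightarrow> real vec) \<Rightarrow> (nat \<Rightarrow> real vec) \<Rightarrow> bool" where
  "lti_trajectory A B C u x y \<longleftrightarrow>
     (\<forall>t. u t \<in> carrier_vec (dim_col B)) \<and>
     (\<forall>t. x t \<in> carrier_vec (dim_row A)) \<and>
     (\<forall>t. x (Suc t) = A *\<^sub>v x t + B *\<^sub>v u t) \<and>
     (\<forall>t. y t = C *\<^sub>v x t)"

text \<open>\<open>(A', B', C')\<close> is consistent with \<open>(A, B, C)\<close>. The trajectory generated by \<open>(A, B, C)\<close>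
  may start from any initial state.\<close>

definition consistent_with ::
  "real mat \<Rightarrow> real mat \<Rightarrow> real mat \<Rightarrow> real mat \<Rightarrow> real mat \<Rightarrow> real mat \<Rightarrow> bool" where
  "consistent_with A' B' C' A B C \<longleftrightarrow>
     (\<forall>u x y. lti_trajectory A B C u x y \<longrightarrow> (\<exists>v. lti_trajectory A' B' C' u v y))"


section \<open>Case 1: delayed inputs and outputs\<close>

definition io_toeplitz :: "real mat \<Rightarrow> real mat \<Rightarrow> real mat \<Rightarrow> real mat" where
  "io_toeplitz A B C =
     (let n = dim_row A; m = dim_col B; p = dim_row C in
      block_mat n n p m (\<lambda>i j. if j < i then C * A ^\<^sub>m (i - j - 1) * B else 0\<^sub>m p m))"

definition io_M :: "real mat \<Rightarrow> real mat \<Rightarrow> real mat \<Rightarrow> real mat" where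
  "io_M A B C =
     (let n = dim_row A; W = A ^\<^sub>m n * pinv (obsv A C) in
      hcat (ctrb A B - W * io_toeplitz A B C) W)"

definition shift_mat :: "nat \<Rightarrow> nat \<Rightarrow> real mat" where
  "shift_mat n k = four_block_mat
     (0\<^sub>m (k * (n - 1)) k) (1\<^sub>m (k * (n - 1)))
     (0\<^sub>m k k)             (0\<^sub>m k (k * (n - 1)))"

definition io_Omega :: "nat \<Rightarrow> nat \<Rightarrow> nat \<Rightarrow> real mat" where
  "io_Omega n m p = diag_block_mat [shift_mat n m, shift_mat n p]"

definition io_B :: "nat \<Rightarrow> nat \<Rightarrow> nat \<Rightarrow> real mat" where
  "io_B n m p = transpose_mat (hcat (hcat (0\<^sub>m m (m * (n - 1))) (1\<^sub>m m)) (0\<^sub>m m (p * n)))"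

definition io_Gamma :: "nat \<Rightarrow> nat \<Rightarrow> nat \<Rightarrow> real mat" where
  "io_Gamma n m p = transpose_mat (hcat (0\<^sub>m p (m * n + p * (n - 1))) (1\<^sub>m p))"

definition io_A :: "real mat \<Rightarrow> real mat \<Rightarrow> real mat \<Rightarrow> real mat" where
  "io_A A B C =
     (let n = dim_row A; m = dim_col B; p = dim_row C in
      io_Omega n m p + io_Gamma n m p * C * io_M A B C)"

definition io_history ::
  "nat \<Rightarrow> nat \<Rightarrow> nat \<Rightarrow> (nat \<Rightarrow> real vec) \<Rightarrow> (nat \<Rightarrow> real vec) \<Rightarrow> nat \<Rightarrow> real vec" where
  "io_history n m p u y t =
     vec (m * n) (\<lambda>i. u (t - n + i div m) $ (i mod m)) @\<^sub>v
     vec (p * n) (\<lambda>i. y (t - n + i div p) $ (i mod p))"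

text \<open>The set of all pairs \<open>(x\<^sub>t, \<zeta>\<^sub>t)\<close> that can occur. Time starts at 0, so that \<open>\<zeta>\<^sub>t\<close> is
  available from time \<open>n\<close> on.\<close>

definition io_pairs :: "real mat \<Rightarrow> real mat \<Rightarrow> real mat \<Rightarrow> (real vec \<times> real vec) set" where
  "io_pairs A B C =
     {(x t, io_history (dim_row A) (dim_col B) (dim_row C) u y t) | u x y t.
        lti_trajectory A B C u x y \<and> dim_row A \<le> t}"

definition delayed_io_case ::
  "nat \<Rightarrow> nat \<Rightarrow> nat \<Rightarrow> real mat \<Rightarrow> real mat \<Rightarrow> real mat \<Rightarrow>
   (real vec \<times> real vec) set \<Rightarrow> real mat \<Rightarrow> real mat \<Rightarrow> real mat \<Rightarrow> nat \<Rightarrow> nat \<Rightarrow> bool" where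
  "delayed_io_case n m p A B C Z E \<A> \<B> n\<^sub>\<zeta> n\<^sub>v \<longleftrightarrow>
     Z = io_pairs A B C \<and>
     E = io_M A B C \<and>
     \<A> = io_A A B C \<and>
     \<B> = io_B n m p \<and>
     n\<^sub>\<zeta> = (m + p) * n \<and>
     n\<^sub>v = m * n + n"


section \<open>Case 2: input-output filter\<close>

text \<open>\<open>adj_coeff H i\<close> is \<open>D\<^sub>i\<close> and \<open>adj_coeffs H\<close> is \<open>[D\<^sub>0, \<dots>, D\<^sub>n\<^sub>-\<^sub>1]\<close>: the coefficients of the
  adjugate of \<open>z I - H\<close> as a polynomial in \<open>z\<close>.\<close>

definition adj_coeff :: "real mat \<Rightarrow> nat \<Rightarrow> real mat" where
  "adj_coeff H i =
     (let n = dim_row H in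
      mat n n (\<lambda>rc. \<Sum>j = 1..n - i. coeff (char_poly H) (n - j + 1) * (H ^\<^sub>m (n - i - j)) $$ rc))"

definition adj_coeffs :: "real mat \<Rightarrow> real mat" where
  "adj_coeffs H = (let n = dim_row H in block_mat 1 n n n (\<lambda>_ i. adj_coeff H i))"

text \<open>The matrix \<open>[D\<^sub>0, \<dots>, D\<^sub>n\<^sub>-\<^sub>1] (I\<^sub>n \<otimes> w)\<close>.\<close>

definition adj_apply :: "real mat \<Rightarrow> real vec \<Rightarrow> real mat" where
  "adj_apply H w = adj_coeffs H * kron (1\<^sub>m (dim_row H)) (col_mat w)"

definition filter_S ::
  "real mat \<Rightarrow> real mat \<Rightarrow> real mat \<Rightarrow> real mat \<Rightarrow> real mat \<Rightarrow> real vec \<Rightarrow> real vec \<Rightarrow> real mat" where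
  "filter_S A B C L A\<^sub>\<epsilon> \<epsilon>\<^sub>0 \<eta>\<^sub>\<epsilon> =
     (let n = dim_row A; m = dim_col B; p = dim_row C; H = A - L * C in
      block_mat 1 (m + p + 1) n n
        (\<lambda>_ k. if k < m then adj_apply H (col B k)
               else if k < m + p then adj_apply H (col L (k - m))
               else adj_apply H \<epsilon>\<^sub>0 * the (mat_inverse (adj_apply A\<^sub>\<epsilon> \<eta>\<^sub>\<epsilon>))))"

definition companion :: "real mat \<Rightarrow> real mat" where
  "companion H =
     (let n = dim_row H in
      mat n n (\<lambda>(i, j). if i = n - 1 then - coeff (char_poly H) j else if j = i + 1 then 1 else 0))"

definition filter_As :: "nat \<Rightarrow> nat \<Rightarrow> real mat \<Rightarrow> real mat \<Rightarrow> real mat" where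
  "filter_As m p H A\<^sub>\<epsilon> = diag_block_mat [kron (1\<^sub>m (m + p)) (companion H), A\<^sub>\<epsilon>]"

definition filter_Bs :: "nat \<Rightarrow> nat \<Rightarrow> nat \<Rightarrow> real mat" where
  "filter_Bs n m p =
     diag_block_mat [kron (1\<^sub>m (m + p)) (col_mat (unit_vec n (n - 1))), 0\<^sub>m n 1]"

definition filter_Bu :: "nat \<Rightarrow> nat \<Rightarrow> nat \<Rightarrow> real mat" where
  "filter_Bu n m p = mat ((m + p + 1) * n) m (\<lambda>(i, j). filter_Bs n m p $$ (i, j))"

definition filter_By :: "nat \<Rightarrow> nat \<Rightarrow> nat \<Rightarrow> real mat" where
  "filter_By n m p = mat ((m + p + 1) * n) p (\<lambda>(i, j). filter_Bs n m p $$ (i, m + j))"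

definition filter_A ::
  "real mat \<Rightarrow> real mat \<Rightarrow> real mat \<Rightarrow> real mat \<Rightarrow> real mat \<Rightarrow> real vec \<Rightarrow> real vec \<Rightarrow> real mat" where
  "filter_A A B C L A\<^sub>\<epsilon> \<epsilon>\<^sub>0 \<eta>\<^sub>\<epsilon> =
     (let n = dim_row A; m = dim_col B; p = dim_row C in
      filter_As m p (A - L * C) A\<^sub>\<epsilon> + filter_By n m p * C * filter_S A B C L A\<^sub>\<epsilon> \<epsilon>\<^sub>0 \<eta>\<^sub>\<epsilon>)"

text \<open>The set of all pairs \<open>(x\<^sub>t, \<eta>\<^sub>t)\<close> that can occur for the given initial observer
  error \<open>\<epsilon>\<^sub>0\<close>; \<open>xc\<close> is the state of the observer.\<close>

definition filter_pairs ::
  "real mat \<Rightarrow> real mat \<Rightarrow> real mat \<Rightarrow> real mat \<Rightarrow> real mat \<Rightarrow> real vec \<Rightarrow> real vec \<Rightarrow>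
   (real vec \<times> real vec) set" where
  "filter_pairs A B C L A\<^sub>\<epsilon> \<epsilon>\<^sub>0 \<eta>\<^sub>\<epsilon> =
     (let n = dim_row A; m = dim_col B; p = dim_row C; H = A - L * C in
      {(x t, \<eta> t) | u x y xc \<eta> t.
         lti_trajectory A B C u x y \<and>
         xc 0 \<in> carrier_vec n \<and>
         (\<forall>s. xc (Suc s) = H *\<^sub>v xc s + B *\<^sub>v u s + L *\<^sub>v y s) \<and>
         \<epsilon>\<^sub>0 = x 0 - xc 0 \<and>
         \<eta> 0 = 0\<^sub>v ((m + p) * n) @\<^sub>v \<eta>\<^sub>\<epsilon> \<and>
         (\<forall>s. \<eta> (Suc s) = filter_As m p H A\<^sub>\<epsilon> *\<^sub>v \<eta> s
                          + filter_Bu n m p *\<^sub>v u s + filter_By n m p *\<^sub>v y s)})"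

text \<open>\<open>n\<^sub>v\<close> is the rank of the controllability matrix of \<open>(\<A>, \<B>)\<close>. If all eigenvalues of
  \<open>A - L C\<close> vanish, this is \<open>m n + n\<close>. Otherwise the closed form \<open>m n + n + n\<close> stated for it
  exceeds the rank: the last \<open>n\<close> rows of that matrix are zero, since the component driven by
  \<open>A\<^sub>\<epsilon>\<close> is autonomous. There the rank itself is used.\<close>

definition filter_case ::
  "nat \<Rightarrow> nat \<Rightarrow> nat \<Rightarrow> real mat \<Rightarrow> real mat \<Rightarrow> real mat \<Rightarrow>
   real mat \<Rightarrow> real mat \<Rightarrow> real vec \<Rightarrow> real vec \<Rightarrow>
   (real vec \<times> real vec) set \<Rightarrow> real mat \<Rightarrow> real mat \<Rightarrow> real mat \<Rightarrow> nat \<Rightarrow> nat \<Rightarrow> bool" where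
  "filter_case n m p A B C L A\<^sub>\<epsilon> \<epsilon>\<^sub>0 \<eta>\<^sub>\<epsilon> Z E \<A> \<B> n\<^sub>\<zeta> n\<^sub>v \<longleftrightarrow>
     L \<in> carrier_mat n p \<and>
     A\<^sub>\<epsilon> \<in> carrier_mat n n \<and> eigvals A\<^sub>\<epsilon> = eigvals (A - L * C) \<and>
     \<epsilon>\<^sub>0 \<in> carrier_vec n \<and>
     \<eta>\<^sub>\<epsilon> \<in> carrier_vec n \<and> invertible_mat (adj_apply A\<^sub>\<epsilon> \<eta>\<^sub>\<epsilon>) \<and>
     Z = filter_pairs A B C L A\<^sub>\<epsilon> \<epsilon>\<^sub>0 \<eta>\<^sub>\<epsilon> \<and>
     E = filter_S A B C L A\<^sub>\<epsilon> \<epsilon>\<^sub>0 \<eta>\<^sub>\<epsilon> \<and>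
     \<A> = filter_A A B C L A\<^sub>\<epsilon> \<epsilon>\<^sub>0 \<eta>\<^sub>\<epsilon> \<and>
     \<B> = filter_Bu n m p \<and>
     n\<^sub>\<zeta> = (m + p + 1) * n \<and>
     n\<^sub>v = (if spectrum (map_mat complex_of_real (A - L * C)) \<subseteq> {0}
           then m * n + n else mat_rank (ctrb \<A> \<B>))"

end

theory Submission
  imports Defs
begin

text \<open>
  The image of the controllability matrix of a pair \<open>(X, Y)\<close> is the set of states reached from zero,
  and by Cayley--Hamilton it does not matter in how many steps. In both cases \<open>E\<close> maps the state that
  \<open>(\<A>, \<B>)\<close> reaches under an input to the state that \<open>(A, B)\<close> reaches under the same input. Hence
  \<open>E \<Pi>\<close> is onto, \<open>E\<close> intertwines the dynamics on \<open>im \<Pi>\<close>, and, \<open>\<Pi>\<close> being injective, the reduced system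
  is the restriction of \<open>(\<A>, \<B>)\<close> to its own controllable subspace.

  Injectivity of \<open>\<Pi>\<close> is a dimension count: a history of length \<open>n\<close> determines, by observability,
  the state \<open>n\<close> steps ago and the inputs since then, and by controllability these \<open>n + m n\<close>
  numbers are arbitrary. If \<open>A - L C\<close> is nilpotent, the companion matrix is a shift and the filter state
  is a reordered history.

  In the filter case, \<open>T\<^sub>w = [D\<^sub>0 w, \<dots>, D\<^sub>n\<^sub>-\<^sub>1 w]\<close> satisfies \<open>T\<^sub>w A\<^sub>s = (A - L C) T\<^sub>w\<close> and \<open>T\<^sub>w b\<^sub>s = w\<close>, so
  that \<open>S \<eta>\<^sub>t\<close> obeys the observer equation.\<close>

subsection \<open>Rank, images and pseudo-inverses\<close>

text \<open>Everything is phrased through input sequences rather than through matrices: two pairs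
  driven by one input are compared step by step, so \<open>E\<close> has to be understood only on
  states reached from zero. For delayed data this is essential, as the formula for \<open>E\<close>
  is shown to return the state only on genuine histories. Arbitrary initial states of the original
  system fit in, since controllability makes each of them reachable from zero.

  The obstacle is the relation \<zeta> = \<Pi> v in the filter case. The block driven by
  \<open>A\<^sub>\<epsilon>\<close> starts at a nonzero vector and receives no input, yet it is zero
  on all of im \<Pi>. The relation can therefore hold only once that block has died out, which
  forces A - L C to be nilpotent. Otherwise no pair satisfies it, x = E \<Pi> v holds vacuously, and
  any matrix would serve as F; this is why uniqueness of F is stated under the existence of one such
  pair. Rank, consistency and controllability are obtained from reached states alone.\<close>

lemma mat_im_subset_carrier: "mat_im X \<subseteq> carrier_vec (dim_row X)"
  unfolding mat_im_def by (auto intro: carrier_vecI)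

lemma mat_imI: "X \<in> carrier_mat r k \<Longrightarrow> w \<in> carrier_vec k \<Longrightarrow> X *\<^sub>v w \<in> mat_im X"
  unfolding mat_im_def by auto

lemma mat_imE:
  assumes "z \<in> mat_im X" "X \<in> carrier_mat r k"
  obtains w where "w \<in> carrier_vec k" "z = X *\<^sub>v w"
  using assms unfolding mat_im_def by auto

lemma mat_im_eq_col_space: "mat_im X = vec_space.col_space (dim_row X) X"
  unfolding vec_space.col_space_eq[OF carrier_matI[OF refl refl]] mat_im_def
  by (auto intro: carrier_vecI)

lemma mat_rank_cong_im:
  assumes "dim_row X = dim_row Y" "mat_im X = mat_im Y"
  shows "mat_rank X = mat_rank Y"
  using assms unfolding mat_im_eq_col_space mat_rank_def vec_space.rank_def vec_space.col_space_def
  by simp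

lemma mat_rank_eq_card_basis:
  assumes "X \<in> carrier_mat r k"
  obtains S where "S \<subseteq> set (cols X)" "module.lin_indpt class_ring (module_vec TYPE(real) r) S"
    "card S = mat_rank X"
proof -
  interpret vec_space "TYPE(real)" r .
  obtain S where S: "maximal S (\<lambda>T. T \<subseteq> set (cols X) \<and> lin_indpt T)"
    using maximal_exists_superset[of "set (cols X)" "\<lambda>T. T \<subseteq> set (cols X) \<and> lin_indpt T" "{}"]
    by (meson List.finite_set empty_iff empty_subsetI finite_lin_indpt2 finite.emptyI)
  moreover from rank_card_indpt[OF assms S] have "card S = mat_rank X"
    using assms by (simp add: mat_rank_def)
  ultimately show thesis using that unfolding maximal_def by metis
qed

lemma inj_if_mat_rank_eq_dim_col:
  assumes X: "X \<in> carrier_mat r k" and rank: "mat_rank X = k"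
    and w: "w \<in> carrier_vec k" and "X *\<^sub>v w = 0\<^sub>v r"
  shows "w = 0\<^sub>v k"
proof (rule ccontr)
  interpret vec_space "TYPE(real)" r .
  assume "w \<noteq> 0\<^sub>v k"
  obtain S where S: "S \<subseteq> set (cols X)" "card S = k"
    using mat_rank_eq_card_basis[OF X] rank by metis
  \<comment> \<open>Linear dependence concerns the set of columns, so repeated columns must be
    excluded first: \<open>k\<close> different columns in a list of length \<open>k\<close> leave no
    room for them.\<close>
  have "length (cols X) = k" using X by simp
  with S have "card (set (cols X)) = length (cols X)"
    by (metis List.finite_set card_length card_mono le_antisym)
  then have dist: "distinct (cols X)" by (rule card_distinct)
  have "lin_indpt (set (cols X))"
    using full_rank_lin_indpt[OF X _ dist] rank X by (simp add: mat_rank_def)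
  moreover have "lin_dep (set (cols X))"
    using lin_depI[OF X w \<open>w \<noteq> 0\<^sub>v k\<close> assms(4) dist] .
  ultimately show False by simp
qed

lemma surj_if_mat_rank_eq_dim_row:
  assumes X: "X \<in> carrier_mat r k" and rank: "mat_rank X = r"
  shows "mat_im X = carrier_vec r"
proof -
  interpret vec_space "TYPE(real)" r .
  obtain S where S: "S \<subseteq> set (cols X)" "lin_indpt S" "card S = r"
    using mat_rank_eq_card_basis[OF X] rank by metis
  have cols: "set (cols X) \<subseteq> carrier_vec r" using X cols_dim by blast
  have "basis S"
    using S cols by (intro dim_li_is_basis) (auto simp: dim_is_n finite_subset)
  then have "carrier_vec r = span S" unfolding basis_def by simp
  also have "\<dots> \<subseteq> span (set (cols X))" using S(1) by (rule span_is_monotone)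
  also have "\<dots> = mat_im X" using X by (simp add: mat_im_eq_col_space col_space_def)
  finally show ?thesis using mat_im_subset_carrier[of X] X by auto
qed

lemma mat_rank_eq_dim_row_if_surj:
  assumes X: "X \<in> carrier_mat r k" and "mat_im X = carrier_vec r"
  shows "mat_rank X = r"
proof -
  have "mat_im (1\<^sub>m r) = carrier_vec r" by (auto simp: mat_im_def)
  then have "mat_rank X = mat_rank (1\<^sub>m r)" using assms by (intro mat_rank_cong_im) auto
  also have "\<dots> = r" using vec_space.det_rank_iff[of "1\<^sub>m r :: real mat" r] by (simp add: mat_rank_def)
  finally show ?thesis .
qed

lemma square_surj_imp_inj:
  assumes X: "X \<in> carrier_mat k k" and "mat_im X = carrier_vec k"
    and "w \<in> carrier_vec k" "X *\<^sub>v w = 0\<^sub>v k"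
  shows "w = 0\<^sub>v k"
  using inj_if_mat_rank_eq_dim_col[OF X mat_rank_eq_dim_row_if_surj[OF X]] assms by blast

text \<open>This is the dimension count. \<open>P\<close> may be tall, but \<open>K * P\<close> is
  square, so being onto makes it injective, and then \<open>P\<close> is injective too. In the
  applications \<open>K\<close> reads off \<open>k\<close> free parameters from a reached
  state.\<close>

lemma inj_if_comp_surj:
  fixes P K :: "real mat"
  assumes P: "P \<in> carrier_mat r k" and K: "K \<in> carrier_mat k r"
    and surj: "\<And>z. z \<in> carrier_vec k \<Longrightarrow> \<exists>v \<in> carrier_vec k. K *\<^sub>v (P *\<^sub>v v) = z"
    and w: "w \<in> carrier_vec k" "P *\<^sub>v w = 0\<^sub>v r"
  shows "w = 0\<^sub>v k"
proof (rule square_surj_imp_inj[of "K * P"])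
  show KP: "K * P \<in> carrier_mat k k" using P K by simp
  show "mat_im (K * P) = carrier_vec k"
  proof
    show "mat_im (K * P) \<subseteq> carrier_vec k" using mat_im_subset_carrier[of "K * P"] K by simp
    show "carrier_vec k \<subseteq> mat_im (K * P)"
    proof
      fix z :: "real vec" assume "z \<in> carrier_vec k"
      then obtain v where "v \<in> carrier_vec k" "K *\<^sub>v (P *\<^sub>v v) = z" using surj by blast
      then have "z = (K * P) *\<^sub>v v" using K P by simp
      then show "z \<in> mat_im (K * P)" using mat_imI[OF KP \<open>v \<in> carrier_vec k\<close>] by simp
    qed
  qed
  show "w \<in> carrier_vec k" by (rule w)
  show "(K * P) *\<^sub>v w = 0\<^sub>v k" using w K P by (auto simp: assoc_mult_mat_vec)
qed

text \<open>Penrose's argument: \<open>X * Y\<close> and \<open>X * Z\<close> are both the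
  orthogonal projection onto the image of \<open>X\<close>, and \<open>Y * X\<close>,
  \<open>Z * X\<close> agree for the same reason on the other side. Finally
  \<open>Y = Y * X * Y\<close> is determined by these two projections.\<close>

lemma is_pinv_unique:
  assumes Y: "is_pinv X Y" and Z: "is_pinv X Z"
  shows "Y = Z"
proof -
  define r k where "r = dim_row X" "k = dim_col X"
  have c: "X \<in> carrier_mat r k" "Y \<in> carrier_mat k r" "Z \<in> carrier_mat k r"
    using Y Z by (auto simp: is_pinv_def r_k_def)
  note y = Y[unfolded is_pinv_def] note z = Z[unfolded is_pinv_def]
  have XY': "X * Y \<in> carrier_mat r r" and XZ': "X * Z \<in> carrier_mat r r"
    and YX': "Y * X \<in> carrier_mat k k" and ZX': "Z * X \<in> carrier_mat k k" using c by auto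
  have "X * Y = X * Z * X * Y" using z by simp
  also have "\<dots> = transpose_mat (X * Z) * transpose_mat (X * Y)"
    using y z assoc_mult_mat[OF XZ' c(1,2)] by simp
  also have "\<dots> = transpose_mat (X * Y * (X * Z))" using transpose_mult[OF XY' XZ'] by simp
  also have "X * Y * (X * Z) = X * Z" using y assoc_mult_mat[OF XY' c(1,3)] by simp
  finally have XY: "X * Y = X * Z" using z by simp
  have "Y * X = Y * (X * Z * X)" using z by simp
  also have "\<dots> = Y * X * (Z * X)"
    using assoc_mult_mat[OF c(2,1) ZX'] assoc_mult_mat[OF c(1,3,1)] by simp
  also have "\<dots> = transpose_mat (Y * X) * transpose_mat (Z * X)" using y z by simp
  also have "\<dots> = transpose_mat (Z * X * (Y * X))" using transpose_mult[OF ZX' YX'] by simp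
  also have "Z * X * (Y * X) = Z * (X * Y * X)"
    using assoc_mult_mat[OF c(3,1) YX'] assoc_mult_mat[OF c(1,2,1)] by simp
  also have "\<dots> = Z * X" using y by simp
  finally have YX: "Y * X = Z * X" using z by simp
  have "Y = Y * X * Y" using y by simp
  also have "\<dots> = Z * X * Z" using assoc_mult_mat[OF c(3,1,2)] assoc_mult_mat[OF c(3,1,3)] XY YX by simp
  finally show ?thesis using z by simp
qed

text \<open>For an injective \<open>X\<close> the pseudo-inverse is \<open>(X\<^sup>T X)\<^sup>-\<^sup>1 X\<^sup>T\<close>.\<close>

lemma pinv_left_inverse:
  assumes X: "X \<in> carrier_mat r k"
    and inj: "\<And>w. w \<in> carrier_vec k \<Longrightarrow> X *\<^sub>v w = 0\<^sub>v r \<Longrightarrow> w = 0\<^sub>v k"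
  shows "pinv X \<in> carrier_mat k r" "pinv X * X = 1\<^sub>m k"
proof -
  define T where "T = transpose_mat X"
  have T: "T \<in> carrier_mat k r" using X by (simp add: T_def)
  define G where "G = T * X"
  have G: "G \<in> carrier_mat k k" using X T by (simp add: G_def)
  \<comment> \<open>A kernel vector \<open>w\<close> of the Gram matrix makes the squared length of
    \<open>X *\<^sub>v w\<close> zero, so injectivity of \<open>X\<close> applies.\<close>
  have "det G \<noteq> 0"
  proof
    assume "det G = 0"
    then obtain w where w: "w \<in> carrier_vec k" "w \<noteq> 0\<^sub>v k" "G *\<^sub>v w = 0\<^sub>v k"
      using det_0_iff_vec_prod_zero_field[OF G] by auto
    have Xw: "X *\<^sub>v w \<in> carrier_vec r" using X w by simp
    have "(X *\<^sub>v w) \<bullet> (X *\<^sub>v w) = (T *\<^sub>v (X *\<^sub>v w)) \<bullet> w"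
      using transpose_vec_mult_scalar[OF X w(1) Xw] Xw w X unfolding T_def
      by simp
    also have "T *\<^sub>v (X *\<^sub>v w) = 0\<^sub>v k" using w T X by (simp add: G_def)
    finally have "(X *\<^sub>v w) \<bullet> (X *\<^sub>v w) = 0" using w by simp
    then have "(\<Sum>i\<in>{0..<r}. (X *\<^sub>v w) $ i * (X *\<^sub>v w) $ i) = 0"
      using carrier_vecD[OF Xw] unfolding scalar_prod_def by metis
    then have "\<forall>i\<in>{0..<r}. (X *\<^sub>v w) $ i * (X *\<^sub>v w) $ i = 0"
      by (subst (asm) sum_nonneg_eq_0_iff) auto
    then have "X *\<^sub>v w = 0\<^sub>v r" using Xw X by (intro eq_vecI) auto
    with inj w show False by blast
  qed
  then obtain J where J: "J \<in> carrier_mat k k" "J * G = 1\<^sub>m k" "G * J = 1\<^sub>m k"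
    using det_non_zero_imp_unit[OF G] unfolding Units_def ring_mat_def by auto
  have GT: "transpose_mat G = G"
    using transpose_mult[OF T X] by (simp add: G_def T_def)
  have JT: "transpose_mat J = J"
  proof -
    have "transpose_mat J * G = 1\<^sub>m k" 
      using transpose_mult[OF G J(1)] J GT by simp
    then have "transpose_mat J * G * J = J" using J by simp
    moreover have "transpose_mat J * G * J = transpose_mat J"
      using J G by (metis assoc_mult_mat right_mult_one_mat transpose_carrier_mat)
    ultimately show ?thesis by simp
  qed
  define Y where "Y = J * T"
  have Y: "Y \<in> carrier_mat k r" using J T by (simp add: Y_def)
  have YX: "Y * X = 1\<^sub>m k" unfolding Y_def using J T X by (simp add: assoc_mult_mat G_def)
  have XYT: "transpose_mat (X * Y) = X * Y"
  proof -
    have "transpose_mat (X * Y) = transpose_mat Y * T" using transpose_mult[OF X Y] by (simp add: T_def)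
    also have "transpose_mat Y = X * J" unfolding Y_def using transpose_mult[OF J(1) T] JT by (simp add: T_def)
    also have "X * J * T = X * Y" unfolding Y_def using X J T by (simp add: assoc_mult_mat)
    finally show ?thesis .
  qed
  have "is_pinv X Y"
    unfolding is_pinv_def
  proof (intro conjI)
    show "X * Y * X = X" using X Y YX by (simp add: assoc_mult_mat)
  qed (use X Y YX XYT in auto)
  then have "pinv X = Y" unfolding pinv_def by (blast intro: the_equality is_pinv_unique)
  then show "pinv X \<in> carrier_mat k r" "pinv X * X = 1\<^sub>m k" using Y YX by auto
qed

subsection \<open>Cayley--Hamilton and reachable states\<close>

text \<open>Matrix powers unfold with the new factor on the right, whereas trajectories gain it on
  the left.\<close>

lemma pow_mat_mult_vec_Suc:
  fixes X :: "'a :: comm_semiring_1 mat"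
  assumes X: "X \<in> carrier_mat d d" and w: "w \<in> carrier_vec d"
  shows "X ^\<^sub>m Suc k *\<^sub>v w = X *\<^sub>v (X ^\<^sub>m k *\<^sub>v w)"
  using w
proof (induction k arbitrary: w)
  case 0
  then show ?case using X by simp
next
  case (Suc k)
  have Xk: "X ^\<^sub>m k \<in> carrier_mat d d" "X ^\<^sub>m Suc k \<in> carrier_mat d d" 
    using X by (metis pow_carrier_mat)+
  have "X ^\<^sub>m Suc (Suc k) *\<^sub>v w = X ^\<^sub>m Suc k *\<^sub>v (X *\<^sub>v w)" 
    using assoc_mult_mat_vec[OF Xk(2) X Suc.prems] by simp
  also have "\<dots> = X *\<^sub>v (X ^\<^sub>m k *\<^sub>v (X *\<^sub>v w))" using Suc.IH[of "X *\<^sub>v w"] X Suc.prems by simp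
  also have "X ^\<^sub>m k *\<^sub>v (X *\<^sub>v w) = X ^\<^sub>m Suc k *\<^sub>v w"
    using assoc_mult_mat_vec[OF Xk(1) X Suc.prems] by simp
  finally show ?case .
qed

lemma mult_mat_vec_index_sum:
  assumes "X \<in> carrier_mat r k" "w \<in> carrier_vec k" "i < r"
  shows "(X *\<^sub>v w) $ i = (\<Sum>j<k. X $$ (i, j) * w $ j)"
  using assms by (simp add: scalar_prod_def lessThan_atLeast0)

lemma mult_mat_index_sum:
  assumes "X \<in> carrier_mat r k" "Y \<in> carrier_mat k c" "i < r" "j < c"
  shows "(X * Y) $$ (i, j) = (\<Sum>l<k. X $$ (i, l) * Y $$ (l, j))"
  using assms by (simp add: scalar_prod_def lessThan_atLeast0)

text \<open>With \<open>G k\<close> the matrix of \<open>k\<close>-th coefficients of \<open>z adj (z I - H)\<close>, comparing coefficients in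
  \<open>(z I - H) adj (z I - H) = \<chi> I\<close> gives \<open>\<chi>\<^sub>k I = G k - H G (k + 1)\<close>; the sum of the
  \<open>H\<^sup>k (G k - H G (k + 1))\<close> telescopes.\<close>

lemma cayley_hamilton:
  fixes H :: "'a :: comm_ring_1 mat"
  assumes H: "H \<in> carrier_mat n n" and rc: "r < n" "c < n"
  shows "(\<Sum>k\<le>n. coeff (char_poly H) k * (H ^\<^sub>m k) $$ (r, c)) = 0"
proof -
  define M where "M = char_poly_matrix H"
  define J where "J = adj_mat M"
  define a where "a k = coeff (char_poly H) k" for k
  have M: "M \<in> carrier_mat n n" using H by (simp add: M_def)
  have J: "J \<in> carrier_mat n n" and MJ: "M * J = char_poly H \<cdot>\<^sub>m 1\<^sub>m n"
    using adj_mat[OF M] by (auto simp: J_def char_poly_def M_def)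
  define G where "G k = mat n n (\<lambda>(i, j). coeff (pCons 0 (J $$ (i, j))) k)" for k
  have G[simp]: "G k \<in> carrier_mat n n" for k by (simp add: G_def)
  have entry: "G k $$ (i, j) = (H * G (Suc k)) $$ (i, j) + a k * (1\<^sub>m n) $$ (i, j)"
    if ij: "i < n" "j < n" for i j k
  proof -
    have "char_poly H * (1\<^sub>m n) $$ (i, j) = (M * J) $$ (i, j)" using MJ ij by simp
    also have "\<dots> = (\<Sum>l<n. M $$ (i, l) * J $$ (l, j))"
      by (rule mult_mat_index_sum[OF M J ij])
    also have "\<dots> = (\<Sum>l<n. (if i = l then [:0, 1:] * J $$ (l, j) else 0) - smult (H $$ (i, l)) (J $$ (l, j)))"
      using H ij unfolding M_def char_poly_matrix_def
      by (intro sum.cong) (auto simp: algebra_simps)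
    also have "\<dots> = pCons 0 (J $$ (i, j)) - (\<Sum>l<n. smult (H $$ (i, l)) (J $$ (l, j)))"
      using ij by (simp add: sum_subtractf)
    finally have "coeff (char_poly H * (1\<^sub>m n) $$ (i, j)) k
      = G k $$ (i, j) - (\<Sum>l<n. H $$ (i, l) * G (Suc k) $$ (l, j))"
      using ij by (simp add: G_def coeff_sum)
    moreover have "coeff (char_poly H * (1\<^sub>m n) $$ (i, j)) k = a k * (1\<^sub>m n) $$ (i, j)"
      using ij by (simp add: a_def)
    ultimately show ?thesis using mult_mat_index_sum[OF H G ij] by simp
  qed
  define F where "F k = (H ^\<^sub>m k * G k) $$ (r, c)" for k
  have Hk: "H ^\<^sub>m k \<in> carrier_mat n n" for k using H by simp
  have step: "a k * (H ^\<^sub>m k) $$ (r, c) = F k - F (Suc k)" for k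
  proof -
    have "G k = H * G (Suc k) + a k \<cdot>\<^sub>m 1\<^sub>m n"
      using H entry by (intro eq_matI) (auto simp: carrier_matD[OF G])
    then have "H ^\<^sub>m k * G k = H ^\<^sub>m k * (H * G (Suc k)) + H ^\<^sub>m k * (a k \<cdot>\<^sub>m 1\<^sub>m n)"
      using mult_add_distrib_mat[OF Hk mult_carrier_mat[OF H G], of "a k \<cdot>\<^sub>m 1\<^sub>m n"] by simp
    also have "H ^\<^sub>m k * (H * G (Suc k)) = H ^\<^sub>m Suc k * G (Suc k)"
      using assoc_mult_mat[OF Hk H G, symmetric] by simp
    also have "H ^\<^sub>m k * (a k \<cdot>\<^sub>m 1\<^sub>m n) = a k \<cdot>\<^sub>m (H ^\<^sub>m k)"
      using mult_smult_distrib[OF Hk one_carrier_mat, where k = "a k"] right_mult_one_mat[OF Hk] by simp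
    finally have "F k = (H ^\<^sub>m Suc k * G (Suc k) + a k \<cdot>\<^sub>m H ^\<^sub>m k) $$ (r, c)" unfolding F_def by simp
    also have "\<dots> = F (Suc k) + a k * (H ^\<^sub>m k) $$ (r, c)"
      using rc carrier_matD[OF Hk] unfolding F_def
      by (subst index_add_mat) (auto simp del: pow_mat.simps simp: carrier_matD[OF G])
    finally show ?thesis by simp
  qed
  \<comment> \<open>\<open>K\<close> bounds the degrees of all entries of the adjugate, so that the
    telescope ends in zero, and is at least \<open>n\<close>, so that no coefficient of the
    characteristic polynomial is lost. The sum of all degrees is a crude but uniform choice.\<close>
  define K where "K = n + (\<Sum>i<n. \<Sum>j<n. degree (J $$ (i, j)))"
  have "degree (J $$ (i, j)) \<le> K" if "i < n" "j < n" for i j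
  proof -
    have "degree (J $$ (i, j)) \<le> (\<Sum>j<n. degree (J $$ (i, j)))"
      using that by (intro member_le_sum) auto
    also have "\<dots> \<le> (\<Sum>i<n. \<Sum>j<n. degree (J $$ (i, j)))"
      using that by (intro member_le_sum[of i _ "\<lambda>i. \<Sum>j<n. degree (J $$ (i, j))"]) auto
    finally show ?thesis by (simp add: K_def)
  qed
  then have "G (Suc (Suc K)) = 0\<^sub>m n n"
    by (intro eq_matI) (auto simp: G_def le_imp_less_Suc intro!: coeff_eq_0)
  then have FK: "F (Suc (Suc K)) = 0"
    using right_mult_zero_mat[OF Hk[of "Suc (Suc K)"], of n] rc
    unfolding F_def by (simp del: pow_mat.simps right_mult_zero_mat')
  \<comment> \<open>The extra factor z in \<open>G\<close> makes the other end of the telescope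
    vanish.\<close>
  have "G 0 = 0\<^sub>m n n" by (intro eq_matI) (auto simp: G_def)
  then have F0: "F 0 = 0" using H rc unfolding F_def by simp
  have "(\<Sum>k\<le>n. a k * (H ^\<^sub>m k) $$ (r, c)) = (\<Sum>k<Suc (Suc K). a k * (H ^\<^sub>m k) $$ (r, c))"
    using degree_monic_char_poly[OF H]
    by (intro sum.mono_neutral_left) (auto simp: K_def a_def coeff_eq_0)
  also have "\<dots> = (\<Sum>k<Suc (Suc K). F k - F (Suc k))" using step by simp
  also have "\<dots> = F 0 - F (Suc (Suc K))" by (rule sum_lessThan_telescope')
  finally show ?thesis using F0 FK by (simp add: a_def)
qed

lemma cayley_hamilton_vec:
  fixes H :: "'a :: comm_ring_1 mat"
  assumes H: "H \<in> carrier_mat n n" and w: "w \<in> carrier_vec n" and r: "r < n"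
  shows "(\<Sum>k\<le>n. coeff (char_poly H) k * (H ^\<^sub>m k *\<^sub>v w) $ r) = 0"
proof -
  have "(\<Sum>k\<le>n. coeff (char_poly H) k * (H ^\<^sub>m k *\<^sub>v w) $ r)
    = (\<Sum>k\<le>n. \<Sum>j<n. coeff (char_poly H) k * (H ^\<^sub>m k) $$ (r, j) * w $ j)"
    using mult_mat_vec_index_sum[OF pow_carrier_mat[OF H] w r]
    by (simp add: sum_distrib_left mult.assoc)
  also have "\<dots> = (\<Sum>j<n. (\<Sum>k\<le>n. coeff (char_poly H) k * (H ^\<^sub>m k) $$ (r, j)) * w $ j)"
    by (subst sum.swap) (simp add: sum_distrib_right)
  also have "\<dots> = 0" using cayley_hamilton[OF H r] by simp
  finally show ?thesis .
qed

text \<open>The input is a function of time instead of a stacked vector: one input can then drive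
  two pairs of different dimension, and idling, delaying and appending are operations on
  functions.\<close>

fun reach :: "real mat \<Rightarrow> real mat \<Rightarrow> (nat \<Rightarrow> real vec) \<Rightarrow> nat \<Rightarrow> real vec" where
  "reach X Y u 0 = 0\<^sub>v (dim_row X)"
| "reach X Y u (Suc t) = X *\<^sub>v reach X Y u t + Y *\<^sub>v u t"

lemma reach_carrier:
  assumes "X \<in> carrier_mat d d" "Y \<in> carrier_mat d m" "\<forall>t. u t \<in> carrier_vec m"
  shows "reach X Y u t \<in> carrier_vec d"
  using assms by (induction t) auto

lemma reach_cong:
  assumes "\<And>s. s < t \<Longrightarrow> u s = u' s"
  shows "reach X Y u t = reach X Y u' t"
  using assms by (induction t) auto

lemma mult_mat_zero_vec:
  fixes X :: "real mat"
  assumes "X \<in> carrier_mat r k"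
  shows "X *\<^sub>v 0\<^sub>v k = 0\<^sub>v r"
  using assms by (intro eq_vecI) auto

lemma reach_zero_input:
  assumes X: "X \<in> carrier_mat d d" and Y: "Y \<in> carrier_mat d m" and u: "\<And>s. s < t \<Longrightarrow> u s = 0\<^sub>v m"
  shows "reach X Y u t = 0\<^sub>v d"
  using u by (induction t) (use X mult_mat_zero_vec[OF X] mult_mat_zero_vec[OF Y] in auto)

text \<open>Zero input keeps the zero state, so waiting is free. This pads short inputs to full
  length and lets an experiment start after an idle phase.\<close>

lemma reach_delay:
  assumes "X \<in> carrier_mat d d" "Y \<in> carrier_mat d m"
    and "\<And>s. s < k \<Longrightarrow> u' s = 0\<^sub>v m" and "\<And>s. u' (k + s) = u s"
  shows "reach X Y u' (k + t) = reach X Y u t"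
proof (induction t)
  case 0
  have "reach X Y u' k = 0\<^sub>v d" by (rule reach_zero_input[OF assms(1-3)])
  then show ?case using assms by auto
next
  case (Suc t)
  then show ?case using assms by simp
qed

text \<open>The definition splits off the last input; splitting off the first one isolates the
  highest power of \<open>X\<close>, the term that Cayley--Hamilton removes.\<close>

lemma reach_Suc_first:
  assumes X: "X \<in> carrier_mat d d" and Y: "Y \<in> carrier_mat d m" and u: "\<forall>t. u t \<in> carrier_vec m"
  shows "reach X Y u (Suc t) = X ^\<^sub>m t *\<^sub>v (Y *\<^sub>v u 0) + reach X Y (\<lambda>s. u (Suc s)) t"
proof (induction t)
  case 0
  then show ?case using X Y u by (auto intro!: eq_vecI)
next
  case (Suc t)
  let ?r = "reach X Y (\<lambda>s. u (Suc s))"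
  have r: "?r t \<in> carrier_vec d" using reach_carrier[OF X Y] u by simp
  have Y0: "Y *\<^sub>v u 0 \<in> carrier_vec d" using Y u by simp
  have Xt: "X ^\<^sub>m t *\<^sub>v (Y *\<^sub>v u 0) \<in> carrier_vec d"
    using mult_mat_vec_carrier[OF pow_carrier_mat[OF X] Y0] .
  have "reach X Y u (Suc (Suc t)) = X *\<^sub>v (X ^\<^sub>m t *\<^sub>v (Y *\<^sub>v u 0) + ?r t) + Y *\<^sub>v u (Suc t)"
    using Suc by simp
  also have "\<dots> = X ^\<^sub>m Suc t *\<^sub>v (Y *\<^sub>v u 0) + X *\<^sub>v ?r t + Y *\<^sub>v u (Suc t)"
    using mult_add_distrib_mat_vec[OF X Xt r] pow_mat_mult_vec_Suc[OF X Y0, of t] by simp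
  also have "\<dots> = X ^\<^sub>m Suc t *\<^sub>v (Y *\<^sub>v u 0) + ?r (Suc t)"
    using assoc_add_vec[of "X ^\<^sub>m Suc t *\<^sub>v (Y *\<^sub>v u 0)" d "X *\<^sub>v ?r t" "Y *\<^sub>v u (Suc t)"]
      mult_mat_vec_carrier[OF pow_carrier_mat[OF X] Y0, of "Suc t"] X Y r u by simp
  finally show ?case .
qed

lemma reach_index:
  assumes X: "X \<in> carrier_mat d d" and Y: "Y \<in> carrier_mat d m"
    and u: "\<forall>t. u t \<in> carrier_vec m" and r: "r < d"
  shows "reach X Y u t $ r = (\<Sum>j<t. (X ^\<^sub>m (t - 1 - j) *\<^sub>v (Y *\<^sub>v u j)) $ r)"
  using u
proof (induction t arbitrary: u)
  case 0
  then show ?case using X r by simp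
next
  case (Suc t)
  have u': "\<forall>s. u (Suc s) \<in> carrier_vec m" using Suc.prems by blast
  have "reach X Y u (Suc t) $ r = (X ^\<^sub>m t *\<^sub>v (Y *\<^sub>v u 0)) $ r + reach X Y (\<lambda>s. u (Suc s)) t $ r"
    unfolding reach_Suc_first[OF X Y Suc.prems]
    using reach_carrier[OF X Y u', of t] r by simp
  also have "reach X Y (\<lambda>s. u (Suc s)) t $ r = (\<Sum>j<t. (X ^\<^sub>m (t - 1 - j) *\<^sub>v (Y *\<^sub>v u (Suc j))) $ r)"
    by (rule Suc.IH[OF u'])
  finally show ?case by (simp add: sum.lessThan_Suc_shift del: sum.lessThan_Suc)
qed

text \<open>Block matrices are encoded by \<open>div\<close> and \<open>mod\<close>; this is the
  passage from a flat index to a block number and an offset.\<close>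

lemma sum_div_mod:
  fixes g :: "nat \<Rightarrow> nat \<Rightarrow> 'a :: comm_monoid_add"
  shows "(\<Sum>s<k * m. g (s div m) (s mod m)) = (\<Sum>j<k. \<Sum>c<m. g j c)"
proof -
  have "(\<Sum>s<k * m. g (s div m) (s mod m)) = (\<Sum>j<k. \<Sum>s\<in>{j * m..<j * m + m}. g (s div m) (s mod m))"
    by (rule sum.nat_group[symmetric])
  also have "\<dots> = (\<Sum>j<k. \<Sum>c<m. g j c)"
  proof (rule sum.cong[OF refl])
    fix j
    have "(\<Sum>s\<in>{j * m..<j * m + m}. g (s div m) (s mod m))
      = (\<Sum>c<m. g ((c + j * m) div m) ((c + j * m) mod m))"
      using sum.shift_bounds_nat_ivl[of "\<lambda>s. g (s div m) (s mod m)" 0 "j * m" m]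
      by (simp add: lessThan_atLeast0 add.commute)
    then show "(\<Sum>s\<in>{j * m..<j * m + m}. g (s div m) (s mod m)) = (\<Sum>c<m. g j c)" by simp
  qed
  finally show ?thesis .
qed

lemma ctrb_carrier:
  assumes "X \<in> carrier_mat d d" "Y \<in> carrier_mat d m"
  shows "ctrb X Y \<in> carrier_mat d (d * m)"
  using assms by (auto simp: ctrb_def block_mat_def)

text \<open>The controllability matrix lists the highest power first, so the inputs are stacked in
  chronological order: the earliest one passes through \<open>X\<close> most often.\<close>

lemma ctrb_mult_vec:
  assumes X: "X \<in> carrier_mat d d" and Y: "Y \<in> carrier_mat d m"
    and u: "\<forall>t. u t \<in> carrier_vec m"
    and w: "w = vec (d * m) (\<lambda>s. u (s div m) $ (s mod m))"
  shows "ctrb X Y *\<^sub>v w = reach X Y u d"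
proof (rule eq_vecI)
  show "dim_vec (ctrb X Y *\<^sub>v w) = dim_vec (reach X Y u d)"
    using ctrb_carrier[OF X Y] reach_carrier[OF X Y u, of d] by simp
  fix r assume "r < dim_vec (reach X Y u d)"
  then have r: "r < d" using reach_carrier[OF X Y u, of d] by simp
  have XY: "X ^\<^sub>m k * Y \<in> carrier_mat d m" for k
    by (rule mult_carrier_mat[OF pow_carrier_mat[OF X] Y])
  have "(ctrb X Y *\<^sub>v w) $ r = (\<Sum>s<d * m. ctrb X Y $$ (r, s) * w $ s)"
    using w by (intro mult_mat_vec_index_sum[OF ctrb_carrier[OF X Y] _ r]) simp
  also have "\<dots> = (\<Sum>s<d * m. (X ^\<^sub>m (d - 1 - s div m) * Y) $$ (r, s mod m) * u (s div m) $ (s mod m))"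
    using X Y r by (intro sum.cong) (auto simp: ctrb_def block_mat_def w)
  also have "\<dots> = (\<Sum>j<d. \<Sum>c<m. (X ^\<^sub>m (d - 1 - j) * Y) $$ (r, c) * u j $ c)"
    by (rule sum_div_mod)
  also have "\<dots> = (\<Sum>j<d. ((X ^\<^sub>m (d - 1 - j) * Y) *\<^sub>v u j) $ r)"
    using mult_mat_vec_index_sum[OF XY _ r] u by simp
  also have "\<dots> = (\<Sum>j<d. (X ^\<^sub>m (d - 1 - j) *\<^sub>v (Y *\<^sub>v u j)) $ r)"
    using assoc_mult_mat_vec[OF pow_carrier_mat[OF X] Y] u by simp
  also have "\<dots> = reach X Y u d $ r" by (rule reach_index[OF X Y u r, symmetric])
  finally show "(ctrb X Y *\<^sub>v w) $ r = reach X Y u d $ r" .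
qed

lemma mat_im_ctrb:
  assumes X: "X \<in> carrier_mat d d" and Y: "Y \<in> carrier_mat d m"
  shows "mat_im (ctrb X Y) = {reach X Y u d | u. \<forall>t. u t \<in> carrier_vec m}"
proof (intro equalityI subsetI)
  fix z assume "z \<in> mat_im (ctrb X Y)"
  then obtain w where w: "w \<in> carrier_vec (d * m)" "z = ctrb X Y *\<^sub>v w"
    using ctrb_carrier[OF X Y] by (elim mat_imE)
  define u where "u t = vec m (\<lambda>c. w $ (t * m + c))" for t
  have u: "\<forall>t. u t \<in> carrier_vec m" by (simp add: u_def)
  have "w = vec (d * m) (\<lambda>s. u (s div m) $ (s mod m))"
  proof (rule eq_vecI)
    fix s assume "s < dim_vec (vec (d * m) (\<lambda>s. u (s div m) $ (s mod m)))"
    then have "s < d * m" by simp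
    then have "s mod m < m" by (metis gr_implies_not0 mod_less_divisor mult_is_0 neq0_conv)
    then show "w $ s = vec (d * m) (\<lambda>s. u (s div m) $ (s mod m)) $ s"
      using \<open>s < d * m\<close> by (simp add: u_def)
  qed (use w in simp)
  then have "z = reach X Y u d" using ctrb_mult_vec[OF X Y u] w by blast
  then show "z \<in> {reach X Y u d | u. \<forall>t. u t \<in> carrier_vec m}" using u by blast
next
  fix z assume "z \<in> {reach X Y u d | u. \<forall>t. u t \<in> carrier_vec m}"
  then obtain u where u: "\<forall>t. u t \<in> carrier_vec m" "z = reach X Y u d" by blast
  then show "z \<in> mat_im (ctrb X Y)"
    using mat_imI[OF ctrb_carrier[OF X Y] vec_carrier[of "d * m" "\<lambda>s. u (s div m) $ (s mod m)"]]
      ctrb_mult_vec[OF X Y u(1) refl] by simp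
qed

text \<open>The first of \<open>d + 1\<close> inputs acts through \<open>X ^\<^sub>m d\<close>.
  Cayley--Hamilton spreads this over the lower powers, and each lower power belongs to one of the
  later inputs, which can absorb its share: the input at time \<open>s\<close> of the shortened
  sequence acts through the power \<open>d - 1 - s\<close>.\<close>

lemma reach_reduce:
  assumes X: "X \<in> carrier_mat d d" and Y: "Y \<in> carrier_mat d m" and u: "\<forall>t. u t \<in> carrier_vec m"
  obtains u' where "\<forall>t. u' t \<in> carrier_vec m" "reach X Y u (Suc d) = reach X Y u' d"
proof -
  define a where "a k = coeff (char_poly X) k" for k
  define u' where "u' s = u (Suc s) + (- a (d - 1 - s)) \<cdot>\<^sub>v u 0" for s
  have u': "\<forall>s. u' s \<in> carrier_vec m" using u by (simp add: u'_def)
  have us: "\<forall>s. u (Suc s) \<in> carrier_vec m" using u by blast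
  have Y0: "Y *\<^sub>v u 0 \<in> carrier_vec d" using Y u by simp
  have "reach X Y u (Suc d) = reach X Y u' d"
  proof (rule eq_vecI)
    show "dim_vec (reach X Y u (Suc d)) = dim_vec (reach X Y u' d)"
      using reach_carrier[OF X Y u, of "Suc d"] reach_carrier[OF X Y u', of d] by (metis carrier_vecD)
    fix r assume "r < dim_vec (reach X Y u' d)"
    then have r: "r < d" using reach_carrier[OF X Y u', of d] by simp
    let ?p = "\<lambda>k w. (X ^\<^sub>m k *\<^sub>v w) $ r"
    have lin: "?p k (Y *\<^sub>v u' j) = ?p k (Y *\<^sub>v u (Suc j)) - a (d - 1 - j) * ?p k (Y *\<^sub>v u 0)" for k j
    proof -
      have "Y *\<^sub>v u' j = Y *\<^sub>v u (Suc j) + (- a (d - 1 - j)) \<cdot>\<^sub>v (Y *\<^sub>v u 0)"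
        using Y u us unfolding u'_def
        by (subst mult_add_distrib_mat_vec[OF Y]) (auto simp: mult_mat_vec[OF Y])
      moreover have Xk: "X ^\<^sub>m k \<in> carrier_mat d d" using X by simp
      ultimately have "X ^\<^sub>m k *\<^sub>v (Y *\<^sub>v u' j)
        = X ^\<^sub>m k *\<^sub>v (Y *\<^sub>v u (Suc j)) + (- a (d - 1 - j)) \<cdot>\<^sub>v (X ^\<^sub>m k *\<^sub>v (Y *\<^sub>v u 0))"
        using Y us Y0
        by (simp add: mult_add_distrib_mat_vec[OF Xk] mult_mat_vec[OF Xk])
      then show ?thesis using r carrier_matD(1)[OF Xk] by (simp del: pow_mat_dim pow_mat_dim_square index_mult_mat_vec)
    qed
    have "reach X Y u' d $ r = (\<Sum>j<d. ?p (d - 1 - j) (Y *\<^sub>v u' j))"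
      by (rule reach_index[OF X Y u' r])
    also have "\<dots> = (\<Sum>j<d. ?p (d - 1 - j) (Y *\<^sub>v u (Suc j)))
      - (\<Sum>j<d. a (d - 1 - j) * ?p (d - 1 - j) (Y *\<^sub>v u 0))"
      unfolding lin by (simp add: sum_subtractf)
    also have "(\<Sum>j<d. ?p (d - 1 - j) (Y *\<^sub>v u (Suc j))) = reach X Y (\<lambda>s. u (Suc s)) d $ r"
      by (rule reach_index[OF X Y us r, symmetric])
    also have "(\<Sum>j<d. a (d - 1 - j) * ?p (d - 1 - j) (Y *\<^sub>v u 0)) = (\<Sum>k<d. a k * ?p k (Y *\<^sub>v u 0))"
      using sum.nat_diff_reindex[of "\<lambda>k. a k * ?p k (Y *\<^sub>v u 0)" d] by simp
    \<comment> \<open>The characteristic polynomial is monic, so Cayley--Hamilton solves for the top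
      power.\<close>
    also have "\<dots> = - ?p d (Y *\<^sub>v u 0)"
      using cayley_hamilton_vec[OF X Y0 r] degree_monic_char_poly[OF X]
      by (simp add: a_def lessThan_Suc_atMost[symmetric] del: lessThan_Suc_atMost)
    finally show "reach X Y u (Suc d) $ r = reach X Y u' d $ r"
      unfolding reach_Suc_first[OF X Y u] using reach_carrier[OF X Y us, of d] r by simp
  qed
  with u' show thesis by (rule that)
qed

lemma reach_in_mat_im_ctrb:
  assumes X: "X \<in> carrier_mat d d" and Y: "Y \<in> carrier_mat d m" and u: "\<forall>t. u t \<in> carrier_vec m"
  shows "reach X Y u t \<in> mat_im (ctrb X Y)"
proof (cases "t \<le> d")
  case True
  \<comment> \<open>An input shorter than \<open>d\<close> is padded with zeros in front, not at the
    end, where the state would move on.\<close>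
  define u' where "u' s = (if s < d - t then 0\<^sub>v m else u (s - (d - t)))" for s
  have "reach X Y u' (d - t + t) = reach X Y u t"
    by (rule reach_delay[OF X Y]) (auto simp: u'_def)
  then show ?thesis using True u by (auto simp: mat_im_ctrb[OF X Y] u'_def intro!: exI[of _ u'])
next
  case False
  have "\<exists>u'. (\<forall>t. u' t \<in> carrier_vec m) \<and> reach X Y u (d + k) = reach X Y u' d" for k
  proof (induction k)
    case 0
    then show ?case using u by auto
  next
    case (Suc k)
    then obtain u' where u': "\<forall>t. u' t \<in> carrier_vec m" "reach X Y u (d + k) = reach X Y u' d" by blast
    \<comment> \<open>The first \<open>d + k\<close> inputs are already compressed to
      \<open>d\<close>; appending the next one gives \<open>d + 1\<close> inputs, which are
      compressed once more.\<close>
    define u2 where "u2 = u'(d := u (d + k))"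
    have "\<forall>t. u2 t \<in> carrier_vec m" using u u' by (simp add: u2_def)
    moreover have "reach X Y u2 d = reach X Y u' d" by (rule reach_cong) (simp add: u2_def)
    then have "reach X Y u (d + Suc k) = reach X Y u2 (Suc d)" using u'(2) by (simp add: u2_def)
    ultimately show ?case using reach_reduce[OF X Y] by metis
  qed
  from this[of "t - d"] False show ?thesis by (auto simp: mat_im_ctrb[OF X Y])
qed

text \<open>The state reached at time \<open>d\<close> does not depend on the input at that time,
  which can therefore be set to \<open>w\<close>. Thus the reachable subspace is left invariant by a
  step with any input.\<close>

lemma mat_im_ctrb_step:
  assumes X: "X \<in> carrier_mat d d" and Y: "Y \<in> carrier_mat d m"
    and z: "z \<in> mat_im (ctrb X Y)" and w: "w \<in> carrier_vec m"
  obtains u where "\<forall>t. u t \<in> carrier_vec m" "z = reach X Y u d"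
    "X *\<^sub>v z + Y *\<^sub>v w = reach X Y u (Suc d)" "u d = w"
proof -
  obtain u where u: "\<forall>t. u t \<in> carrier_vec m" "z = reach X Y u d"
    using z by (auto simp: mat_im_ctrb[OF X Y])
  have "reach X Y (u(d := w)) d = z" unfolding u(2) by (rule reach_cong) simp
  then show thesis using u(1) w by (intro that[of "u(d := w)"]) auto
qed

lemma controllable_iff:
  assumes X: "X \<in> carrier_mat d d" and Y: "Y \<in> carrier_mat d m"
  shows "controllable X Y \<longleftrightarrow> mat_im (ctrb X Y) = carrier_vec d"
  using surj_if_mat_rank_eq_dim_row[OF ctrb_carrier[OF X Y]]
    mat_rank_eq_dim_row_if_surj[OF ctrb_carrier[OF X Y]] X
  unfolding controllable_def by auto

subsection \<open>The reduced realization\<close>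

lemma reduced_realization:
  assumes A: "A \<in> carrier_mat n n" and B: "B \<in> carrier_mat n m" and C: "C \<in> carrier_mat p n"
    and ctrl: "controllable A B"
    and X: "X \<in> carrier_mat N N" and Y: "Y \<in> carrier_mat N m" and E: "E \<in> carrier_mat n N"
    and lift: "\<And>u t. \<forall>t. u t \<in> carrier_vec m \<Longrightarrow> E *\<^sub>v reach X Y u t = reach A B u t"
    and P: "P \<in> carrier_mat N k" and im: "mat_im P = mat_im (ctrb X Y)"
    and inj: "\<And>w. w \<in> carrier_vec k \<Longrightarrow> P *\<^sub>v w = 0\<^sub>v N \<Longrightarrow> w = 0\<^sub>v k"
  shows "mat_rank (E * P) = n"
    and "consistent_with (pinv P * X * P) (pinv P * Y) (C * E * P) A B C"
    and "controllable (pinv P * X * P) (pinv P * Y)"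
proof -
  have EP: "E * P \<in> carrier_mat n k" using E P by simp
  note PI = pinv_left_inverse[OF P inj]
  define X' Y' where "X' = pinv P * X * P" and "Y' = pinv P * Y"
  have PX: "pinv P * X \<in> carrier_mat k N" using PI X by simp
  have X': "X' \<in> carrier_mat k k" and Y': "Y' \<in> carrier_mat k m"
    unfolding X'_def Y'_def using mult_carrier_mat[OF PX P] PI Y by auto
  have left_inv: "pinv P *\<^sub>v (P *\<^sub>v v) = v" if "v \<in> carrier_vec k" for v
    using assoc_mult_mat_vec[OF PI(1) P that] PI that by simp
  have surj: "\<exists>v\<in>carrier_vec k. x = E *\<^sub>v (P *\<^sub>v v)" if x: "x \<in> carrier_vec n" for x
  proof -
    have "x \<in> mat_im (ctrb A B)" using ctrl x controllable_iff[OF A B] by simp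
    then obtain u where u: "\<forall>t. u t \<in> carrier_vec m" "x = reach A B u n"
      unfolding mat_im_ctrb[OF A B] by blast
    have "reach X Y u n \<in> mat_im P" unfolding im by (rule reach_in_mat_im_ctrb[OF X Y u(1)])
    then obtain v where "v \<in> carrier_vec k" "reach X Y u n = P *\<^sub>v v" using P by (elim mat_imE)
    then show ?thesis using lift[OF u(1), of n] u(2) by metis
  qed
  show "mat_rank (E * P) = n"
  proof (rule mat_rank_eq_dim_row_if_surj[OF EP], intro equalityI subsetI)
    show "z \<in> carrier_vec n" if "z \<in> mat_im (E * P)" for z
      using that mat_im_subset_carrier[of "E * P"] E by auto
    fix x :: "real vec" assume "x \<in> carrier_vec n"
    then obtain v where v: "v \<in> carrier_vec k" "x = E *\<^sub>v (P *\<^sub>v v)" using surj by blast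
    then show "x \<in> mat_im (E * P)"
      using mat_imI[OF EP v(1)] assoc_mult_mat_vec[OF E P v(1)] by simp
  qed
  \<comment> \<open>The successor of a reached state is reached, hence equal to
    \<open>P *\<^sub>v v'\<close> for some \<open>v'\<close>, and the left inverse recovers exactly
    \<open>v'\<close>. The second identity applies \<open>lift\<close> to one input at two
    consecutive times.\<close>
  have step: "P *\<^sub>v (X' *\<^sub>v v + Y' *\<^sub>v w) = X *\<^sub>v (P *\<^sub>v v) + Y *\<^sub>v w"
    and Estep: "E *\<^sub>v (X *\<^sub>v (P *\<^sub>v v) + Y *\<^sub>v w) = A *\<^sub>v (E *\<^sub>v (P *\<^sub>v v)) + B *\<^sub>v w"
    if v: "v \<in> carrier_vec k" and w: "w \<in> carrier_vec m" for v w
  proof -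
    have Pv: "P *\<^sub>v v \<in> carrier_vec N" using P v by simp
    have "P *\<^sub>v v \<in> mat_im (ctrb X Y)" using mat_imI[OF P v] im by simp
    from mat_im_ctrb_step[OF X Y this w] obtain u where u: "\<forall>t. u t \<in> carrier_vec m"
      "P *\<^sub>v v = reach X Y u N" "X *\<^sub>v (P *\<^sub>v v) + Y *\<^sub>v w = reach X Y u (Suc N)" "u N = w" by blast
    have "X *\<^sub>v (P *\<^sub>v v) + Y *\<^sub>v w \<in> mat_im P"
      unfolding u(3) im by (rule reach_in_mat_im_ctrb[OF X Y u(1)])
    then obtain v' where v': "v' \<in> carrier_vec k" "X *\<^sub>v (P *\<^sub>v v) + Y *\<^sub>v w = P *\<^sub>v v'"
      using P by (elim mat_imE)
    have "X' *\<^sub>v v + Y' *\<^sub>v w = pinv P *\<^sub>v (X *\<^sub>v (P *\<^sub>v v)) + pinv P *\<^sub>v (Y *\<^sub>v w)"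
      unfolding X'_def Y'_def
      using assoc_mult_mat_vec[OF PX P v] assoc_mult_mat_vec[OF PI(1) X Pv]
        assoc_mult_mat_vec[OF PI(1) Y w] by simp
    also have "\<dots> = pinv P *\<^sub>v (X *\<^sub>v (P *\<^sub>v v) + Y *\<^sub>v w)"
      using X Y Pv w by (intro mult_add_distrib_mat_vec[OF PI(1), symmetric]) auto
    also have "\<dots> = v'" unfolding v'(2) by (rule left_inv[OF v'(1)])
    finally show "P *\<^sub>v (X' *\<^sub>v v + Y' *\<^sub>v w) = X *\<^sub>v (P *\<^sub>v v) + Y *\<^sub>v w" using v'(2) by simp
    have "E *\<^sub>v (X *\<^sub>v (P *\<^sub>v v) + Y *\<^sub>v w) = A *\<^sub>v reach A B u N + B *\<^sub>v w"
      unfolding u(3) lift[OF u(1)] using u(4) by simp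
    also have "reach A B u N = E *\<^sub>v (P *\<^sub>v v)" unfolding u(2) by (rule lift[OF u(1), symmetric])
    finally show "E *\<^sub>v (X *\<^sub>v (P *\<^sub>v v) + Y *\<^sub>v w) = A *\<^sub>v (E *\<^sub>v (P *\<^sub>v v)) + B *\<^sub>v w" .
  qed
  show "consistent_with (pinv P * X * P) (pinv P * Y) (C * E * P) A B C"
    unfolding consistent_with_def X'_def[symmetric] Y'_def[symmetric]
  proof (intro allI impI)
    fix u x y assume traj: "lti_trajectory A B C u x y"
    have u: "u t \<in> carrier_vec m" and x: "x t \<in> carrier_vec n"
      and x_Suc: "x (Suc t) = A *\<^sub>v x t + B *\<^sub>v u t" and y: "y t = C *\<^sub>v x t" for t
      using traj A B unfolding lti_trajectory_def by auto
    \<comment> \<open>The trajectory may start anywhere; surjectivity of \<open>E * P\<close>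
      supplies a matching reduced initial state.\<close>
    obtain v0 where v0: "v0 \<in> carrier_vec k" "x 0 = E *\<^sub>v (P *\<^sub>v v0)" using surj[OF x] by blast
    define v where "v = rec_nat v0 (\<lambda>t w. X' *\<^sub>v w + Y' *\<^sub>v u t)"
    have v_simps: "v 0 = v0" "v (Suc t) = X' *\<^sub>v v t + Y' *\<^sub>v u t" for t by (auto simp: v_def)
    have v: "v t \<in> carrier_vec k" for t
      by (induction t) (use v0 X' Y' u in \<open>auto simp: v_simps\<close>)
    have xv: "x t = E *\<^sub>v (P *\<^sub>v v t)" for t
      by (induction t) (use v0 in \<open>simp_all add: v_simps x_Suc step[OF v u] Estep[OF v u]\<close>)
    have CE: "C * E \<in> carrier_mat p N" using C E by simp
    have "y t = (C * E * P) *\<^sub>v v t" for t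
      using assoc_mult_mat_vec[OF CE P v] assoc_mult_mat_vec[OF C E mult_mat_vec_carrier[OF P v]]
        y xv by simp
    then have "lti_trajectory X' Y' (C * E * P) u v y"
      unfolding lti_trajectory_def using X' Y' u v v_simps by auto
    then show "\<exists>v. lti_trajectory X' Y' (C * E * P) u v y" by blast
  qed
  have "mat_im (ctrb X' Y') = carrier_vec k"
  proof (intro equalityI subsetI)
    show "z \<in> carrier_vec k" if "z \<in> mat_im (ctrb X' Y')" for z
      using that mat_im_subset_carrier[of "ctrb X' Y'"] ctrb_carrier[OF X' Y'] by auto
    fix v :: "real vec" assume v: "v \<in> carrier_vec k"
    have "P *\<^sub>v v \<in> mat_im (ctrb X Y)" using mat_imI[OF P v] im by simp
    then obtain u where u: "\<forall>t. u t \<in> carrier_vec m" "P *\<^sub>v v = reach X Y u N"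
      unfolding mat_im_ctrb[OF X Y] by blast
    have "P *\<^sub>v reach X' Y' u t = reach X Y u t" for t
    proof (induction t)
      case 0
      then show ?case using P X X' by (auto intro!: eq_vecI)
    next
      case (Suc t)
      then show ?case using step[OF reach_carrier[OF X' Y' u(1)]] u(1) by simp
    qed
    \<comment> \<open>The full system needs \<open>N\<close> steps, more than the \<open>k\<close>
      recorded in the reduced controllability matrix if \<open>k\<close> is smaller; the number of
      steps is immaterial for the image.\<close>
    with u(2) have "reach X' Y' u N = v"
      using left_inv[OF v] left_inv[OF reach_carrier[OF X' Y' u(1)]] by metis
    then show "v \<in> mat_im (ctrb X' Y')" using reach_in_mat_im_ctrb[OF X' Y' u(1), of N] by simp
  qed
  then show "controllable (pinv P * X * P) (pinv P * Y)"
    using controllable_iff[OF X' Y'] by (simp add: X'_def Y'_def)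
qed

section \<open>Shifts, injections and sliding windows\<close>

lemma hcat_carrier:
  "X \<in> carrier_mat r j \<Longrightarrow> Y \<in> carrier_mat r k \<Longrightarrow> hcat X Y \<in> carrier_mat r (j + k)"
  by (auto simp: hcat_def)

lemma hcat_mult_vec:
  assumes "X \<in> carrier_mat r j" "Y \<in> carrier_mat r k" "v \<in> carrier_vec j" "w \<in> carrier_vec k"
  shows "hcat X Y *\<^sub>v (v @\<^sub>v w) = X *\<^sub>v v + Y *\<^sub>v w"
proof -
  have "hcat X Y *\<^sub>v (v @\<^sub>v w)
    = (X *\<^sub>v v + Y *\<^sub>v w) @\<^sub>v (0\<^sub>m 0 (dim_col X) *\<^sub>v v + 0\<^sub>m 0 (dim_col Y) *\<^sub>v w)"
    unfolding hcat_def using assms by (intro four_block_mat_mult_vec) auto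
  also have "\<dots> = X *\<^sub>v v + Y *\<^sub>v w" by (intro eq_vecI) auto
  finally show ?thesis .
qed

text \<open>Positivity of \<open>n\<close> matters: at \<open>n = 0\<close> the truncated
  \<open>n - 1\<close> would leave a \<open>k\<close> by \<open>k\<close> matrix instead of an empty
  one.\<close>

lemma shift_mat_altdef:
  assumes "0 < n"
  shows "shift_mat n k = mat (k * n) (k * n) (\<lambda>(i, j). if j = i + k then 1 else 0)"
proof -
  have "k * (n - 1) + k = k * n" using assms by (cases n) auto
  then show ?thesis by (intro eq_matI) (auto simp: shift_mat_def)
qed

lemma shift_mat_mult_vec:
  assumes n: "0 < n" and w: "w \<in> carrier_vec (k * n)" and i: "i < k * n"
  shows "(shift_mat n k *\<^sub>v w) $ i = (if i + k < k * n then w $ (i + k) else 0)"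
proof -
  have S: "shift_mat n k \<in> carrier_mat (k * n) (k * n)" by (simp add: shift_mat_altdef[OF n])
  have "(shift_mat n k *\<^sub>v w) $ i = (\<Sum>j<k * n. if j = i + k then w $ j else 0)"
    unfolding mult_mat_vec_index_sum[OF S w i]
    using i by (intro sum.cong) (auto simp: shift_mat_altdef[OF n])
  then show ?thesis by simp
qed

text \<open>Common shape of \<open>io_B\<close> and \<open>io_Gamma\<close>: a vector is copied into
  the rows from \<open>off\<close> on, here the slot for the newest input or output.\<close>

definition inject_mat :: "nat \<Rightarrow> nat \<Rightarrow> nat \<Rightarrow> real mat" where
  "inject_mat N off k = mat N k (\<lambda>(i, c). if i = off + c then 1 else 0)"

lemma inject_mat_mult_vec:
  assumes w: "w \<in> carrier_vec k" and i: "i < N"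
  shows "(inject_mat N off k *\<^sub>v w) $ i = (if off \<le> i \<and> i < off + k then w $ (i - off) else 0)"
proof -
  have S: "inject_mat N off k \<in> carrier_mat N k" by (simp add: inject_mat_def)
  have "(inject_mat N off k *\<^sub>v w) $ i = (\<Sum>c<k. if off \<le> i \<and> c = i - off then w $ c else 0)"
    unfolding mult_mat_vec_index_sum[OF S w i]
    using i by (intro sum.cong) (auto simp: inject_mat_def)
  then show ?thesis by (cases "off \<le> i") auto
qed

lemma io_B_altdef:
  assumes "0 < n"
  shows "io_B n m p = inject_mat (m * n + p * n) (m * (n - 1)) m"
proof -
  have "m * (n - 1) + m = m * n" using assms by (cases n) auto
  then show ?thesis by (intro eq_matI) (auto simp: io_B_def hcat_def inject_mat_def)
qed

lemma io_Gamma_altdef: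
  assumes "0 < n"
  shows "io_Gamma n m p = inject_mat (m * n + p * n) (m * n + p * (n - 1)) p"
proof -
  have "m * n + p * (n - 1) + p = m * n + p * n" using assms by (cases n) auto
  then show ?thesis by (intro eq_matI) (auto simp: io_Gamma_def hcat_def inject_mat_def)
qed

lemma diag_block_mat_pair_mult_vec:
  fixes X Y :: "real mat"
  assumes X: "X \<in> carrier_mat r j" and Y: "Y \<in> carrier_mat q k"
    and v: "v \<in> carrier_vec j" and w: "w \<in> carrier_vec k"
  shows "diag_block_mat [X, Y] *\<^sub>v (v @\<^sub>v w) = (X *\<^sub>v v) @\<^sub>v (Y *\<^sub>v w)"
proof -
  have "diag_block_mat [X, Y] = four_block_mat X (0\<^sub>m r k) (0\<^sub>m q j) Y"
    using X Y by (subst diag_block_mat.simps(2)) (simp only: diag_block_mat_singleton Let_def carrier_matD)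
  also have "\<dots> *\<^sub>v (v @\<^sub>v w) = (X *\<^sub>v v + 0\<^sub>m r k *\<^sub>v w) @\<^sub>v (0\<^sub>m q j *\<^sub>v v + Y *\<^sub>v w)"
    using assms by (intro four_block_mat_mult_vec) auto
  also have "\<dots> = (X *\<^sub>v v) @\<^sub>v (Y *\<^sub>v w)" using assms by (intro eq_vecI) auto
  finally show ?thesis .
qed

text \<open>Indexed by its oldest time, so that the truncated subtraction of
  \<open>io_history\<close> stays out of the computations.\<close>

definition window :: "nat \<Rightarrow> nat \<Rightarrow> (nat \<Rightarrow> real vec) \<Rightarrow> nat \<Rightarrow> real vec" where
  "window n k f s = vec (k * n) (\<lambda>i. f (s + i div k) $ (i mod k))"

lemma window_carrier[simp]: "window n k f s \<in> carrier_vec (k * n)"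
  by (simp add: window_def)

lemma dim_window[simp]: "dim_vec (window n k f s) = k * n"
  by (simp add: window_def)

lemma io_history_eq_window:
  "io_history n m p u y t = window n m u (t - n) @\<^sub>v window n p y (t - n)"
  by (simp add: io_history_def window_def)

text \<open>Advancing by one time step drops the oldest block, shifts the others and lets the newest
  value enter at the end; this is the row form of a shift plus an injection.\<close>

lemma window_Suc:
  assumes "i < k * n"
  shows "window n k f (Suc s) $ i
    = (if i + k < k * n then window n k f s $ (i + k) else f (s + n) $ (i - k * (n - 1)))"
proof -
  have k: "0 < k" using assms by (metis gr0I mult_0 not_less_zero)
  show ?thesis
  proof (cases "i + k < k * n")
    case True
    then show ?thesis using k assms by (simp add: window_def)
  next
    case False
    have "k * (n - 1) \<le> i" using False by (cases n) auto
    then obtain c where c: "i = k * (n - 1) + c" by (metis le_Suc_ex)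
    have "c < k" using assms c by (cases n) auto
    then have "i div k = n - 1" "i mod k = c" using c by auto
    moreover have "0 < n" using assms by (metis gr0I mult_0_right not_less_zero)
    ultimately show ?thesis using False c assms by (simp add: window_def)
  qed
qed

text \<open>Superposition of the free motion and the response from rest.\<close>

lemma lti_trajectory_split:
  assumes A: "A \<in> carrier_mat n n" and B: "B \<in> carrier_mat n m" and traj: "lti_trajectory A B C u x y"
  shows "x (s + t) = A ^\<^sub>m t *\<^sub>v x s + reach A B (\<lambda>j. u (s + j)) t"
proof (induction t)
  case 0
  then show ?case using A traj by (auto simp: lti_trajectory_def)
next
  case (Suc t)
  have xs: "x s \<in> carrier_vec n" using traj A by (auto simp: lti_trajectory_def)
  have u: "\<forall>j. u (s + j) \<in> carrier_vec m" using traj B by (auto simp: lti_trajectory_def)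
  note r = reach_carrier[OF A B u]
  have At: "A ^\<^sub>m t *\<^sub>v x s \<in> carrier_vec n" for t
    using mult_mat_vec_carrier[OF pow_carrier_mat[OF A] xs] .
  have "x (s + Suc t) = A *\<^sub>v (A ^\<^sub>m t *\<^sub>v x s + reach A B (\<lambda>j. u (s + j)) t) + B *\<^sub>v u (s + t)"
    using traj Suc by (simp add: lti_trajectory_def)
  also have "\<dots> = A ^\<^sub>m Suc t *\<^sub>v x s + A *\<^sub>v reach A B (\<lambda>j. u (s + j)) t + B *\<^sub>v u (s + t)"
    unfolding mult_add_distrib_mat_vec[OF A At r] pow_mat_mult_vec_Suc[OF A xs] ..
  also have "\<dots> = A ^\<^sub>m Suc t *\<^sub>v x s + (A *\<^sub>v reach A B (\<lambda>j. u (s + j)) t + B *\<^sub>v u (s + t))"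
    using A B u r by (intro assoc_add_vec[OF At]) auto
  finally show ?case by simp
qed

subsection \<open>Delayed inputs and outputs\<close>

locale observable_lti =
  fixes A B C :: "real mat" and n m p :: nat
  assumes n: "0 < n"
    and A: "A \<in> carrier_mat n n" and B: "B \<in> carrier_mat n m" and C: "C \<in> carrier_mat p n"
    and obs: "observable A C"
begin

lemma lti_trajectoryD:
  assumes "lti_trajectory A B C u x y"
  shows "\<forall>t. u t \<in> carrier_vec m" "\<forall>t. x t \<in> carrier_vec n"
    "x (Suc t) = A *\<^sub>v x t + B *\<^sub>v u t" "y t = C *\<^sub>v x t" "\<forall>t. y t \<in> carrier_vec p"
  using assms A B C unfolding lti_trajectory_def by auto

abbreviation (input) "Ob \<equiv> obsv A C"
abbreviation (input) "Tz \<equiv> io_toeplitz A B C"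

lemma obsv_carrier: "Ob \<in> carrier_mat (p * n) n"
  using A C by (auto simp: obsv_def block_mat_def mult.commute)

lemma toeplitz_carrier: "Tz \<in> carrier_mat (p * n) (m * n)"
  using A B C by (auto simp: io_toeplitz_def block_mat_def Let_def mult.commute)

lemma pinv_obsv: "pinv Ob \<in> carrier_mat n (p * n)" "pinv Ob * Ob = 1\<^sub>m n"
proof -
  have "mat_rank Ob = n" using obs A by (simp add: observable_def)
  note inj = inj_if_mat_rank_eq_dim_col[OF obsv_carrier this]
  show "pinv Ob \<in> carrier_mat n (p * n)" "pinv Ob * Ob = 1\<^sub>m n"
    by (rule pinv_left_inverse[OF obsv_carrier inj]; assumption)+
qed

text \<open>The forced output is the convolution of the input with the Markov parameters, which are
  the blocks of the Toeplitz matrix. Only inputs before time \<open>i\<close> enter, matching its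
  strictly lower triangular form.\<close>

lemma output_reach_index:
  assumes u: "\<forall>t. u t \<in> carrier_vec m" and c: "c < p"
  shows "(C *\<^sub>v reach A B u i) $ c = (\<Sum>j<i. ((C * A ^\<^sub>m (i - j - 1) * B) *\<^sub>v u j) $ c)"
proof -
  have Bu: "B *\<^sub>v u j \<in> carrier_vec n" for j using B u by simp
  have "(C *\<^sub>v reach A B u i) $ c = (\<Sum>l<n. C $$ (c, l) * reach A B u i $ l)"
    by (rule mult_mat_vec_index_sum[OF C reach_carrier[OF A B u] c])
  also have "\<dots> = (\<Sum>l<n. \<Sum>j<i. C $$ (c, l) * (A ^\<^sub>m (i - 1 - j) *\<^sub>v (B *\<^sub>v u j)) $ l)"
    by (intro sum.cong[OF refl]) (simp only: lessThan_iff reach_index[OF A B u] sum_distrib_left)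
  also have "\<dots> = (\<Sum>j<i. \<Sum>l<n. C $$ (c, l) * (A ^\<^sub>m (i - 1 - j) *\<^sub>v (B *\<^sub>v u j)) $ l)"
    by (rule sum.swap)
  also have "\<dots> = (\<Sum>j<i. (C *\<^sub>v (A ^\<^sub>m (i - 1 - j) *\<^sub>v (B *\<^sub>v u j))) $ c)"
    by (intro sum.cong[OF refl] mult_mat_vec_index_sum[OF C _ c, symmetric]
        mult_mat_vec_carrier[OF pow_carrier_mat[OF A] Bu])
  also have "\<dots> = (\<Sum>j<i. ((C * A ^\<^sub>m (i - j - 1) * B) *\<^sub>v u j) $ c)"
  proof (rule sum.cong[OF refl])
    fix j
    note Ak = pow_carrier_mat[OF A, of "i - j - 1"]
    have uj: "u j \<in> carrier_vec m" using u by simp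
    have "(C * A ^\<^sub>m (i - j - 1) * B) *\<^sub>v u j = C *\<^sub>v (A ^\<^sub>m (i - j - 1) *\<^sub>v (B *\<^sub>v u j))"
      using assoc_mult_mat_vec[OF mult_carrier_mat[OF C Ak] B uj] assoc_mult_mat_vec[OF C Ak Bu] by simp
    then show "(C *\<^sub>v (A ^\<^sub>m (i - 1 - j) *\<^sub>v (B *\<^sub>v u j))) $ c = ((C * A ^\<^sub>m (i - j - 1) * B) *\<^sub>v u j) $ c"
      by (simp add: diff_commute)
  qed
  finally show ?thesis .
qed

lemma toeplitz_window_index:
  assumes u: "\<forall>t. u t \<in> carrier_vec m" and r: "r < p * n"
  shows "(Tz *\<^sub>v window n m u s) $ r = (C *\<^sub>v reach A B (\<lambda>j. u (s + j)) (r div p)) $ (r mod p)"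
proof -
  define i c where "i = r div p" and "c = r mod p"
  have p: "0 < p" using r by (metis gr0I mult_0 not_less_zero)
  have c: "c < p" using p by (simp add: c_def)
  have i: "i < n" using r p by (simp add: i_def less_mult_imp_div_less mult.commute)
  have us: "\<forall>j. u (s + j) \<in> carrier_vec m" using u by simp
  define K where "K j = C * A ^\<^sub>m (i - j - 1) * B" for j
  have K: "K j \<in> carrier_mat p m" for j
    unfolding K_def by (rule mult_carrier_mat[OF mult_carrier_mat[OF C pow_carrier_mat[OF A]] B])
  have "(Tz *\<^sub>v window n m u s) $ r = (\<Sum>q<m * n. Tz $$ (r, q) * window n m u s $ q)"
    by (rule mult_mat_vec_index_sum[OF toeplitz_carrier window_carrier r])
  also have "\<dots> = (\<Sum>q<n * m. (if q div m < i then K (q div m) $$ (c, q mod m) else 0) * u (s + q div m) $ (q mod m))"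
  proof (rule sum.cong)
    show "{..<m * n} = {..<n * m}" by (simp add: mult.commute)
    fix q assume "q \<in> {..<n * m}"
    then have q: "q < n * m" by simp
    then have "q mod m < m" by (metis gr0I mod_less_divisor mult_0_right not_less_zero)
    then show "Tz $$ (r, q) * window n m u s $ q
      = (if q div m < i then K (q div m) $$ (c, q mod m) else 0) * u (s + q div m) $ (q mod m)"
      using q r c A B C by (simp add: io_toeplitz_def block_mat_def Let_def window_def K_def i_def c_def mult.commute)
  qed
  also have "\<dots> = (\<Sum>j<n. \<Sum>c'<m. (if j < i then K j $$ (c, c') else 0) * u (s + j) $ c')"
    by (rule sum_div_mod)
  also have "\<dots> = (\<Sum>j<n. if j < i then (K j *\<^sub>v u (s + j)) $ c else 0)"
    using mult_mat_vec_index_sum[OF K _ c] us by (intro sum.cong) auto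
  also have "\<dots> = (\<Sum>j<i. (K j *\<^sub>v u (s + j)) $ c)"
    using i by (intro sum.mono_neutral_cong_right) auto
  also have "\<dots> = (C *\<^sub>v reach A B (\<lambda>j. u (s + j)) i) $ c"
    unfolding output_reach_index[OF us c] K_def ..
  finally show ?thesis by (simp add: i_def c_def)
qed

lemma obsv_mult_vec_index:
  assumes x: "x \<in> carrier_vec n" and r: "r < p * n"
  shows "(Ob *\<^sub>v x) $ r = (C *\<^sub>v (A ^\<^sub>m (r div p) *\<^sub>v x)) $ (r mod p)"
proof -
  have p: "0 < p" using r by (metis gr0I mult_0 not_less_zero)
  then have c: "r mod p < p" by simp
  note CA = mult_carrier_mat[OF C pow_carrier_mat[OF A, of "r div p"]]
  have "(Ob *\<^sub>v x) $ r = (\<Sum>j<n. Ob $$ (r, j) * x $ j)"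
    by (rule mult_mat_vec_index_sum[OF obsv_carrier x r])
  also have "\<dots> = (\<Sum>j<n. (C * A ^\<^sub>m (r div p)) $$ (r mod p, j) * x $ j)"
    using r A C by (intro sum.cong) (auto simp: obsv_def block_mat_def mult.commute)
  also have "\<dots> = ((C * A ^\<^sub>m (r div p)) *\<^sub>v x) $ (r mod p)"
    by (rule mult_mat_vec_index_sum[OF CA x c, symmetric])
  also have "(C * A ^\<^sub>m (r div p)) *\<^sub>v x = C *\<^sub>v (A ^\<^sub>m (r div p) *\<^sub>v x)"
    by (rule assoc_mult_mat_vec[OF C pow_carrier_mat[OF A] x])
  finally show ?thesis .
qed

lemma output_window:
  assumes traj: "lti_trajectory A B C u x y"
  shows "window n p y s = Ob *\<^sub>v x s + Tz *\<^sub>v window n m u s"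
proof (rule eq_vecI)
  note T = lti_trajectoryD[OF traj]
  have us: "\<forall>j. u (s + j) \<in> carrier_vec m" using T(1) by simp
  have xs: "x s \<in> carrier_vec n" using T(2) by simp
  fix r assume "r < dim_vec (Ob *\<^sub>v x s + Tz *\<^sub>v window n m u s)"
  then have r: "r < p * n" using toeplitz_carrier by simp
  then have c: "r mod p < p" by (metis gr0I mod_less_divisor mult_0 not_less_zero)
  let ?i = "r div p"
  have Ax: "A ^\<^sub>m ?i *\<^sub>v x s \<in> carrier_vec n" using mult_mat_vec_carrier[OF pow_carrier_mat[OF A] xs] .
  have "window n p y s $ r = (C *\<^sub>v x (s + ?i)) $ (r mod p)" using r T(4) by (simp add: window_def)
  also have "C *\<^sub>v x (s + ?i) = C *\<^sub>v (A ^\<^sub>m ?i *\<^sub>v x s) + C *\<^sub>v reach A B (\<lambda>j. u (s + j)) ?i"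
    unfolding lti_trajectory_split[OF A B traj]
    by (rule mult_add_distrib_mat_vec[OF C Ax reach_carrier[OF A B us]])
  also have "\<dots> $ (r mod p) = (Ob *\<^sub>v x s) $ r + (Tz *\<^sub>v window n m u s) $ r"
    unfolding obsv_mult_vec_index[OF xs r] toeplitz_window_index[OF T(1) r]
    using C c by simp
  finally show "window n p y s $ r = (Ob *\<^sub>v x s + Tz *\<^sub>v window n m u s) $ r"
    using r toeplitz_carrier obsv_carrier by simp
next
  show "dim_vec (window n p y s) = dim_vec (Ob *\<^sub>v x s + Tz *\<^sub>v window n m u s)"
    using toeplitz_carrier by (simp add: window_def)
qed

text \<open>By observability the pseudo-inverse is a left inverse, so the stacked output equation
  can be solved for the state at the start of the window.\<close>

lemma pinv_obsv_output_window:
  assumes traj: "lti_trajectory A B C u x y"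
  shows "pinv Ob *\<^sub>v window n p y s = x s + (pinv Ob * Tz) *\<^sub>v window n m u s"
proof -
  have xs: "x s \<in> carrier_vec n" using lti_trajectoryD[OF traj] by simp
  have "pinv Ob *\<^sub>v window n p y s
    = pinv Ob *\<^sub>v (Ob *\<^sub>v x s) + pinv Ob *\<^sub>v (Tz *\<^sub>v window n m u s)"
    unfolding output_window[OF traj]
    using obsv_carrier toeplitz_carrier xs by (intro mult_add_distrib_mat_vec[OF pinv_obsv(1)]) auto
  also have "pinv Ob *\<^sub>v (Ob *\<^sub>v x s) = x s"
    using assoc_mult_mat_vec[OF pinv_obsv(1) obsv_carrier xs] pinv_obsv(2) xs by simp
  also have "pinv Ob *\<^sub>v (Tz *\<^sub>v window n m u s) = (pinv Ob * Tz) *\<^sub>v window n m u s"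
    by (rule assoc_mult_mat_vec[OF pinv_obsv(1) toeplitz_carrier window_carrier, symmetric])
  finally show ?thesis .
qed

lemma io_M_carrier: "io_M A B C \<in> carrier_mat n (m * n + p * n)"
proof -
  have W: "A ^\<^sub>m n * pinv Ob \<in> carrier_mat n (p * n)"
    by (rule mult_carrier_mat[OF pow_carrier_mat[OF A] pinv_obsv(1)])
  have "ctrb A B - A ^\<^sub>m n * pinv Ob * Tz \<in> carrier_mat n (m * n)"
    by (rule minus_carrier_mat[OF mult_carrier_mat[OF W toeplitz_carrier]])
  from hcat_carrier[OF this W] show ?thesis using A by (simp add: io_M_def Let_def)
qed

text \<open>The left inverse finds the state \<open>n\<close> steps ago from the outputs corrected
  by the Toeplitz term; the power of \<open>A\<close> and the controllability matrix then carry it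
  to the present. The two occurrences of the Toeplitz term cancel.\<close>

lemma io_M_history:
  assumes traj: "lti_trajectory A B C u x y" and t: "n \<le> t"
  shows "io_M A B C *\<^sub>v io_history n m p u y t = x t"
proof -
  note T = lti_trajectoryD[OF traj]
  define s where "s = t - n"
  define uh yh where "uh = window n m u s" and "yh = window n p y s"
  have uh: "uh \<in> carrier_vec (m * n)" and yh: "yh \<in> carrier_vec (p * n)" by (auto simp: uh_def yh_def)
  have xs: "x s \<in> carrier_vec n" using T(2) by simp
  have us: "\<forall>j. u (s + j) \<in> carrier_vec m" using T(1) by simp
  note An = pow_carrier_mat[OF A, of n]
  have R: "ctrb A B \<in> carrier_mat n (m * n)" using ctrb_carrier[OF A B] by (simp add: mult.commute)
  define W where "W = A ^\<^sub>m n * pinv Ob"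
  have W: "W \<in> carrier_mat n (p * n)" unfolding W_def using mult_carrier_mat[OF An pinv_obsv(1)] .
  have WT: "W * Tz \<in> carrier_mat n (m * n)" using mult_carrier_mat[OF W toeplitz_carrier] .
  have Oxs: "Ob *\<^sub>v x s \<in> carrier_vec (p * n)" and Tu: "Tz *\<^sub>v uh \<in> carrier_vec (p * n)"
    using obsv_carrier toeplitz_carrier xs uh by auto
  have Ru: "ctrb A B *\<^sub>v uh = reach A B (\<lambda>j. u (s + j)) n"
    by (rule ctrb_mult_vec[OF A B us]) (simp add: uh_def window_def mult.commute)
  have "W *\<^sub>v (Ob *\<^sub>v x s) = A ^\<^sub>m n *\<^sub>v (pinv Ob *\<^sub>v (Ob *\<^sub>v x s))"
    unfolding W_def by (rule assoc_mult_mat_vec[OF An pinv_obsv(1) Oxs])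
  also have "pinv Ob *\<^sub>v (Ob *\<^sub>v x s) = x s"
    using assoc_mult_mat_vec[OF pinv_obsv(1) obsv_carrier xs] pinv_obsv(2) xs by simp
  finally have WO: "W *\<^sub>v (Ob *\<^sub>v x s) = A ^\<^sub>m n *\<^sub>v x s" .
  have "io_M A B C *\<^sub>v io_history n m p u y t = hcat (ctrb A B - W * Tz) W *\<^sub>v (uh @\<^sub>v yh)"
    using A by (simp add: io_M_def Let_def io_history_eq_window W_def uh_def yh_def s_def)
  also have "\<dots> = (ctrb A B - W * Tz) *\<^sub>v uh + W *\<^sub>v yh"
    by (rule hcat_mult_vec[OF minus_carrier_mat[OF WT] W uh yh])
  also have "(ctrb A B - W * Tz) *\<^sub>v uh = ctrb A B *\<^sub>v uh - W *\<^sub>v (Tz *\<^sub>v uh)"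
    unfolding minus_mult_distrib_mat_vec[OF R WT uh] assoc_mult_mat_vec[OF W toeplitz_carrier uh] ..
  also have "W *\<^sub>v yh = A ^\<^sub>m n *\<^sub>v x s + W *\<^sub>v (Tz *\<^sub>v uh)"
    using output_window[OF traj, of s] mult_add_distrib_mat_vec[OF W Oxs Tu] WO by (simp add: uh_def yh_def)
  also have "ctrb A B *\<^sub>v uh - W *\<^sub>v (Tz *\<^sub>v uh) + (A ^\<^sub>m n *\<^sub>v x s + W *\<^sub>v (Tz *\<^sub>v uh))
    = A ^\<^sub>m n *\<^sub>v x s + ctrb A B *\<^sub>v uh"
    using R W An by (intro eq_vecI) (auto simp del: index_mult_mat_vec)
  also have "\<dots> = x t"
    using lti_trajectory_split[OF A B traj, of s n] t by (simp add: Ru s_def)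
  finally show ?thesis .
qed

lemma io_Gamma_carrier: "io_Gamma n m p \<in> carrier_mat (m * n + p * n) p"
  by (simp add: io_Gamma_altdef[OF n] inject_mat_def)

lemma io_A_carrier: "io_A A B C \<in> carrier_mat (m * n + p * n) (m * n + p * n)"
  using add_carrier_mat[OF mult_carrier_mat[OF mult_carrier_mat[OF io_Gamma_carrier C] io_M_carrier]] A B C
  by (simp add: io_A_def Let_def)

lemma io_B_carrier: "io_B n m p \<in> carrier_mat (m * n + p * n) m"
  by (simp add: io_B_altdef[OF n] inject_mat_def)

text \<open>On a genuine history \<open>io_M\<close> returns the true state, so the feedback term
  writes the true output into the newest output slot. All other entries are shifted or come from the
  input.\<close>

lemma io_history_Suc:
  assumes traj: "lti_trajectory A B C u x y" and t: "n \<le> t"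
  shows "io_history n m p u y (Suc t) = io_A A B C *\<^sub>v io_history n m p u y t + io_B n m p *\<^sub>v u t"
proof -
  note T = lti_trajectoryD[OF traj]
  define s where "s = t - n"
  have t_eq: "t = s + n" using t by (simp add: s_def)
  define uh yh where "uh = window n m u s" and "yh = window n p y s"
  have uh: "uh \<in> carrier_vec (m * n)" and yh: "yh \<in> carrier_vec (p * n)" by (auto simp: uh_def yh_def)
  have h: "io_history n m p u y t = uh @\<^sub>v yh" by (simp add: io_history_eq_window uh_def yh_def s_def)
  have hc: "(uh @\<^sub>v yh) \<in> carrier_vec (m * n + p * n)" using uh yh by simp
  have S: "shift_mat n k \<in> carrier_mat (k * n) (k * n)" for k by (simp add: shift_mat_altdef[OF n])
  define \<Gamma> where "\<Gamma> = io_Gamma n m p"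
  have G: "\<Gamma> \<in> carrier_mat (m * n + p * n) p" by (simp add: \<Gamma>_def io_Gamma_carrier)
  have O: "io_Omega n m p \<in> carrier_mat (m * n + p * n) (m * n + p * n)"
    using S[of m] S[of p] unfolding io_Omega_def by (intro carrier_matI) (auto simp: dim_diag_block_mat)
  have GC: "\<Gamma> * C \<in> carrier_mat (m * n + p * n) n" using G C by simp
  have GCM: "\<Gamma> * C * io_M A B C \<in> carrier_mat (m * n + p * n) (m * n + p * n)"
    using mult_carrier_mat[OF GC io_M_carrier] .
  have Mh: "io_M A B C *\<^sub>v (uh @\<^sub>v yh) = x t" using io_M_history[OF traj t] h by simp
  have "io_A A B C *\<^sub>v (uh @\<^sub>v yh)
    = io_Omega n m p *\<^sub>v (uh @\<^sub>v yh) + (\<Gamma> * C * io_M A B C) *\<^sub>v (uh @\<^sub>v yh)"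
    using A B C add_mult_distrib_mat_vec[OF O GCM hc] by (simp add: io_A_def Let_def \<Gamma>_def)
  also have "(\<Gamma> * C * io_M A B C) *\<^sub>v (uh @\<^sub>v yh) = \<Gamma> *\<^sub>v y t"
    using assoc_mult_mat_vec[OF GC io_M_carrier hc] Mh T(2,4) assoc_mult_mat_vec[OF G C] by simp
  also have "io_Omega n m p *\<^sub>v (uh @\<^sub>v yh) = (shift_mat n m *\<^sub>v uh) @\<^sub>v (shift_mat n p *\<^sub>v yh)"
    unfolding io_Omega_def by (rule diag_block_mat_pair_mult_vec[OF S S uh yh])
  finally have Ah: "io_A A B C *\<^sub>v (uh @\<^sub>v yh)
    = ((shift_mat n m *\<^sub>v uh) @\<^sub>v (shift_mat n p *\<^sub>v yh)) + \<Gamma> *\<^sub>v y t" .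
  have mn: "m * (n - 1) + m = m * n" "p * (n - 1) + p = p * n" using n by (cases n, auto)+
  have ut: "u t \<in> carrier_vec m" and yt: "y t \<in> carrier_vec p" using T by auto
  have "window n m u (Suc s) @\<^sub>v window n p y (Suc s)
    = ((shift_mat n m *\<^sub>v uh) @\<^sub>v (shift_mat n p *\<^sub>v yh)) + \<Gamma> *\<^sub>v y t + io_B n m p *\<^sub>v u t"
    (is "?l = ?r")
  proof (rule eq_vecI)
    have dims: "dim_vec (shift_mat n m *\<^sub>v uh) = m * n" "dim_vec (shift_mat n p *\<^sub>v yh) = p * n"
      "dim_vec (window n m u (Suc s)) = m * n" "dim_vec (window n p y (Suc s)) = p * n"
      "dim_vec (\<Gamma> *\<^sub>v y t) = m * n + p * n" "dim_vec (io_B n m p *\<^sub>v u t) = m * n + p * n"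
      using S[of m] S[of p] G io_B_carrier by (auto simp: window_def)
    from dims show "dim_vec ?l = dim_vec ?r" by (simp add: window_def)
    fix i assume "i < dim_vec ?r"
    then have i: "i < m * n + p * n" using dims by simp
    have Gi: "(\<Gamma> *\<^sub>v y t) $ i = (if m * n + p * (n - 1) \<le> i then y t $ (i - (m * n + p * (n - 1))) else 0)"
      unfolding \<Gamma>_def io_Gamma_altdef[OF n] inject_mat_mult_vec[OF yt i] using i mn by auto
    have Bi: "(io_B n m p *\<^sub>v u t) $ i = (if m * (n - 1) \<le> i \<and> i < m * n then u t $ (i - m * (n - 1)) else 0)"
      unfolding io_B_altdef[OF n] inject_mat_mult_vec[OF ut i] using mn by auto
    show "?l $ i = ?r $ i"
    proof (cases "i < m * n")
      case True
      then have "?l $ i = window n m u (Suc s) $ i" using dims i by simp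
      also have "\<dots> = (shift_mat n m *\<^sub>v uh) $ i + (io_B n m p *\<^sub>v u t) $ i"
        unfolding window_Suc[OF True] Bi shift_mat_mult_vec[OF n uh True]
        using True mn t_eq by (auto simp: uh_def)
      also have "\<dots> = ?r $ i" using True i dims Gi by simp
      finally show ?thesis .
    next
      case False
      then have j: "i - m * n < p * n" using i by simp
      have "?l $ i = window n p y (Suc s) $ (i - m * n)" using False dims i by simp
      also have "\<dots> = (shift_mat n p *\<^sub>v yh) $ (i - m * n) + (\<Gamma> *\<^sub>v y t) $ i"
        unfolding window_Suc[OF j] Gi shift_mat_mult_vec[OF n yh j]
        using False mn t_eq by (auto simp: yh_def)
      also have "\<dots> = ?r $ i" using False i dims Bi by simp
      finally show ?thesis .
    qed
  qed
  then show ?thesis using Ah h t by (simp add: io_history_eq_window Suc_diff_le s_def)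
qed

text \<open>Histories exist only from time \<open>n\<close> on, so an experiment starting from the zero history idles
  during the first \<open>n\<close> steps.\<close>

definition delayed_input :: "(nat \<Rightarrow> real vec) \<Rightarrow> nat \<Rightarrow> real vec" where
  "delayed_input u t = (if t < n then 0\<^sub>v m else u (t - n))"

definition rest_state :: "(nat \<Rightarrow> real vec) \<Rightarrow> nat \<Rightarrow> real vec" where
  "rest_state u = reach A B (delayed_input u)"

definition rest_output :: "(nat \<Rightarrow> real vec) \<Rightarrow> nat \<Rightarrow> real vec" where
  "rest_output u t = C *\<^sub>v rest_state u t"

lemma rest_trajectory:
  assumes u: "\<forall>t. u t \<in> carrier_vec m"
  shows "lti_trajectory A B C (delayed_input u) (rest_state u) (rest_output u)"
proof -
  have d: "\<forall>t. delayed_input u t \<in> carrier_vec m" using u by (simp add: delayed_input_def)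
  then show ?thesis
    unfolding lti_trajectory_def using A B reach_carrier[OF A B d]
    by (auto simp: rest_state_def rest_output_def)
qed

lemma rest_state_add: "rest_state u (n + t) = reach A B u t"
  unfolding rest_state_def by (rule reach_delay[OF A B]) (auto simp: delayed_input_def)

lemma rest_state_before: "t \<le> n \<Longrightarrow> rest_state u t = 0\<^sub>v n"
  unfolding rest_state_def by (rule reach_zero_input[OF A B]) (simp add: delayed_input_def)

text \<open>After \<open>n\<close> idle steps the history is zero, the starting point of
  \<open>reach\<close>; from then on both obey the same recursion.\<close>

lemma reach_eq_history:
  assumes u: "\<forall>t. u t \<in> carrier_vec m"
  shows "reach (io_A A B C) (io_B n m p) u t
    = io_history n m p (delayed_input u) (rest_output u) (n + t)"
proof (induction t)
  case 0
  have "window n m (delayed_input u) 0 = 0\<^sub>v (m * n)"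
  proof (rule eq_vecI)
    fix i assume "i < dim_vec (0\<^sub>v (m * n) :: real vec)"
    then have i: "i < m * n" by simp
    then have "0 < m" by (metis gr0I mult_0 not_less_zero)
    then have "i mod m < m" "i div m < n"
      using i by (auto simp: less_mult_imp_div_less mult.commute)
    then show "window n m (delayed_input u) 0 $ i = 0\<^sub>v (m * n) $ i"
      using i by (simp add: window_def delayed_input_def)
  qed (simp add: window_def)
  moreover have "window n p (rest_output u) 0 = 0\<^sub>v (p * n)"
  proof (rule eq_vecI)
    fix i assume "i < dim_vec (0\<^sub>v (p * n) :: real vec)"
    then have i: "i < p * n" by simp
    then have "0 < p" by (metis gr0I mult_0 not_less_zero)
    then have "i mod p < p" "i div p < n"
      using i by (auto simp: less_mult_imp_div_less mult.commute)
    moreover have "C *\<^sub>v 0\<^sub>v n = 0\<^sub>v p" by (rule mult_mat_zero_vec[OF C])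
    ultimately show "window n p (rest_output u) 0 $ i = 0\<^sub>v (p * n) $ i"
      using i rest_state_before[of "i div p"] by (simp add: window_def rest_output_def)
  qed (simp add: window_def)
  moreover have "0\<^sub>v (m * n + p * n) = 0\<^sub>v (m * n) @\<^sub>v (0\<^sub>v (p * n) :: real vec)"
    by (intro eq_vecI) auto
  ultimately show ?case using io_A_carrier by (simp add: io_history_eq_window)
next
  case (Suc t)
  have "delayed_input u (n + t) = u t" by (simp add: delayed_input_def)
  then show ?case using io_history_Suc[OF rest_trajectory[OF u], of "n + t"] Suc by simp
qed

lemma io_M_reach:
  assumes u: "\<forall>t. u t \<in> carrier_vec m"
  shows "io_M A B C *\<^sub>v reach (io_A A B C) (io_B n m p) u t = reach A B u t"
  using io_M_history[OF rest_trajectory[OF u], of "n + t"]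
  by (simp add: reach_eq_history[OF u] rest_state_add)

text \<open>The block rows solve for the state \<open>n\<close> steps ago and copy the inputs since
  then. These are \<open>n + m * n\<close> numbers, exactly the number of columns of \<Pi> in the
  delayed case.\<close>

definition unhistory :: "real mat" where
  "unhistory = four_block_mat (- (pinv Ob * Tz)) (pinv Ob) (1\<^sub>m (m * n)) (0\<^sub>m (m * n) (p * n))"

lemma unhistory_carrier: "unhistory \<in> carrier_mat (n + m * n) (m * n + p * n)"
  unfolding unhistory_def
  by (rule four_block_carrier_mat[OF uminus_carrier_mat[OF mult_carrier_mat[OF pinv_obsv(1) toeplitz_carrier]]
        zero_carrier_mat])

lemma unhistory_history:
  assumes traj: "lti_trajectory A B C u x y"
  shows "unhistory *\<^sub>v io_history n m p u y t = x (t - n) @\<^sub>v window n m u (t - n)"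
proof -
  let ?u = "window n m u (t - n)" and ?y = "window n p y (t - n)"
  have xs: "x (t - n) \<in> carrier_vec n" using lti_trajectoryD[OF traj] by simp
  have PT: "pinv Ob * Tz \<in> carrier_mat n (m * n)" using mult_carrier_mat[OF pinv_obsv(1) toeplitz_carrier] .
  then have PTu: "(pinv Ob * Tz) *\<^sub>v ?u \<in> carrier_vec n" by simp
  have "unhistory *\<^sub>v (?u @\<^sub>v ?y) = (- (pinv Ob * Tz) *\<^sub>v ?u + pinv Ob *\<^sub>v ?y) @\<^sub>v
    (1\<^sub>m (m * n) *\<^sub>v ?u + 0\<^sub>m (m * n) (p * n) *\<^sub>v ?y)"
    unfolding unhistory_def
    by (rule four_block_mat_mult_vec[OF uminus_carrier_mat[OF PT] pinv_obsv(1) one_carrier_mat zero_carrier_mat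
          window_carrier window_carrier])
  also have "- (pinv Ob * Tz) *\<^sub>v ?u = - ((pinv Ob * Tz) *\<^sub>v ?u)"
    using toeplitz_carrier by (intro uminus_mult_mat_vec) simp
  also have "\<dots> + pinv Ob *\<^sub>v ?y = x (t - n)"
    unfolding pinv_obsv_output_window[OF traj]
    using xs PTu by (intro eq_vecI) (auto simp del: index_mult_mat_vec dim_mult_mat_vec)
  also have "1\<^sub>m (m * n) *\<^sub>v ?u + 0\<^sub>m (m * n) (p * n) *\<^sub>v ?y = ?u"
    by (intro eq_vecI) auto
  finally show ?thesis by (simp add: io_history_eq_window)
qed

lemma unhistory_surj:
  assumes ctrl: "controllable A B" and z: "z \<in> carrier_vec (n + m * n)"
  obtains u where "\<forall>t. u t \<in> carrier_vec m"
    "unhistory *\<^sub>v io_history n m p (delayed_input u) (rest_output u) (n + (n + n)) = z"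
proof -
  define x w where "x = vec_first z n" and "w = vec_last z (m * n)"
  have z_eq: "z = x @\<^sub>v w" using z by (simp add: x_def w_def)
  have x: "x \<in> carrier_vec n" and w: "w \<in> carrier_vec (m * n)" by (auto simp: x_def w_def)
  have "x \<in> mat_im (ctrb A B)" using ctrl x controllable_iff[OF A B] by simp
  then obtain u0 where u0: "\<forall>t. u0 t \<in> carrier_vec m" "x = reach A B u0 n"
    unfolding mat_im_ctrb[OF A B] by blast
  \<comment> \<open>After the idle phase of length \<open>n\<close>, one phase of length
    \<open>n\<close> steers the state to \<open>x\<close> and the next one spells out
    \<open>w\<close>. The window thus starts at \<open>n + n\<close> and ends at
    \<open>n + (n + n)\<close>.\<close>
  define u where "u t = (if t < n then u0 t else vec m (\<lambda>c. w $ (m * (t - n) + c)))" for t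
  have u: "\<forall>t. u t \<in> carrier_vec m" using u0(1) by (simp add: u_def)
  have "rest_state u (n + n) = x"
    unfolding rest_state_add u0(2) by (rule reach_cong) (simp add: u_def)
  moreover have "window n m (delayed_input u) (n + n) = w"
  proof (rule eq_vecI)
    fix i assume "i < dim_vec w"
    then have i: "i < m * n" using w by simp
    then have "i mod m < m" by (metis gr0I mod_less_divisor mult_0 not_less_zero)
    then show "window n m (delayed_input u) (n + n) $ i = w $ i"
      using i by (simp add: window_def delayed_input_def u_def)
  qed (use w in \<open>simp add: window_def\<close>)
  ultimately show thesis
    using that[OF u] unhistory_history[OF rest_trajectory[OF u], of "n + (n + n)"] z_eq by simp
qed

end

subsection \<open>Companion matrices and characteristic polynomials\<close>

lemma mult_mat_vec_unit_vec:
  fixes X :: "'a :: comm_semiring_1 mat"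
  assumes "X \<in> carrier_mat r k" "j < k"
  shows "X *\<^sub>v unit_vec k j = col X j"
  using assms by (intro eq_vecI) auto

lemma col_mat_index: "col_mat w \<in> carrier_mat (dim_vec w) 1" "i < dim_vec w \<Longrightarrow> col_mat w $$ (i, 0) = w $ i"
  by (auto simp: col_mat_def mat_of_cols_def)

lemma block_index_less:
  fixes k q r i :: nat
  assumes "k < q" "i < r"
  shows "k * r + i < q * r"
proof -
  have "k * r + i < Suc k * r" using assms by simp
  also have "\<dots> \<le> q * r" using assms by (intro mult_le_mono1) simp
  finally show ?thesis .
qed

lemma kron_one_mult_vec_index:
  assumes X: "X \<in> carrier_mat r c" and v: "v \<in> carrier_vec (q * c)" and k: "k < q" and i: "i < r"
  shows "(kron (1\<^sub>m q) X *\<^sub>v v) $ (k * r + i) = (X *\<^sub>v vec c (\<lambda>j. v $ (k * c + j))) $ i"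
proof -
  note kr = block_index_less[OF k i]
  have K: "kron (1\<^sub>m q) X \<in> carrier_mat (q * r) (q * c)" using X by (auto simp: kron_def block_mat_def)
  have "(kron (1\<^sub>m q) X *\<^sub>v v) $ (k * r + i) = (\<Sum>s<q * c. kron (1\<^sub>m q) X $$ (k * r + i, s) * v $ s)"
    by (rule mult_mat_vec_index_sum[OF K v kr])
  also have "\<dots> = (\<Sum>s<q * c. (if s div c = k then X $$ (i, s mod c) * v $ (k * c + s mod c) else 0))"
  proof (rule sum.cong[OF refl])
    fix s assume "s \<in> {..<q * c}"
    then have s: "s < q * c" by simp
    then have c: "0 < c" by (metis gr0I mult_0_right not_less_zero)
    have "s div c < q" "s mod c < c" using s c by (auto simp: less_mult_imp_div_less)
    moreover have "s = s div c * c + s mod c" by simp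
    ultimately show "kron (1\<^sub>m q) X $$ (k * r + i, s) * v $ s
      = (if s div c = k then X $$ (i, s mod c) * v $ (k * c + s mod c) else 0)"
      using X k i kr s by (auto simp: kron_def block_mat_def)
  qed
  also have "\<dots> = (\<Sum>j<q. \<Sum>l<c. (if j = k then X $$ (i, l) * v $ (k * c + l) else 0))"
    by (rule sum_div_mod)
  also have "\<dots> = (\<Sum>j<q. if j = k then (\<Sum>l<c. X $$ (i, l) * v $ (k * c + l)) else 0)"
    by (intro sum.cong) auto
  also have "\<dots> = (\<Sum>l<c. X $$ (i, l) * v $ (k * c + l))" using k by simp
  also have "\<dots> = (X *\<^sub>v vec c (\<lambda>j. v $ (k * c + j))) $ i"
    using mult_mat_vec_index_sum[OF X vec_carrier i, of "\<lambda>j. v $ (k * c + j)"] by simp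
  finally show ?thesis .
qed

lemma pow_mat_intertwine_vec:
  fixes T :: "'a :: comm_semiring_1 mat"
  assumes T: "T \<in> carrier_mat r k" and X: "X \<in> carrier_mat k k" and Y: "Y \<in> carrier_mat r r"
    and TX: "T * X = Y * T" and v: "v \<in> carrier_vec k"
  shows "T *\<^sub>v (X ^\<^sub>m t *\<^sub>v v) = Y ^\<^sub>m t *\<^sub>v (T *\<^sub>v v)"
proof (induction t)
  case 0
  then show ?case using T X Y v by simp
next
  case (Suc t)
  have Xv: "X ^\<^sub>m t *\<^sub>v v \<in> carrier_vec k" using mult_mat_vec_carrier[OF pow_carrier_mat[OF X] v] .
  have Tv: "T *\<^sub>v v \<in> carrier_vec r" using T v by simp
  have "T *\<^sub>v (X ^\<^sub>m Suc t *\<^sub>v v) = (T * X) *\<^sub>v (X ^\<^sub>m t *\<^sub>v v)"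
    unfolding pow_mat_mult_vec_Suc[OF X v] by (rule assoc_mult_mat_vec[OF T X Xv, symmetric])
  also have "\<dots> = Y *\<^sub>v (T *\<^sub>v (X ^\<^sub>m t *\<^sub>v v))"
    unfolding TX by (rule assoc_mult_mat_vec[OF Y T Xv])
  also have "\<dots> = Y ^\<^sub>m Suc t *\<^sub>v (T *\<^sub>v v)"
    unfolding Suc pow_mat_mult_vec_Suc[OF Y Tv] ..
  finally show ?case .
qed

lemma char_poly_of_real:
  fixes X :: "real mat"
  assumes "X \<in> carrier_mat n n"
  shows "char_poly (map_mat complex_of_real X) = map_poly complex_of_real (char_poly X)"
  by (rule of_real_hom.char_poly_hom[OF assms])

text \<open>Over the complex numbers a monic polynomial is the product of its linear factors, and
  the multiset of eigenvalues records their multiplicities. Hence \<open>A\<^sub>\<epsilon>\<close>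
  and A - L C share one companion matrix.\<close>

lemma char_poly_eq_if_eigvals_eq:
  assumes X: "X \<in> carrier_mat n n" and Y: "Y \<in> carrier_mat n n" and eq: "eigvals X = eigvals Y"
  shows "char_poly X = char_poly Y"
proof -
  let ?p = "\<lambda>X. char_poly (map_mat complex_of_real X)"
  have decomp: "?p M = (\<Prod>x\<in>#eigvals M. [:-x, 1:])" if "M \<in> carrier_mat n n" for M
  proof -
    have "lead_coeff (?p M) = 1"
      using degree_monic_char_poly[of "map_mat complex_of_real M" n] that by simp
    then show ?thesis
      using complex_poly_decompose_multiset[of "?p M"] unfolding eigvals_def by (simp only: smult_1_left)
  qed
  have "?p X = ?p Y" unfolding decomp[OF X] decomp[OF Y] eq ..
  then have "map_poly complex_of_real (char_poly X) = map_poly complex_of_real (char_poly Y)"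
    by (simp add: char_poly_of_real[OF X] char_poly_of_real[OF Y])
  then have "complex_of_real (coeff (char_poly X) k) = complex_of_real (coeff (char_poly Y) k)" for k
    by (metis coeff_map_poly of_real_0)
  then show ?thesis by (intro poly_eqI) (simp only: of_real_eq_iff)
qed

text \<open>With zero as the only root, the monic polynomial of degree \<open>n\<close> is the power
  of z, which turns the companion matrix into a shift.\<close>

lemma char_poly_coeff_if_spectrum_zero:
  assumes X: "X \<in> carrier_mat n n" and spec: "spectrum (map_mat complex_of_real X) \<subseteq> {0}" and k: "k < n"
  shows "coeff (char_poly X) k = 0"
proof -
  let ?X = "map_mat complex_of_real X"
  have X': "?X \<in> carrier_mat n n" using X by simp
  let ?p = "char_poly ?X"
  have deg: "degree ?p = n" "lead_coeff ?p = 1" using degree_monic_char_poly[OF X'] by auto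
  then have "?p \<noteq> 0" by auto
  then have "set_mset (proots ?p) \<subseteq> {0}" using spec spectrum_root_char_poly[OF X'] by simp
  then have "(\<Prod>x\<in>#proots ?p. [:-x, 1:]) = (\<Prod>x\<in>#proots ?p. [:0, 1:])"
    by (intro arg_cong[of _ _ prod_mset] image_mset_cong) auto
  also have "\<dots> = [:0, 1:] ^ n" by (simp add: prod_mset_constant size_proots_complex deg)
  finally have "?p = monom 1 n"
    using complex_poly_decompose_multiset[of ?p] deg by (simp add: monom_altdef)
  then have "complex_of_real (coeff (char_poly X) k) = coeff (monom 1 n) k"
    unfolding char_poly_of_real[OF X] by (metis coeff_map_poly of_real_0)
  then show ?thesis using k by simp
qed

lemma adj_apply_carrier:
  assumes "H \<in> carrier_mat n n" "w \<in> carrier_vec n"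
  shows "adj_apply H w \<in> carrier_mat n n"
  using assms by (auto simp: adj_apply_def adj_coeffs_def kron_def block_mat_def col_mat_def Let_def)

text \<open>The Kronecker factor puts the product of \<open>adj_coeff H i\<close> and
  \<open>w\<close> into column \<open>i\<close>. Summed by rising powers it is a Horner tail of the
  characteristic polynomial: coefficient \<open>i + 1\<close> times \<open>w\<close>, plus
  coefficient \<open>i + 2\<close> times \<open>H *\<^sub>v w\<close>, and so on.\<close>

lemma adj_apply_index:
  assumes H: "H \<in> carrier_mat n n" and w: "w \<in> carrier_vec n" and r: "r < n" and i: "i < n"
  shows "adj_apply H w $$ (r, i) = (\<Sum>l<n - i. coeff (char_poly H) (i + 1 + l) * (H ^\<^sub>m l *\<^sub>v w) $ r)"
proof -
  let ?a = "coeff (char_poly H)"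
  have D: "adj_coeffs H \<in> carrier_mat n (n * n)" using H by (auto simp: adj_coeffs_def block_mat_def Let_def)
  have K: "kron (1\<^sub>m n) (col_mat w) \<in> carrier_mat (n * n) n"
    using w by (auto simp: kron_def block_mat_def col_mat_def)
  have "adj_apply H w $$ (r, i) = (\<Sum>q<n * n. adj_coeffs H $$ (r, q) * kron (1\<^sub>m n) (col_mat w) $$ (q, i))"
    unfolding adj_apply_def using mult_mat_index_sum[OF D K r i] H by simp
  also have "\<dots> = (\<Sum>q<n * n. adj_coeff H (q div n) $$ (r, q mod n) * (if q div n = i then w $ (q mod n) else 0))"
  proof (rule sum.cong[OF refl])
    fix q assume "q \<in> {..<n * n}"
    then have q: "q < n * n" by simp
    have "q div n < n" "q mod n < n" using q r by (auto simp: less_mult_imp_div_less)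
    then show "adj_coeffs H $$ (r, q) * kron (1\<^sub>m n) (col_mat w) $$ (q, i)
      = adj_coeff H (q div n) $$ (r, q mod n) * (if q div n = i then w $ (q mod n) else 0)"
      using H w q r i col_mat_index(1)[of w] col_mat_index(2)[where w = w]
      by (auto simp: adj_coeffs_def kron_def block_mat_def Let_def)
  qed
  also have "\<dots> = (\<Sum>j<n. \<Sum>c<n. adj_coeff H j $$ (r, c) * (if j = i then w $ c else 0))"
    by (rule sum_div_mod)
  also have "\<dots> = (\<Sum>j<n. if j = i then (\<Sum>c<n. adj_coeff H i $$ (r, c) * w $ c) else 0)"
    by (intro sum.cong) auto
  also have "\<dots> = (\<Sum>c<n. adj_coeff H i $$ (r, c) * w $ c)" using i by simp
  also have "\<dots> = (\<Sum>c<n. \<Sum>j = 1..n - i. ?a (n - j + 1) * ((H ^\<^sub>m (n - i - j)) $$ (r, c) * w $ c))"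
    using H r by (intro sum.cong) (auto simp: adj_coeff_def Let_def sum_distrib_right mult.assoc)
  also have "\<dots> = (\<Sum>j = 1..n - i. ?a (n - j + 1) * (H ^\<^sub>m (n - i - j) *\<^sub>v w) $ r)"
    by (subst sum.swap) (simp only: mult_mat_vec_index_sum[OF pow_carrier_mat[OF H] w r] sum_distrib_left)
  also have "\<dots> = (\<Sum>l<n - i. ?a (i + 1 + l) * (H ^\<^sub>m l *\<^sub>v w) $ r)"
    using i by (intro sum.reindex_bij_witness[of _ "\<lambda>l. n - i - l" "\<lambda>j. n - i - j"])
      (auto simp: le_diff_conv2 intro!: arg_cong[of _ _ ?a])
  finally show ?thesis .
qed

text \<open>The shortest Horner tail consists of the leading coefficient, which is 1.\<close>

lemma adj_apply_unit_vec:
  assumes H: "H \<in> carrier_mat n n" and w: "w \<in> carrier_vec n" and n: "0 < n"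
  shows "adj_apply H w *\<^sub>v unit_vec n (n - 1) = w"
proof -
  note T = adj_apply_carrier[OF H w]
  have "adj_apply H w *\<^sub>v unit_vec n (n - 1) = col (adj_apply H w) (n - 1)"
    using n by (intro mult_mat_vec_unit_vec[OF T]) simp
  also have "\<dots> = w"
  proof (rule eq_vecI)
    fix r assume "r < dim_vec w"
    then have r: "r < n" using w by simp
    have "coeff (char_poly H) n = 1" using degree_monic_char_poly[OF H] by simp
    then show "col (adj_apply H w) (n - 1) $ r = w $ r"
      using adj_apply_index[OF H w r, of "n - 1"] T r n w H by simp
  qed (use T w in simp)
  finally show ?thesis .
qed

lemma companion_carrier: "H \<in> carrier_mat n n \<Longrightarrow> companion H \<in> carrier_mat n n"
  by (auto simp: companion_def Let_def)

text \<open>Horner's rule links neighbouring columns: column \<open>j - 1\<close> is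
  \<open>H\<close> times column \<open>j\<close> plus coefficient \<open>j\<close> times
  \<open>w\<close>. Right multiplication by the companion matrix moves column \<open>j - 1\<close>
  into place and its last row subtracts the multiple of \<open>w\<close>. Column 0 closes up by
  Cayley--Hamilton.\<close>

lemma adj_apply_companion:
  assumes H: "H \<in> carrier_mat n n" and w: "w \<in> carrier_vec n" and n: "0 < n"
  shows "adj_apply H w * companion H = H * adj_apply H w"
proof (rule eq_matI)
  let ?a = "coeff (char_poly H)" and ?T = "adj_apply H w"
  note T = adj_apply_carrier[OF H w] and K = companion_carrier[OF H]
  fix r j assume "r < dim_row (H * ?T)" "j < dim_col (H * ?T)"
  then have r: "r < n" and j: "j < n" using H T by auto
  define h where "h l = (H ^\<^sub>m l *\<^sub>v w) $ r" for l
  \<comment> \<open>Shifted by one against the columns: \<open>D (Suc i)\<close> belongs to column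
    \<open>i\<close>, and \<open>D 0\<close> is the full characteristic polynomial evaluated at
    \<open>H\<close> and applied to \<open>w\<close>, hence zero.\<close>
  define D where "D j = (\<Sum>l<Suc n - j. ?a (j + l) * h l)" for j
  have h0: "h 0 = w $ r" using H w by (simp add: h_def)
  have T_D: "?T $$ (r, i) = D (Suc i)" if "i < n" for i
    using adj_apply_index[OF H w r that] by (simp add: D_def h_def)
  have "?a n = 1" using degree_monic_char_poly[OF H] by simp
  then have T_last: "?T $$ (r, n - 1) = w $ r" using T_D[of "n - 1"] n by (simp add: D_def h0)
  have D0: "D 0 = 0"
    using cayley_hamilton_vec[OF H w r] by (simp add: D_def h_def lessThan_Suc_atMost)
  have "(?T * companion H) $$ (r, j) = (\<Sum>i<n. ?T $$ (r, i) * companion H $$ (i, j))"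
    by (rule mult_mat_index_sum[OF T K r j])
  also have "\<dots> = (\<Sum>i<n - 1. ?T $$ (r, i) * companion H $$ (i, j)) + ?T $$ (r, n - 1) * companion H $$ (n - 1, j)"
    using n by (cases n) auto
  also have "companion H $$ (n - 1, j) = - ?a j" using H n j by (simp add: companion_def Let_def)
  also have "(\<Sum>i<n - 1. ?T $$ (r, i) * companion H $$ (i, j)) = (\<Sum>i<n - 1. if j = Suc i then D j else 0)"
    using H j T_D by (intro sum.cong) (auto simp: companion_def Let_def)
  also have "\<dots> = D j"
    using j D0 by (cases j) (auto simp: sum.delta')
  finally have L: "(?T * companion H) $$ (r, j) = D j - ?a j * w $ r" unfolding T_last by simp
  have Hl: "H ^\<^sub>m l *\<^sub>v w \<in> carrier_vec n" for l using mult_mat_vec_carrier[OF pow_carrier_mat[OF H] w] .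
  have "(H * ?T) $$ (r, j) = (\<Sum>c<n. H $$ (r, c) * ?T $$ (c, j))"
    by (rule mult_mat_index_sum[OF H T r j])
  also have "\<dots> = (\<Sum>c<n. \<Sum>l<n - j. ?a (j + 1 + l) * (H $$ (r, c) * (H ^\<^sub>m l *\<^sub>v w) $ c))"
    using j by (intro sum.cong[OF refl])
      (simp only: lessThan_iff adj_apply_index[OF H w] sum_distrib_left mult.left_commute)
  also have "\<dots> = (\<Sum>l<n - j. ?a (j + 1 + l) * (H *\<^sub>v (H ^\<^sub>m l *\<^sub>v w)) $ r)"
    by (subst sum.swap) (simp only: mult_mat_vec_index_sum[OF H Hl r] sum_distrib_left)
  also have "\<dots> = (\<Sum>l<n - j. ?a (j + Suc l) * h (Suc l))"
    by (simp only: h_def pow_mat_mult_vec_Suc[OF H w] add_Suc_right add_Suc plus_1_eq_Suc add.commute[of j 1])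
  also have "\<dots> = D j - ?a j * h 0"
  proof -
    have "D j = (\<Sum>l<Suc (n - j). ?a (j + l) * h l)" using j by (simp add: D_def Suc_diff_le)
    then show ?thesis by (simp only: sum.lessThan_Suc_shift) simp
  qed
  finally show "(?T * companion H) $$ (r, j) = (H * ?T) $$ (r, j)" using L h0 by simp
next
  show "dim_row (adj_apply H w * companion H) = dim_row (H * adj_apply H w)"
    "dim_col (adj_apply H w * companion H) = dim_col (H * adj_apply H w)"
    using adj_apply_carrier[OF H w] companion_carrier[OF H] H by auto
qed

lemma companion_mult_vec_index:
  assumes H: "H \<in> carrier_mat n n" and "\<And>k. k < n \<Longrightarrow> coeff (char_poly H) k = 0"
    and v: "v \<in> carrier_vec n" and i: "i < n"
  shows "(companion H *\<^sub>v v) $ i = (if i + 1 < n then v $ (i + 1) else 0)"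
proof -
  have "(companion H *\<^sub>v v) $ i = (\<Sum>j<n. if j = i + 1 then v $ j else 0)"
    unfolding mult_mat_vec_index_sum[OF companion_carrier[OF H] v i]
    using assms by (intro sum.cong) (auto simp: companion_def Let_def)
  then show ?thesis by simp
qed

lemma mat_inverse_invertible:
  fixes X :: "real mat"
  assumes X: "X \<in> carrier_mat n n" and inv: "invertible_mat X"
  shows "the (mat_inverse X) \<in> carrier_mat n n" "X * the (mat_inverse X) = 1\<^sub>m n"
    "the (mat_inverse X) * X = 1\<^sub>m n"
proof -
  obtain Y where Y: "X * Y = 1\<^sub>m n" "Y * X = 1\<^sub>m (dim_row Y)"
    using inv X unfolding invertible_mat_def inverts_mat_def by auto
  \<comment> \<open>\<open>inverts_mat\<close> does not fix the shape of \<open>Y\<close>; it is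
    read off from the two products.\<close>
  have "dim_col Y = n" using arg_cong[OF Y(1), of dim_col] by simp
  moreover have "dim_row Y = n" using arg_cong[OF Y(2), of dim_col] X by simp
  ultimately have "Y \<in> carrier_mat n n" by auto
  then have "X \<in> Units (ring_mat TYPE(real) n ())"
    using X Y unfolding Units_def ring_mat_def by auto
  then obtain Z where "mat_inverse X = Some Z" using mat_inverse(1)[OF X] by (metis not_None_eq)
  then show "the (mat_inverse X) \<in> carrier_mat n n" "X * the (mat_inverse X) = 1\<^sub>m n"
    "the (mat_inverse X) * X = 1\<^sub>m n" using mat_inverse(2)[OF X] by auto
qed

subsection \<open>The input-output filter\<close>

text \<open>The filter state has \<open>m + p + 1\<close> blocks of length \<open>n\<close>: one per
  input, one per output, and the autonomous one with index \<open>m + p\<close>.\<close>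

definition slice :: "nat \<Rightarrow> nat \<Rightarrow> real vec \<Rightarrow> real vec" where
  "slice n k v = vec n (\<lambda>i. v $ (k * n + i))"

lemma slice_carrier[simp]: "slice n k v \<in> carrier_vec n"
  by (simp add: slice_def)

lemma slice_index: "i < n \<Longrightarrow> slice n k v $ i = v $ (k * n + i)"
  by (simp add: slice_def)

lemma slice_add:
  assumes "v \<in> carrier_vec (q * n)" "w \<in> carrier_vec (q * n)" "k < q"
  shows "slice n k (v + w) = slice n k v + slice n k w"
  using assms block_index_less[of k q _ n] by (intro eq_vecI) (auto simp: slice_def)

lemma slice_zero: "k < q \<Longrightarrow> slice n k (0\<^sub>v (q * n)) = 0\<^sub>v n"
  using block_index_less[of k q _ n] by (intro eq_vecI) (auto simp: slice_def)

lemma eq_vec_slices: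
  assumes "v \<in> carrier_vec (q * n)" "w \<in> carrier_vec (q * n)"
    and eq: "\<And>k. k < q \<Longrightarrow> slice n k v = slice n k w"
  shows "v = w"
proof (rule eq_vecI)
  fix i assume "i < dim_vec w"
  then have i: "i < q * n" using assms by simp
  then have n: "0 < n" by (metis gr0I mult_0_right not_less_zero)
  have k: "i div n < q" using i by (simp add: less_mult_imp_div_less)
  have "v $ i = slice n (i div n) v $ (i mod n)" using n by (simp add: slice_index)
  also have "\<dots> = slice n (i div n) w $ (i mod n)" by (simp only: eq[OF k])
  also have "\<dots> = w $ i" using n by (simp add: slice_index)
  finally show "v $ i = w $ i" .
qed (use assms in simp)

lemma block_row_mult_vec_index:
  assumes f: "\<And>k. k < q \<Longrightarrow> f k \<in> carrier_mat n n" and v: "v \<in> carrier_vec (q * n)" and r: "r < n"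
  shows "(block_mat 1 q n n (\<lambda>_. f) *\<^sub>v v) $ r = (\<Sum>k<q. (f k *\<^sub>v slice n k v) $ r)"
proof -
  have S: "block_mat 1 q n n (\<lambda>_. f) \<in> carrier_mat n (q * n)" by (simp add: block_mat_def)
  have "(block_mat 1 q n n (\<lambda>_. f) *\<^sub>v v) $ r = (\<Sum>s<q * n. block_mat 1 q n n (\<lambda>_. f) $$ (r, s) * v $ s)"
    by (rule mult_mat_vec_index_sum[OF S v r])
  also have "\<dots> = (\<Sum>s<q * n. f (s div n) $$ (r, s mod n) * v $ (s div n * n + s mod n))"
    using r by (intro sum.cong) (auto simp: block_mat_def)
  also have "\<dots> = (\<Sum>k<q. \<Sum>c<n. f k $$ (r, c) * v $ (k * n + c))" by (rule sum_div_mod)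
  also have "\<dots> = (\<Sum>k<q. (f k *\<^sub>v slice n k v) $ r)"
    using mult_mat_vec_index_sum[OF f slice_carrier r] by (intro sum.cong) (auto simp: slice_index)
  finally show ?thesis .
qed

lemma filter_Bs_index:
  assumes "k < m + p + 1" "i < n" "j < m + p"
  shows "filter_Bs n m p $$ (k * n + i, j) = (if k = j \<and> i = n - 1 then 1 else 0)"
proof -
  let ?K = "kron (1\<^sub>m (m + p)) (col_mat (unit_vec n (n - 1)))"
  have K: "?K \<in> carrier_mat ((m + p) * n) (m + p)" by (auto simp: kron_def block_mat_def col_mat_def)
  have Bs: "filter_Bs n m p = four_block_mat ?K (0\<^sub>m ((m + p) * n) 1) (0\<^sub>m n (m + p)) (0\<^sub>m n 1)"
    unfolding filter_Bs_def using K
    by (subst diag_block_mat.simps(2)) (simp only: diag_block_mat_singleton Let_def carrier_matD index_zero_mat)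
  show ?thesis
  proof (cases "k < m + p")
    case True
    note ki = block_index_less[OF True assms(2)]
    have "filter_Bs n m p $$ (k * n + i, j) = ?K $$ (k * n + i, j)"
      unfolding Bs using K ki assms by simp
    also have "\<dots> = (1\<^sub>m (m + p) $$ (k, j) \<cdot>\<^sub>m col_mat (unit_vec n (n - 1))) $$ (i, 0)"
      using ki assms by (simp add: kron_def block_mat_def col_mat_def)
    also have "\<dots> = (if k = j \<and> i = n - 1 then 1 else 0)"
      using True assms col_mat_index(1)[of "unit_vec n (n - 1)"] col_mat_index(2)[of i "unit_vec n (n - 1)"]
      by auto
    finally show ?thesis .
  next
    case False
    then have k: "k = m + p" using assms by simp
    show ?thesis unfolding Bs k using K assms by simp
  qed
qed

text \<open>The scalar signal that enters block \<open>k\<close>; the default 0 at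
  \<open>k = m + p\<close> expresses that the last block is autonomous.\<close>

definition block_input :: "nat \<Rightarrow> nat \<Rightarrow> real vec \<Rightarrow> real vec \<Rightarrow> nat \<Rightarrow> real" where
  "block_input m p u y k = (if k < m then u $ k else if k < m + p then y $ (k - m) else 0)"

lemma filter_B_carrier:
  "filter_Bu n m p \<in> carrier_mat ((m + p + 1) * n) m" "filter_By n m p \<in> carrier_mat ((m + p + 1) * n) p"
  by (auto simp: filter_Bu_def filter_By_def)

lemma filter_B_slice:
  assumes u: "u \<in> carrier_vec m" and y: "y \<in> carrier_vec p" and k: "k < m + p + 1"
  shows "slice n k (filter_Bu n m p *\<^sub>v u) + slice n k (filter_By n m p *\<^sub>v y)
    = block_input m p u y k \<cdot>\<^sub>v unit_vec n (n - 1)"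
proof (rule eq_vecI)
  fix i assume "i < dim_vec (block_input m p u y k \<cdot>\<^sub>v unit_vec n (n - 1))"
  then have i: "i < n" by simp
  note ki = block_index_less[OF k i]
  have "(filter_Bu n m p *\<^sub>v u) $ (k * n + i) = (\<Sum>j<m. if j = k then (if i = n - 1 then u $ j else 0) else 0)"
    unfolding mult_mat_vec_index_sum[OF filter_B_carrier(1) u ki]
    using ki filter_Bs_index[OF k i] by (intro sum.cong) (auto simp: filter_Bu_def)
  also have "\<dots> = (if k < m \<and> i = n - 1 then u $ k else 0)" by simp
  finally have 1: "(filter_Bu n m p *\<^sub>v u) $ (k * n + i) = (if k < m \<and> i = n - 1 then u $ k else 0)" .
  have "(filter_By n m p *\<^sub>v y) $ (k * n + i)
    = (\<Sum>j<p. if j = k - m then (if m \<le> k \<and> i = n - 1 then y $ j else 0) else 0)"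
    unfolding mult_mat_vec_index_sum[OF filter_B_carrier(2) y ki]
    using ki filter_Bs_index[OF k i] by (intro sum.cong) (auto simp: filter_By_def)
  also have "\<dots> = (if m \<le> k \<and> k < m + p \<and> i = n - 1 then y $ (k - m) else 0)" using k by auto
  finally have 2: "(filter_By n m p *\<^sub>v y) $ (k * n + i)
    = (if m \<le> k \<and> k < m + p \<and> i = n - 1 then y $ (k - m) else 0)" .
  show "(slice n k (filter_Bu n m p *\<^sub>v u) + slice n k (filter_By n m p *\<^sub>v y)) $ i
    = (block_input m p u y k \<cdot>\<^sub>v unit_vec n (n - 1)) $ i"
    using i 1 2 by (auto simp: slice_index slice_def block_input_def)
qed (simp add: slice_def)

lemma sum_lessThan_add:
  fixes f :: "nat \<Rightarrow> 'a :: comm_monoid_add"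
  shows "(\<Sum>k<m + p. f k) = (\<Sum>k<m. f k) + (\<Sum>j<p. f (m + j))"
  by (induction p) (auto simp: add.assoc)

locale filter_lti = observable_lti +
  fixes L A\<^sub>\<epsilon> :: "real mat" and \<epsilon>\<^sub>0 \<eta>\<^sub>\<epsilon> :: "real vec"
  assumes L: "L \<in> carrier_mat n p" and A\<^sub>\<epsilon>: "A\<^sub>\<epsilon> \<in> carrier_mat n n"
    and eig: "eigvals A\<^sub>\<epsilon> = eigvals (A - L * C)"
    and \<epsilon>\<^sub>0: "\<epsilon>\<^sub>0 \<in> carrier_vec n" and \<eta>\<^sub>\<epsilon>: "\<eta>\<^sub>\<epsilon> \<in> carrier_vec n"
    and inv: "invertible_mat (adj_apply A\<^sub>\<epsilon> \<eta>\<^sub>\<epsilon>)"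
begin

definition H :: "real mat" where "H = A - L * C"

abbreviation (input) "nz \<equiv> (m + p + 1) * n"
abbreviation (input) "As \<equiv> filter_As m p H A\<^sub>\<epsilon>"
abbreviation (input) "Bu \<equiv> filter_Bu n m p"
abbreviation (input) "By \<equiv> filter_By n m p"
abbreviation (input) "S \<equiv> filter_S A B C L A\<^sub>\<epsilon> \<epsilon>\<^sub>0 \<eta>\<^sub>\<epsilon>"
abbreviation (input) "FA \<equiv> filter_A A B C L A\<^sub>\<epsilon> \<epsilon>\<^sub>0 \<eta>\<^sub>\<epsilon>"
abbreviation (input) "e \<equiv> unit_vec n (n - 1) :: real vec"
abbreviation (input) "T\<^sub>\<epsilon> \<equiv> adj_apply A\<^sub>\<epsilon> \<eta>\<^sub>\<epsilon>"

lemma H: "H \<in> carrier_mat n n"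
  unfolding H_def by (rule minus_carrier_mat[OF mult_carrier_mat[OF L C]])

lemma companion_eq: "companion A\<^sub>\<epsilon> = companion H"
  using char_poly_eq_if_eigvals_eq[OF A\<^sub>\<epsilon> H] eig A\<^sub>\<epsilon> H
  by (simp only: companion_def H_def[symmetric] Let_def carrier_matD)

lemmas comp = companion_carrier[OF H]
lemmas T\<^sub>\<epsilon> = adj_apply_carrier[OF A\<^sub>\<epsilon> \<eta>\<^sub>\<epsilon>]
lemmas inv_T\<^sub>\<epsilon> = mat_inverse_invertible[OF T\<^sub>\<epsilon> inv]

lemma T\<^sub>\<epsilon>_companion: "T\<^sub>\<epsilon> * companion H = A\<^sub>\<epsilon> * T\<^sub>\<epsilon>"
  using adj_apply_companion[OF A\<^sub>\<epsilon> \<eta>\<^sub>\<epsilon> n] by (simp add: companion_eq)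

text \<open>Block \<open>k\<close> of \<open>S\<close>, paired below with the diagonal block
  \<open>dyn k\<close> of \<open>As\<close>, so that one identity treats input, output and
  autonomous blocks alike.\<close>

definition gain :: "nat \<Rightarrow> real mat" where
  "gain k = (if k < m then adj_apply H (col B k)
             else if k < m + p then adj_apply H (col L (k - m))
             else adj_apply H \<epsilon>\<^sub>0 * the (mat_inverse T\<^sub>\<epsilon>))"

definition dyn :: "nat \<Rightarrow> real mat" where
  "dyn k = (if k < m + p then companion H else A\<^sub>\<epsilon>)"

lemma dyn_carrier: "dyn k \<in> carrier_mat n n"
  using comp A\<^sub>\<epsilon> by (simp add: dyn_def)

lemma cols: "col B k \<in> carrier_vec n" "col L k \<in> carrier_vec n"
  using B L by (auto intro: carrier_vecI)

lemma gain_carrier: "gain k \<in> carrier_mat n n"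
  using adj_apply_carrier[OF H] cols mult_carrier_mat[OF adj_apply_carrier[OF H \<epsilon>\<^sub>0] inv_T\<^sub>\<epsilon>(1)]
  by (simp add: gain_def)

text \<open>For driven blocks this is the companion identity. For the last one, the inverse of
  \<open>T\<^sub>\<epsilon>\<close> first conjugates \<open>A\<^sub>\<epsilon>\<close> back to the
  companion matrix, which the factor built from \<open>\<epsilon>\<^sub>0\<close> then carries over
  to \<open>H\<close>.\<close>

lemma gain_dyn: "gain k * dyn k = H * gain k"
proof (cases "k < m + p")
  case True
  then show ?thesis using adj_apply_companion[OF H _ n] cols by (simp add: gain_def dyn_def)
next
  case False
  let ?T = "adj_apply H \<epsilon>\<^sub>0" and ?J = "the (mat_inverse T\<^sub>\<epsilon>)"
  note T = adj_apply_carrier[OF H \<epsilon>\<^sub>0] and J = inv_T\<^sub>\<epsilon>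
  have "?J * A\<^sub>\<epsilon> = ?J * (A\<^sub>\<epsilon> * T\<^sub>\<epsilon>) * ?J"
    using J A\<^sub>\<epsilon> T\<^sub>\<epsilon> assoc_mult_mat[OF J(1) mult_carrier_mat[OF A\<^sub>\<epsilon> T\<^sub>\<epsilon>] J(1)] assoc_mult_mat[OF A\<^sub>\<epsilon> T\<^sub>\<epsilon> J(1)]
    by simp
  also have "?J * (A\<^sub>\<epsilon> * T\<^sub>\<epsilon>) = companion H"
    unfolding T\<^sub>\<epsilon>_companion[symmetric]
    using assoc_mult_mat[OF J(1) T\<^sub>\<epsilon> comp, symmetric] J comp by simp
  finally have JA: "?J * A\<^sub>\<epsilon> = companion H * ?J" .
  have "?T * ?J * A\<^sub>\<epsilon> = ?T * (companion H * ?J)"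
    using assoc_mult_mat[OF T J(1) A\<^sub>\<epsilon>] JA by simp
  also have "\<dots> = H * ?T * ?J"
    using assoc_mult_mat[OF T comp J(1), symmetric] adj_apply_companion[OF H \<epsilon>\<^sub>0 n] by simp
  also have "\<dots> = H * (?T * ?J)" by (rule assoc_mult_mat[OF H T J(1)])
  finally show ?thesis using False by (simp add: gain_def dyn_def)
qed

lemma filter_As_carrier: "As \<in> carrier_mat nz nz"
  using comp A\<^sub>\<epsilon> by (intro carrier_matI)
    (auto simp: filter_As_def dim_diag_block_mat kron_def block_mat_def algebra_simps)

lemma filter_As_slice:
  assumes v: "v \<in> carrier_vec nz" and k: "k < m + p + 1"
  shows "slice n k (As *\<^sub>v v) = dyn k *\<^sub>v slice n k v"
proof -
  let ?K = "kron (1\<^sub>m (m + p)) (companion H)"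
  have K: "?K \<in> carrier_mat ((m + p) * n) ((m + p) * n)" using comp by (auto simp: kron_def block_mat_def)
  define v1 v2 where "v1 = vec_first v ((m + p) * n)" and "v2 = vec_last v n"
  have v_eq: "v = v1 @\<^sub>v v2" using v by (simp add: v1_def v2_def algebra_simps)
  have v1: "v1 \<in> carrier_vec ((m + p) * n)" and v2: "v2 \<in> carrier_vec n" by (auto simp: v1_def v2_def)
  have Av: "As *\<^sub>v v = (?K *\<^sub>v v1) @\<^sub>v (A\<^sub>\<epsilon> *\<^sub>v v2)"
    unfolding filter_As_def v_eq by (rule diag_block_mat_pair_mult_vec[OF K A\<^sub>\<epsilon> v1 v2])
  show ?thesis
  proof (rule eq_vecI)
    fix i assume "i < dim_vec (dyn k *\<^sub>v slice n k v)"
    then have i: "i < n" using dyn_carrier[of k] by simp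
    show "slice n k (As *\<^sub>v v) $ i = (dyn k *\<^sub>v slice n k v) $ i"
    proof (cases "k < m + p")
      case True
      note ki = block_index_less[OF True]
      have "slice n k v = vec n (\<lambda>j. v1 $ (k * n + j))"
        unfolding slice_def v_eq using v1 v2 ki by (intro eq_vecI) (auto simp: trans_less_add1)
      moreover have "slice n k (As *\<^sub>v v) $ i = (?K *\<^sub>v v1) $ (k * n + i)"
        unfolding Av slice_index[OF i] using ki[OF i] K A\<^sub>\<epsilon> by (simp add: trans_less_add1)
      ultimately show ?thesis
        using kron_one_mult_vec_index[OF comp v1 True i] True by (simp add: dyn_def)
    next
      case False
      then have k: "k = m + p" using k by simp
      have "slice n k v = v2"
        unfolding slice_def v_eq k using v1 v2 by (intro eq_vecI) auto
      moreover have "slice n k (As *\<^sub>v v) $ i = (A\<^sub>\<epsilon> *\<^sub>v v2) $ i"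
        unfolding Av slice_index[OF i] k using i K A\<^sub>\<epsilon> by simp
      ultimately show ?thesis using False by (simp add: dyn_def)
    qed
  qed (use dyn_carrier[of k] in \<open>simp add: slice_def\<close>)
qed

text \<open>The output is a free argument: it is the measured output along a trajectory and the
  feedback \<open>C *\<^sub>v (S *\<^sub>v v)\<close> in the closed loop.\<close>

definition fstep :: "real vec \<Rightarrow> real vec \<Rightarrow> real vec \<Rightarrow> real vec" where
  "fstep v u y = As *\<^sub>v v + Bu *\<^sub>v u + By *\<^sub>v y"

lemma fstep_carrier:
  assumes "v \<in> carrier_vec nz" "u \<in> carrier_vec m" "y \<in> carrier_vec p"
  shows "fstep v u y \<in> carrier_vec nz"
  unfolding fstep_def using assms filter_As_carrier filter_B_carrier[of n m p]
  by (intro add_carrier_vec mult_mat_vec_carrier)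

lemma fstep_slice:
  assumes v: "v \<in> carrier_vec nz" and u: "u \<in> carrier_vec m" and y: "y \<in> carrier_vec p"
    and k: "k < m + p + 1"
  shows "slice n k (fstep v u y) = dyn k *\<^sub>v slice n k v + block_input m p u y k \<cdot>\<^sub>v e"
proof -
  have c: "As *\<^sub>v v \<in> carrier_vec nz" "Bu *\<^sub>v u \<in> carrier_vec nz" "By *\<^sub>v y \<in> carrier_vec nz"
    using v u y filter_As_carrier filter_B_carrier[of n m p] by auto
  have "slice n k (fstep v u y)
    = slice n k (As *\<^sub>v v) + slice n k (Bu *\<^sub>v u) + slice n k (By *\<^sub>v y)"
    unfolding fstep_def slice_add[OF add_carrier_vec[OF c(1,2)] c(3) k] slice_add[OF c(1,2) k] ..
  also have "\<dots> = slice n k (As *\<^sub>v v) + (slice n k (Bu *\<^sub>v u) + slice n k (By *\<^sub>v y))"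
    by (rule assoc_add_vec[OF slice_carrier slice_carrier slice_carrier])
  finally show ?thesis unfolding filter_B_slice[OF u y k] filter_As_slice[OF v k] .
qed

lemma filter_S_carrier: "S \<in> carrier_mat n nz"
  using A B C by (simp add: filter_S_def Let_def block_mat_def)

lemma filter_S_index:
  assumes v: "v \<in> carrier_vec nz" and r: "r < n"
  shows "(S *\<^sub>v v) $ r = (\<Sum>k<m + p + 1. (gain k *\<^sub>v slice n k v) $ r)"
proof -
  have "S = block_mat 1 (m + p + 1) n n (\<lambda>_. gain)"
    unfolding filter_S_def Let_def gain_def[abs_def] H_def
      carrier_matD(1)[OF A] carrier_matD(2)[OF B] carrier_matD(1)[OF C] ..
  then show ?thesis using block_row_mult_vec_index[OF gain_carrier v r] by simp
qed

text \<open>Block by block, \<open>S\<close> intertwines the filter dynamics with \<open>H\<close>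
  and maps the driven direction \<open>e\<close> to a column of \<open>B\<close> or
  \<open>L\<close>. No restriction on \<open>v\<close> arises, in contrast to the delayed
  case.\<close>

lemma filter_S_fstep:
  assumes v: "v \<in> carrier_vec nz" and u: "u \<in> carrier_vec m" and y: "y \<in> carrier_vec p"
  shows "S *\<^sub>v fstep v u y = H *\<^sub>v (S *\<^sub>v v) + B *\<^sub>v u + L *\<^sub>v y"
proof (rule eq_vecI)
  fix r assume "r < dim_vec (H *\<^sub>v (S *\<^sub>v v) + B *\<^sub>v u + L *\<^sub>v y)"
  then have r: "r < n" using L by simp
  have Sv: "S *\<^sub>v v \<in> carrier_vec n" using filter_S_carrier v by simp
  have Gk: "gain k *\<^sub>v slice n k v \<in> carrier_vec n" for k using gain_carrier[of k] by simp
  let ?g = "block_input m p u y"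
  have gain_fstep: "(gain k *\<^sub>v slice n k (fstep v u y)) $ r
    = (H *\<^sub>v (gain k *\<^sub>v slice n k v)) $ r + ?g k * (gain k *\<^sub>v e) $ r" if k: "k < m + p + 1" for k
  proof -
    have "gain k *\<^sub>v slice n k (fstep v u y) = gain k *\<^sub>v (dyn k *\<^sub>v slice n k v) + gain k *\<^sub>v (?g k \<cdot>\<^sub>v e)"
      unfolding fstep_slice[OF v u y k]
      using dyn_carrier[of k] by (intro mult_add_distrib_mat_vec[OF gain_carrier]) auto
    also have "gain k *\<^sub>v (dyn k *\<^sub>v slice n k v) = H *\<^sub>v (gain k *\<^sub>v slice n k v)"
      using assoc_mult_mat_vec[OF gain_carrier dyn_carrier slice_carrier]
        assoc_mult_mat_vec[OF H gain_carrier slice_carrier] gain_dyn by metis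
    also have "gain k *\<^sub>v (?g k \<cdot>\<^sub>v e) = ?g k \<cdot>\<^sub>v (gain k *\<^sub>v e)"
      by (rule mult_mat_vec[OF gain_carrier unit_vec_carrier])
    finally show ?thesis using r gain_carrier[of k] H by (simp del: index_mult_mat_vec)
  qed
  have "(S *\<^sub>v fstep v u y) $ r = (\<Sum>k<m + p + 1. (gain k *\<^sub>v slice n k (fstep v u y)) $ r)"
    by (rule filter_S_index[OF fstep_carrier[OF v u y] r])
  also have "\<dots> = (\<Sum>k<m + p + 1. (H *\<^sub>v (gain k *\<^sub>v slice n k v)) $ r)
    + (\<Sum>k<m + p + 1. ?g k * (gain k *\<^sub>v e) $ r)"
    using gain_fstep by (simp add: sum.distrib del: index_mult_mat_vec)
  also have "(\<Sum>k<m + p + 1. (H *\<^sub>v (gain k *\<^sub>v slice n k v)) $ r) = (H *\<^sub>v (S *\<^sub>v v)) $ r"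
  proof -
    have "(\<Sum>k<m + p + 1. (H *\<^sub>v (gain k *\<^sub>v slice n k v)) $ r)
      = (\<Sum>k<m + p + 1. \<Sum>c<n. H $$ (r, c) * (gain k *\<^sub>v slice n k v) $ c)"
      by (simp only: mult_mat_vec_index_sum[OF H Gk r])
    also have "\<dots> = (\<Sum>c<n. H $$ (r, c) * (\<Sum>k<m + p + 1. (gain k *\<^sub>v slice n k v) $ c))"
      by (subst sum.swap) (simp only: sum_distrib_left)
    also have "\<dots> = (\<Sum>c<n. H $$ (r, c) * (S *\<^sub>v v) $ c)"
      by (intro sum.cong[OF refl]) (simp only: lessThan_iff filter_S_index[OF v])
    also have "\<dots> = (H *\<^sub>v (S *\<^sub>v v)) $ r" by (rule mult_mat_vec_index_sum[OF H Sv r, symmetric])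
    finally show ?thesis .
  qed
  also have "(\<Sum>k<m + p + 1. ?g k * (gain k *\<^sub>v e) $ r)
    = (\<Sum>k<m. ?g k * (gain k *\<^sub>v e) $ r) + (\<Sum>j<p. ?g (m + j) * (gain (m + j) *\<^sub>v e) $ r)"
    by (simp add: sum_lessThan_add block_input_def)
  also have "(\<Sum>k<m. ?g k * (gain k *\<^sub>v e) $ r) = (\<Sum>k<m. B $$ (r, k) * u $ k)"
    using adj_apply_unit_vec[OF H cols(1) n] r B
    by (intro sum.cong) (auto simp: block_input_def gain_def simp del: index_mult_mat_vec)
  also have "\<dots> = (B *\<^sub>v u) $ r" by (rule mult_mat_vec_index_sum[OF B u r, symmetric])
  also have "(\<Sum>j<p. ?g (m + j) * (gain (m + j) *\<^sub>v e) $ r) = (\<Sum>j<p. L $$ (r, j) * y $ j)"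
    using adj_apply_unit_vec[OF H cols(2) n] r L
    by (intro sum.cong) (auto simp: block_input_def gain_def simp del: index_mult_mat_vec)
  also have "\<dots> = (L *\<^sub>v y) $ r" by (rule mult_mat_vec_index_sum[OF L y r, symmetric])
  finally show "(S *\<^sub>v fstep v u y) $ r = (H *\<^sub>v (S *\<^sub>v v) + B *\<^sub>v u + L *\<^sub>v y) $ r"
    using r L B H by (simp add: add.assoc del: index_mult_mat_vec)
next
  show "dim_vec (S *\<^sub>v fstep v u y) = dim_vec (H *\<^sub>v (S *\<^sub>v v) + B *\<^sub>v u + L *\<^sub>v y)"
    using filter_S_carrier L by simp
qed

lemma A_eq_observer:
  assumes x: "x \<in> carrier_vec n"
  shows "A *\<^sub>v x = H *\<^sub>v x + L *\<^sub>v (C *\<^sub>v x)"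
proof -
  have "H *\<^sub>v x = A *\<^sub>v x - L *\<^sub>v (C *\<^sub>v x)"
    unfolding H_def minus_mult_distrib_mat_vec[OF A mult_carrier_mat[OF L C] x]
      assoc_mult_mat_vec[OF L C x] ..
  then show ?thesis using A L by (intro eq_vecI) (auto simp del: index_mult_mat_vec)
qed

lemma filter_A_carrier: "FA \<in> carrier_mat nz nz"
  using add_carrier_mat[OF mult_carrier_mat[OF mult_carrier_mat[OF filter_B_carrier(2) C] filter_S_carrier]]
    A B C by (simp add: filter_A_def Let_def)

lemma filter_A_step:
  assumes v: "v \<in> carrier_vec nz" and u: "u \<in> carrier_vec m"
  shows "FA *\<^sub>v v + Bu *\<^sub>v u = fstep v u (C *\<^sub>v (S *\<^sub>v v))"
proof -
  note By = filter_B_carrier(2)[of n m p] and Bu = filter_B_carrier(1)[of n m p]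
  have Sv: "S *\<^sub>v v \<in> carrier_vec n" using filter_S_carrier v by simp
  have "FA *\<^sub>v v = As *\<^sub>v v + (By * C * S) *\<^sub>v v"
    using A B C add_mult_distrib_mat_vec[OF filter_As_carrier mult_carrier_mat[OF mult_carrier_mat[OF By C] filter_S_carrier] v]
    by (simp add: filter_A_def Let_def H_def)
  also have "(By * C * S) *\<^sub>v v = By *\<^sub>v (C *\<^sub>v (S *\<^sub>v v))"
    unfolding assoc_mult_mat_vec[OF mult_carrier_mat[OF By C] filter_S_carrier v]
    by (rule assoc_mult_mat_vec[OF By C Sv])
  finally show ?thesis
    unfolding fstep_def using filter_As_carrier By Bu
    by (intro eq_vecI) (auto simp del: index_mult_mat_vec)
qed

text \<open>Feeding back the output computed from \<open>S\<close> turns the observer equation into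
  the plant equation, because A = H + L C.\<close>

lemma filter_S_reach:
  assumes u: "\<forall>t. u t \<in> carrier_vec m"
  shows "S *\<^sub>v reach FA Bu u t = reach A B u t"
proof (induction t)
  case 0
  then show ?case using filter_S_carrier filter_A_carrier A by (auto intro!: eq_vecI)
next
  case (Suc t)
  let ?v = "reach FA Bu u t" and ?x = "reach A B u t"
  have v: "?v \<in> carrier_vec nz" by (rule reach_carrier[OF filter_A_carrier filter_B_carrier(1) u])
  have x: "?x \<in> carrier_vec n" by (rule reach_carrier[OF A B u])
  have ut: "u t \<in> carrier_vec m" using u by simp
  have "S *\<^sub>v reach FA Bu u (Suc t) = S *\<^sub>v fstep ?v (u t) (C *\<^sub>v ?x)"
    using filter_A_step[OF v ut] Suc by simp
  also have "\<dots> = H *\<^sub>v ?x + B *\<^sub>v u t + L *\<^sub>v (C *\<^sub>v ?x)"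
    using filter_S_fstep[OF v ut, of "C *\<^sub>v ?x"] C x Suc by simp
  also have "\<dots> = A *\<^sub>v ?x + B *\<^sub>v u t"
    unfolding A_eq_observer[OF x] using H L B by (intro eq_vecI) (auto simp del: index_mult_mat_vec)
  finally show ?case by simp
qed

end

section \<open>Autonomous block, observer error and reached filter states\<close>

context filter_lti
begin

lemma reach_last_slice:
  assumes u: "\<forall>t. u t \<in> carrier_vec m"
  shows "slice n (m + p) (reach FA Bu u t) = 0\<^sub>v n"
proof (induction t)
  case 0
  then show ?case using filter_A_carrier slice_zero[of "m + p" "m + p + 1" n] by simp
next
  case (Suc t)
  let ?v = "reach FA Bu u t"
  have v: "?v \<in> carrier_vec nz" by (rule reach_carrier[OF filter_A_carrier filter_B_carrier(1) u])
  have ut: "u t \<in> carrier_vec m" using u by simp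
  have y: "C *\<^sub>v (S *\<^sub>v ?v) \<in> carrier_vec p" using C filter_S_carrier v by simp
  have "slice n (m + p) (reach FA Bu u (Suc t))
    = A\<^sub>\<epsilon> *\<^sub>v 0\<^sub>v n + 0 \<cdot>\<^sub>v e"
    using filter_A_step[OF v ut] fstep_slice[OF v ut y, of "m + p"] Suc
    by (simp add: dyn_def block_input_def)
  also have "\<dots> = 0\<^sub>v n" using A\<^sub>\<epsilon> by (intro eq_vecI) auto
  finally show ?case .
qed

text \<open>\<open>S *\<^sub>v \<eta> t\<close> and the plant state receive the same input and
  output injection, so both cancel in the difference and only \<open>H\<close> acts on it.\<close>

lemma error_propagation:
  assumes traj: "lti_trajectory A B C u x y" and \<eta>0: "\<eta> 0 \<in> carrier_vec nz"
    and \<eta>: "\<forall>s. \<eta> (Suc s) = fstep (\<eta> s) (u s) (y s)"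
  shows "\<eta> t \<in> carrier_vec nz" "x t - S *\<^sub>v \<eta> t = H ^\<^sub>m t *\<^sub>v (x 0 - S *\<^sub>v \<eta> 0)"
proof -
  note T = lti_trajectoryD[OF traj]
  have \<eta>c: "\<eta> t \<in> carrier_vec nz" for t
    by (induction t) (use \<eta>0 fstep_carrier T in \<open>auto simp: \<eta>\<close>)
  have Sc: "S *\<^sub>v \<eta> t \<in> carrier_vec n" for t using filter_S_carrier \<eta>c by simp
  have d0: "x 0 - S *\<^sub>v \<eta> 0 \<in> carrier_vec n" using T(2) Sc by simp
  show "\<eta> t \<in> carrier_vec nz" by (rule \<eta>c)
  show "x t - S *\<^sub>v \<eta> t = H ^\<^sub>m t *\<^sub>v (x 0 - S *\<^sub>v \<eta> 0)"
  proof (induction t)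
    case 0
    then show ?case using H d0 by simp
  next
    case (Suc t)
    have x: "x t \<in> carrier_vec n" using T(2) by simp
    have "S *\<^sub>v \<eta> (Suc t) = H *\<^sub>v (S *\<^sub>v \<eta> t) + B *\<^sub>v u t + L *\<^sub>v (C *\<^sub>v x t)"
      using filter_S_fstep[OF \<eta>c] T \<eta> by metis
    moreover have "x (Suc t) = H *\<^sub>v x t + L *\<^sub>v (C *\<^sub>v x t) + B *\<^sub>v u t"
      using T(3) A_eq_observer[OF x] by simp
    ultimately have "x (Suc t) - S *\<^sub>v \<eta> (Suc t) = H *\<^sub>v x t - H *\<^sub>v (S *\<^sub>v \<eta> t)"
      using H B L by (intro eq_vecI) (auto simp del: index_mult_mat_vec)
    also have "\<dots> = H *\<^sub>v (x t - S *\<^sub>v \<eta> t)"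
      by (rule mult_minus_distrib_mat_vec[OF H x Sc, symmetric])
    finally show ?case unfolding Suc pow_mat_mult_vec_Suc[OF H d0] .
  qed
qed

lemma autonomous_slice:
  assumes \<eta>: "\<forall>s. \<eta> (Suc s) = fstep (\<eta> s) (u s) (y s)" and c: "\<forall>s. \<eta> s \<in> carrier_vec nz"
    and u: "\<forall>s. u s \<in> carrier_vec m" and y: "\<forall>s. y s \<in> carrier_vec p"
    and \<eta>0: "\<eta> 0 = 0\<^sub>v ((m + p) * n) @\<^sub>v \<eta>\<^sub>\<epsilon>"
  shows "slice n (m + p) (\<eta> t) = A\<^sub>\<epsilon> ^\<^sub>m t *\<^sub>v \<eta>\<^sub>\<epsilon>"
proof (induction t)
  case 0
  have "slice n (m + p) (\<eta> 0) = \<eta>\<^sub>\<epsilon>"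
    unfolding slice_def \<eta>0 using \<eta>\<^sub>\<epsilon> by (intro eq_vecI) auto
  then show ?case using A\<^sub>\<epsilon> \<eta>\<^sub>\<epsilon> by simp
next
  case (Suc t)
  have "slice n (m + p) (\<eta> (Suc t)) = A\<^sub>\<epsilon> *\<^sub>v slice n (m + p) (\<eta> t) + 0 \<cdot>\<^sub>v e"
    using \<eta> fstep_slice[OF c[rule_format, of t] u[rule_format, of t] y[rule_format, of t], of "m + p"]
    by (simp add: dyn_def block_input_def)
  also have "\<dots> = A\<^sub>\<epsilon> *\<^sub>v slice n (m + p) (\<eta> t)" using A\<^sub>\<epsilon> by (intro eq_vecI) auto
  finally show ?case unfolding Suc pow_mat_mult_vec_Suc[OF A\<^sub>\<epsilon> \<eta>\<^sub>\<epsilon>] .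
qed

text \<open>\<open>T\<^sub>\<epsilon>\<close> sends \<open>e\<close> to
  \<open>\<eta>\<^sub>\<epsilon>\<close> and intertwines the two dynamics. As it is invertible, one
  orbit dies out exactly when the other does.\<close>

lemma autonomous_eq_companion: "A\<^sub>\<epsilon> ^\<^sub>m t *\<^sub>v \<eta>\<^sub>\<epsilon> = T\<^sub>\<epsilon> *\<^sub>v (companion H ^\<^sub>m t *\<^sub>v e)"
  using pow_mat_intertwine_vec[OF T\<^sub>\<epsilon> comp A\<^sub>\<epsilon> T\<^sub>\<epsilon>_companion unit_vec_carrier, of t]
    adj_apply_unit_vec[OF A\<^sub>\<epsilon> \<eta>\<^sub>\<epsilon> n] by simp

lemma companion_vanishes:
  assumes "A\<^sub>\<epsilon> ^\<^sub>m t *\<^sub>v \<eta>\<^sub>\<epsilon> = 0\<^sub>v n"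
  shows "companion H ^\<^sub>m t *\<^sub>v e = 0\<^sub>v n"
proof -
  let ?v = "companion H ^\<^sub>m t *\<^sub>v e" and ?J = "the (mat_inverse T\<^sub>\<epsilon>)"
  have v: "?v \<in> carrier_vec n" using mult_mat_vec_carrier[OF pow_carrier_mat[OF comp] unit_vec_carrier] .
  have "?v = (?J * T\<^sub>\<epsilon>) *\<^sub>v ?v" using inv_T\<^sub>\<epsilon>(3) v by simp
  also have "\<dots> = ?J *\<^sub>v 0\<^sub>v n"
    using assoc_mult_mat_vec[OF inv_T\<^sub>\<epsilon>(1) T\<^sub>\<epsilon> v] assms autonomous_eq_companion by simp
  also have "\<dots> = 0\<^sub>v n" by (rule mult_mat_zero_vec[OF inv_T\<^sub>\<epsilon>(1)])
  finally show ?thesis .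
qed

text \<open>Every \<open>w\<close> is the image of the same vector \<open>e\<close> under an
  intertwiner, namely \<open>adj_apply H w\<close>, so the vanishing of the orbit of
  \<open>e\<close> settles all \<open>w\<close> at once.\<close>

lemma observer_nilpotent:
  assumes vanish: "companion H ^\<^sub>m t *\<^sub>v e = 0\<^sub>v n" and w: "w \<in> carrier_vec n"
  shows "H ^\<^sub>m t *\<^sub>v w = 0\<^sub>v n"
proof -
  note T = adj_apply_carrier[OF H w]
  have "H ^\<^sub>m t *\<^sub>v w = adj_apply H w *\<^sub>v (companion H ^\<^sub>m t *\<^sub>v e)"
    using pow_mat_intertwine_vec[OF T comp H adj_apply_companion[OF H w n] unit_vec_carrier, of t]
      adj_apply_unit_vec[OF H w n] by simp
  also have "\<dots> = 0\<^sub>v n" unfolding vanish by (rule mult_mat_zero_vec[OF T])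
  finally show ?thesis .
qed

abbreviation (input) "Z \<equiv> filter_pairs A B C L A\<^sub>\<epsilon> \<epsilon>\<^sub>0 \<eta>\<^sub>\<epsilon>"

lemma filter_pairsE:
  assumes "(x', \<zeta>) \<in> Z"
  obtains u x y \<eta> t where "lti_trajectory A B C u x y" "x' = x t" "\<zeta> = \<eta> t"
    "\<eta> 0 = 0\<^sub>v ((m + p) * n) @\<^sub>v \<eta>\<^sub>\<epsilon>" "\<eta> 0 \<in> carrier_vec nz" "\<forall>s. \<eta> (Suc s) = fstep (\<eta> s) (u s) (y s)"
proof -
  have "0\<^sub>v ((m + p) * n) @\<^sub>v \<eta>\<^sub>\<epsilon> \<in> carrier_vec nz" using \<eta>\<^sub>\<epsilon> by (auto intro!: carrier_vecI simp: algebra_simps)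
  with assms show thesis
    using that A B C unfolding filter_pairs_def Let_def fstep_def H_def by auto
qed

text \<open>The autonomous block of the filter state cannot be excited, so a state in the controllable
  subspace is only met after this block has died out. Since \<open>\<eta>\<^sub>\<epsilon>\<close> is cyclic for \<open>A\<^sub>\<epsilon>\<close>, the observer
  error has then died out as well, whatever the initial observer state.\<close>

lemma companion_vanishes_if_reached:
  assumes Z: "(x', \<zeta>) \<in> Z" and reached: "\<zeta> \<in> mat_im (ctrb FA Bu)"
  obtains t where "companion H ^\<^sub>m t *\<^sub>v e = 0\<^sub>v n" "x' = S *\<^sub>v \<zeta>"
proof -
  obtain u x y \<eta> t where traj: "lti_trajectory A B C u x y" and eqs: "x' = x t" "\<zeta> = \<eta> t"
    and \<eta>0: "\<eta> 0 = 0\<^sub>v ((m + p) * n) @\<^sub>v \<eta>\<^sub>\<epsilon>" "\<eta> 0 \<in> carrier_vec nz"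
    and \<eta>: "\<forall>s. \<eta> (Suc s) = fstep (\<eta> s) (u s) (y s)"
    using Z by (elim filter_pairsE)
  note T = lti_trajectoryD[OF traj]
  note err = error_propagation[OF traj \<eta>0(2) \<eta>]
  obtain u' where u': "\<forall>t. u' t \<in> carrier_vec m" "\<zeta> = reach FA Bu u' nz"
    using reached unfolding mat_im_ctrb[OF filter_A_carrier filter_B_carrier(1)] by blast
  have "A\<^sub>\<epsilon> ^\<^sub>m t *\<^sub>v \<eta>\<^sub>\<epsilon> = slice n (m + p) \<zeta>"
    unfolding eqs using autonomous_slice[OF \<eta> _ T(1,5) \<eta>0(1)] err(1) by simp
  also have "\<dots> = 0\<^sub>v n" unfolding u'(2) by (rule reach_last_slice[OF u'(1)])
  finally have van: "companion H ^\<^sub>m t *\<^sub>v e = 0\<^sub>v n" by (rule companion_vanishes)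
  have Sc: "S *\<^sub>v \<eta> s \<in> carrier_vec n" for s using filter_S_carrier err(1) by simp
  have xc: "x s \<in> carrier_vec n" for s using T(2) by simp
  have diff: "x t - S *\<^sub>v \<eta> t = 0\<^sub>v n"
    unfolding err(2)[of t] using observer_nilpotent[OF van] Sc xc by simp
  have "x t = S *\<^sub>v \<eta> t"
  proof (rule eq_vecI)
    fix i assume "i < dim_vec (S *\<^sub>v \<eta> t)"
    then have i: "i < n" using filter_S_carrier by simp
    have "(x t - S *\<^sub>v \<eta> t) $ i = x t $ i - (S *\<^sub>v \<eta> t) $ i"
      using i filter_S_carrier by (simp del: index_mult_mat_vec)
    then show "x t $ i = (S *\<^sub>v \<eta> t) $ i" using i unfolding diff by (simp del: index_mult_mat_vec)
  qed (use xc[of t] filter_S_carrier in simp)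
  with van show thesis using that eqs by blast
qed

text \<open>Idle with the plant at rest until the autonomous block has died out. All filter blocks
  are then zero, and the input that steers the closed loop from zero to \<open>z\<close> does the
  same here.\<close>

lemma reached_in_filter_pairs:
  assumes vanish: "companion H ^\<^sub>m t0 *\<^sub>v e = 0\<^sub>v n" and z: "z \<in> mat_im (ctrb FA Bu)"
  shows "\<exists>x. (x, z) \<in> Z"
proof -
  obtain u where u: "\<forall>t. u t \<in> carrier_vec m" and z_eq: "z = reach FA Bu u nz"
    using z unfolding mat_im_ctrb[OF filter_A_carrier filter_B_carrier(1)] by blast
  define u' where "u' t = (if t < t0 then 0\<^sub>v m else u (t - t0))" for t
  have u': "\<forall>t. u' t \<in> carrier_vec m" using u by (simp add: u'_def)
  define x where "x = reach A B u'"
  define y where "y t = C *\<^sub>v x t" for t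
  define \<eta> where "\<eta> = rec_nat (0\<^sub>v ((m + p) * n) @\<^sub>v \<eta>\<^sub>\<epsilon>) (\<lambda>t v. fstep v (u' t) (y t))"
  \<comment> \<open>With the plant at zero, this observer start produces the prescribed initial
    error.\<close>
  define xc where "xc = rec_nat (- \<epsilon>\<^sub>0) (\<lambda>t v. H *\<^sub>v v + B *\<^sub>v u' t + L *\<^sub>v y t)"
  have \<eta>0: "\<eta> 0 = 0\<^sub>v ((m + p) * n) @\<^sub>v \<eta>\<^sub>\<epsilon>" and \<eta>: "\<forall>s. \<eta> (Suc s) = fstep (\<eta> s) (u' s) (y s)"
    by (auto simp: \<eta>_def)
  have xc: "xc 0 = - \<epsilon>\<^sub>0" "\<And>s. xc (Suc s) = H *\<^sub>v xc s + B *\<^sub>v u' s + L *\<^sub>v y s" by (auto simp: xc_def)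
  have x0: "x 0 = 0\<^sub>v n" using A by (simp add: x_def)
  have traj: "lti_trajectory A B C u' x y"
    unfolding lti_trajectory_def using u' reach_carrier[OF A B u'] A B by (auto simp: x_def y_def)
  note T = lti_trajectoryD[OF traj]
  have \<eta>0c: "\<eta> 0 \<in> carrier_vec nz" unfolding \<eta>0 using \<eta>\<^sub>\<epsilon> by (auto intro!: carrier_vecI simp: algebra_simps)
  note \<eta>c = error_propagation(1)[OF traj \<eta>0c \<eta>]
  have pair: "(x t, \<eta> t) \<in> Z" for t
  proof -
    have "\<epsilon>\<^sub>0 = x 0 - xc 0" using \<epsilon>\<^sub>0 unfolding x0 xc by (intro eq_vecI) auto
    moreover have "xc 0 \<in> carrier_vec n" using \<epsilon>\<^sub>0 xc(1) by simp
    ultimately have "lti_trajectory A B C u' x y \<and> xc 0 \<in> carrier_vec n \<and>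
        (\<forall>s. xc (Suc s) = H *\<^sub>v xc s + B *\<^sub>v u' s + L *\<^sub>v y s) \<and> \<epsilon>\<^sub>0 = x 0 - xc 0 \<and>
        \<eta> 0 = 0\<^sub>v ((m + p) * n) @\<^sub>v \<eta>\<^sub>\<epsilon> \<and> (\<forall>s. \<eta> (Suc s) = fstep (\<eta> s) (u' s) (y s))"
      using traj xc(2) \<eta>0 \<eta> by simp
    then show ?thesis
      unfolding filter_pairs_def Let_def carrier_matD(1)[OF A] carrier_matD(2)[OF B] carrier_matD(1)[OF C]
        H_def[symmetric] fstep_def[symmetric] by blast
  qed
  have x_rest: "x t = 0\<^sub>v n" if "t \<le> t0" for t
    unfolding x_def by (rule reach_zero_input[OF A B]) (use that in \<open>simp add: u'_def\<close>)
  have slice0: "slice n k (\<eta> t) = 0\<^sub>v n" if "t \<le> t0" and k: "k < m + p" for t k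
    using that(1)
  proof (induction t)
    case 0
    show ?case
      unfolding slice_def \<eta>0 using \<eta>\<^sub>\<epsilon> block_index_less[OF k, of _ n]
      by (intro eq_vecI) (auto simp: trans_less_add1)
  next
    case (Suc t)
    have "C *\<^sub>v 0\<^sub>v n = 0\<^sub>v p" by (rule mult_mat_zero_vec[OF C])
    then have "y t = 0\<^sub>v p" using x_rest[of t] Suc by (simp add: y_def)
    moreover have "u' t = 0\<^sub>v m" using Suc by (simp add: u'_def)
    ultimately have "block_input m p (u' t) (y t) k = 0" using k by (auto simp: block_input_def)
    moreover have "slice n k (\<eta> (Suc t)) = dyn k *\<^sub>v slice n k (\<eta> t) + block_input m p (u' t) (y t) k \<cdot>\<^sub>v e"
      unfolding \<eta>[rule_format] using k T(1,5) \<eta>c by (intro fstep_slice) auto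
    ultimately have "slice n k (\<eta> (Suc t)) = dyn k *\<^sub>v 0\<^sub>v n + 0 \<cdot>\<^sub>v e" using Suc by simp
    also have "\<dots> = 0\<^sub>v n" using dyn_carrier[of k] by (intro eq_vecI) auto
    finally show ?case .
  qed
  have "A\<^sub>\<epsilon> ^\<^sub>m t0 *\<^sub>v \<eta>\<^sub>\<epsilon> = 0\<^sub>v n"
    unfolding autonomous_eq_companion vanish by (rule mult_mat_zero_vec[OF T\<^sub>\<epsilon>])
  moreover have "slice n (m + p) (\<eta> t0) = A\<^sub>\<epsilon> ^\<^sub>m t0 *\<^sub>v \<eta>\<^sub>\<epsilon>"
    using autonomous_slice[OF \<eta> _ T(1,5) \<eta>0] \<eta>c by simp
  ultimately have slice1: "slice n k (\<eta> t0) = 0\<^sub>v n" if "k < m + p + 1" for k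
    using that slice0[of t0 k] by (cases "k = m + p") auto
  have start: "\<eta> t0 = 0\<^sub>v nz"
    by (rule eq_vec_slices[OF \<eta>c zero_carrier_vec]) (simp only: slice1 slice_zero)
  have "\<eta> (t0 + s) = reach FA Bu u s" for s
  proof (induction s)
    case 0
    then show ?case using start filter_A_carrier by simp
  next
    case (Suc s)
    let ?v = "reach FA Bu u s"
    have v: "?v \<in> carrier_vec nz" by (rule reach_carrier[OF filter_A_carrier filter_B_carrier(1) u])
    have us: "u s \<in> carrier_vec m" using u by simp
    have "x (t0 + s) = reach A B u s"
      unfolding x_def by (rule reach_delay[OF A B]) (auto simp: u'_def)
    then have "y (t0 + s) = C *\<^sub>v (S *\<^sub>v ?v)" by (simp add: y_def filter_S_reach[OF u])
    then show ?case using Suc \<eta> filter_A_step[OF v us] by (simp add: u'_def)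
  qed
  then show ?thesis using pair[of "t0 + nz"] z_eq by auto
qed

text \<open>Row permutation between the channel-major ordering of the filter state and the time-major
  ordering of the history.\<close>

definition reorder_index :: "nat \<Rightarrow> nat" where
  "reorder_index i = (if i < m * n then i mod m * n + i div m
                      else (m + (i - m * n) mod p) * n + (i - m * n) div p)"

definition reorder :: "real mat" where
  "reorder = mat (m * n + p * n) nz (\<lambda>(i, j). if j = reorder_index i then 1 else 0)"

lemma reorder_mult_vec_index:
  assumes v: "v \<in> carrier_vec nz" and i: "i < m * n + p * n"
  shows "(reorder *\<^sub>v v) $ i = (if i < m * n then slice n (i mod m) v $ (i div m)
    else slice n (m + (i - m * n) mod p) v $ ((i - m * n) div p))"
proof -
  have R: "reorder \<in> carrier_mat (m * n + p * n) nz" by (simp add: reorder_def)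
  define k l where "k = (if i < m * n then i mod m else m + (i - m * n) mod p)"
    and "l = (if i < m * n then i div m else (i - m * n) div p)"
  have kl: "k < m + p + 1" "l < n"
  proof -
    have "k < m + p + 1 \<and> l < n"
    proof (cases "i < m * n")
      case True
      then have "0 < m" by (metis gr0I mult_0 not_less_zero)
      then have "i mod m < m" by simp
      then show ?thesis using True by (simp add: k_def l_def less_mult_imp_div_less mult.commute)
    next
      case False
      then have j: "i - m * n < p * n" using i by simp
      then have "0 < p" by (metis gr0I mult_0 not_less_zero)
      then have "(i - m * n) mod p < p" by simp
      then show ?thesis using False j by (simp add: k_def l_def less_mult_imp_div_less mult.commute)
    qed
    then show "k < m + p + 1" "l < n" by auto
  qed
  have ri: "reorder_index i = k * n + l" by (simp add: reorder_index_def k_def l_def)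
  have "(reorder *\<^sub>v v) $ i = (\<Sum>j<nz. if j = k * n + l then v $ j else 0)"
    unfolding mult_mat_vec_index_sum[OF R v i]
    using i by (intro sum.cong) (auto simp: reorder_def ri)
  also have "\<dots> = v $ (k * n + l)" using block_index_less[OF kl] by simp
  also have "\<dots> = slice n k v $ l" using kl by (simp add: slice_index)
  finally show ?thesis by (simp add: k_def l_def)
qed

text \<open>With a nilpotent companion matrix every driven block is a shift register, storing the
  last \<open>n\<close> values of its signal. Up to order this is the delayed history, so
  \<open>unhistory\<close> can be reused for the dimension count.\<close>

lemma reorder_reach:
  assumes spec: "spectrum (map_mat complex_of_real H) \<subseteq> {0}" and u: "\<forall>t. u t \<in> carrier_vec m"
  shows "reorder *\<^sub>v reach FA Bu u t = io_history n m p (delayed_input u) (rest_output u) (n + t)"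
proof -
  let ?d = "delayed_input u" and ?y = "rest_output u"
  define f where "f k s = (if k < m then ?d s $ k else ?y s $ (k - m))" for k s
  have v: "reach FA Bu u t \<in> carrier_vec nz" for t
    by (rule reach_carrier[OF filter_A_carrier filter_B_carrier(1) u])
  have comp_index: "(companion H *\<^sub>v w) $ i = (if i + 1 < n then w $ (i + 1) else 0)"
    if "w \<in> carrier_vec n" "i < n" for w i
    by (rule companion_mult_vec_index[OF H char_poly_coeff_if_spectrum_zero[OF H spec] that])
  \<comment> \<open>In delayed time slot \<open>i\<close> holds the signal of \<open>n - i\<close>
    steps ago. One step moves slot \<open>i + 1\<close> to slot \<open>i\<close>, hence the
    induction for all \<open>i\<close>.\<close>
  have sl: "slice n k (reach FA Bu u t) $ i = f k (t + i)" if k: "k < m + p" and "i < n" for k i t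
    using that(2)
  proof (induction t arbitrary: i)
    case 0
    have "C *\<^sub>v 0\<^sub>v n = 0\<^sub>v p" by (rule mult_mat_zero_vec[OF C])
    then have "?y i = 0\<^sub>v p" using rest_state_before[of i u] 0 by (simp add: rest_output_def)
    then have "f k i = 0" using 0 k by (auto simp: f_def delayed_input_def)
    then show ?case using filter_A_carrier slice_zero[of k "m + p + 1" n] k 0 by simp
  next
    case (Suc t)
    let ?v = "reach FA Bu u t"
    have ut: "u t \<in> carrier_vec m" using u by simp
    have y_eq: "C *\<^sub>v (S *\<^sub>v ?v) = ?y (t + n)"
      unfolding filter_S_reach[OF u] rest_output_def by (simp add: rest_state_add[symmetric] add.commute)
    have y: "C *\<^sub>v (S *\<^sub>v ?v) \<in> carrier_vec p" using C filter_S_carrier v[of t] by simp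
    have d_eq: "?d (t + n) = u t" by (simp add: delayed_input_def)
    have "slice n k (reach FA Bu u (Suc t))
      = companion H *\<^sub>v slice n k ?v + f k (t + n) \<cdot>\<^sub>v e"
      using filter_A_step[OF v ut] fstep_slice[OF v ut y, of k] k d_eq y_eq
      by (simp add: dyn_def block_input_def f_def)
    also have "\<dots> $ i = (if i + 1 < n then slice n k ?v $ (i + 1) else f k (t + n))"
      using Suc.prems comp_index[OF slice_carrier Suc.prems, of k ?v] comp by (auto simp del: index_mult_mat_vec)
    also have "\<dots> = f k (Suc t + i)"
    proof (cases "i + 1 < n")
      case True
      then show ?thesis using Suc.IH[OF True] by simp
    next
      case False
      then have "n = Suc i" using Suc.prems by simp
      then show ?thesis by simp
    qed
    finally show ?case .
  qed
  show ?thesis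
  proof (rule eq_vecI)
    fix i assume "i < dim_vec (io_history n m p ?d ?y (n + t))"
    then have i: "i < m * n + p * n" by (simp add: io_history_eq_window)
    show "(reorder *\<^sub>v reach FA Bu u t) $ i = io_history n m p ?d ?y (n + t) $ i"
    proof (cases "i < m * n")
      case True
      then have "0 < m" by (metis gr0I mult_0 not_less_zero)
      then have "i mod m < m" "i div m < n"
        using True by (auto simp: less_mult_imp_div_less mult.commute)
      then show ?thesis
        unfolding reorder_mult_vec_index[OF v i]
        using True sl[of "i mod m" "i div m" t] i
        by (simp add: f_def io_history_eq_window window_def)
    next
      case False
      then have j: "i - m * n < p * n" using i by simp
      then have "0 < p" by (metis gr0I mult_0 not_less_zero)
      then have "(i - m * n) mod p < p" "(i - m * n) div p < n"
        using j by (auto simp: less_mult_imp_div_less mult.commute)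
      then show ?thesis
        unfolding reorder_mult_vec_index[OF v i]
        using False j sl[of "m + (i - m * n) mod p" "(i - m * n) div p" t] i
        by (simp add: f_def io_history_eq_window window_def)
    qed
  qed (simp add: reorder_def io_history_eq_window)
qed

end

section \<open>Uniqueness of the state map and the two cases\<close>

text \<open>Each reduced state occurs in some pair, in particular every unit vector, so the columns
  of a valid matrix are forced.\<close>

lemma unique_matrix_of_surj_pairs:
  fixes F :: "real mat"
  assumes F: "F \<in> carrier_mat n k"
    and sound: "\<And>x \<zeta> v. (x, \<zeta>) \<in> Z \<Longrightarrow> v \<in> carrier_vec k \<Longrightarrow> \<zeta> = P *\<^sub>v v \<Longrightarrow> x = F *\<^sub>v v"
    and full: "\<And>v. v \<in> carrier_vec k \<Longrightarrow> \<exists>x. (x, P *\<^sub>v v) \<in> Z"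
  shows "\<exists>!F. F \<in> carrier_mat n k \<and> (\<forall>(x, \<zeta>) \<in> Z. \<forall>v \<in> carrier_vec k. \<zeta> = P *\<^sub>v v \<longrightarrow> x = F *\<^sub>v v)"
proof (rule ex1I[of _ F])
  show "F \<in> carrier_mat n k \<and> (\<forall>(x, \<zeta>) \<in> Z. \<forall>v \<in> carrier_vec k. \<zeta> = P *\<^sub>v v \<longrightarrow> x = F *\<^sub>v v)"
    using F sound by blast
  fix G :: "real mat"
  assume G: "G \<in> carrier_mat n k \<and> (\<forall>(x, \<zeta>) \<in> Z. \<forall>v \<in> carrier_vec k. \<zeta> = P *\<^sub>v v \<longrightarrow> x = G *\<^sub>v v)"
  have eq: "G *\<^sub>v v = F *\<^sub>v v" if v: "v \<in> carrier_vec k" for v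
  proof -
    obtain x where x: "(x, P *\<^sub>v v) \<in> Z" using full[OF v] by blast
    then have "x = G *\<^sub>v v" using G v by blast
    moreover have "x = F *\<^sub>v v" using sound[OF x v] by simp
    ultimately show ?thesis by simp
  qed
  show "G = F"
  proof (rule mat_col_eqI)
    fix j assume j: "j < dim_col F"
    then have j: "j < k" using F by simp
    then show "col G j = col F j"
      using eq[OF unit_vec_carrier] mult_mat_vec_unit_vec[OF F j] mult_mat_vec_unit_vec[OF conjunct1[OF G] j]
      by simp
  qed (use F G in auto)
qed

theorem lemma3p9:
  fixes n m p n\<^sub>\<zeta> n\<^sub>v :: nat
    and A B C Q L A\<^sub>\<epsilon> E \<A> \<B> P :: "real mat"
    and \<epsilon>\<^sub>0 \<eta>\<^sub>\<epsilon> :: "real vec"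
    and Z :: "(real vec \<times> real vec) set"
  assumes "0 < n" and "p \<le> n"
    and "A \<in> carrier_mat n n" and "B \<in> carrier_mat n m" and "C \<in> carrier_mat p n"
    and "mat_rank C = p"
    and "sym_psd p Q"
    and "controllable A B"
    and "observable A C"
    and "observable A (psd_sqrt (transpose_mat C * Q * C))"
    and "delayed_io_case n m p A B C Z E \<A> \<B> n\<^sub>\<zeta> n\<^sub>v \<or>
         filter_case n m p A B C L A\<^sub>\<epsilon> \<epsilon>\<^sub>0 \<eta>\<^sub>\<epsilon> Z E \<A> \<B> n\<^sub>\<zeta> n\<^sub>v"
    and "P \<in> carrier_mat n\<^sub>\<zeta> n\<^sub>v"
    and "mat_im P = mat_im (ctrb \<A> \<B>)"
  shows
    "(\<forall>(x, \<zeta>) \<in> Z. \<forall>v \<in> carrier_vec n\<^sub>v. \<zeta> = P *\<^sub>v v \<longrightarrow> x = (E * P) *\<^sub>v v) \<and>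
     ((\<exists>(x, \<zeta>) \<in> Z. \<exists>v \<in> carrier_vec n\<^sub>v. \<zeta> = P *\<^sub>v v) \<longrightarrow>
        (\<exists>!F. F \<in> carrier_mat n n\<^sub>v \<and>
           (\<forall>(x, \<zeta>) \<in> Z. \<forall>v \<in> carrier_vec n\<^sub>v. \<zeta> = P *\<^sub>v v \<longrightarrow> x = F *\<^sub>v v))) \<and>
     mat_rank (E * P) = n \<and>
     consistent_with (pinv P * \<A> * P) (pinv P * \<B>) (C * E * P) A B C \<and>
     controllable (pinv P * \<A> * P) (pinv P * \<B>)"
proof -
  interpret observable_lti A B C n m p
    using assms by unfold_locales
  note ctrl = \<open>controllable A B\<close> and P = \<open>P \<in> carrier_mat n\<^sub>\<zeta> n\<^sub>v\<close> and im = \<open>mat_im P = mat_im (ctrb \<A> \<B>)\<close>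
  \<comment> \<open>The obligations of a single case. \<open>full\<close> may assume one pair in the
    image of \<open>P\<close>; in the filter case that pair is what yields nilpotency.\<close>
  have conclude: ?thesis
    if \<A>: "\<A> \<in> carrier_mat n\<^sub>\<zeta> n\<^sub>\<zeta>" and \<B>: "\<B> \<in> carrier_mat n\<^sub>\<zeta> m" and E: "E \<in> carrier_mat n n\<^sub>\<zeta>"
      and lift: "\<And>u t. \<forall>t. u t \<in> carrier_vec m \<Longrightarrow> E *\<^sub>v reach \<A> \<B> u t = reach A B u t"
      and inj: "\<And>w. w \<in> carrier_vec n\<^sub>v \<Longrightarrow> P *\<^sub>v w = 0\<^sub>v n\<^sub>\<zeta> \<Longrightarrow> w = 0\<^sub>v n\<^sub>v"
      and sound: "\<And>x \<zeta>. (x, \<zeta>) \<in> Z \<Longrightarrow> \<zeta> \<in> mat_im P \<Longrightarrow> x = E *\<^sub>v \<zeta>"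
      and full: "\<And>x \<zeta> z. (x, \<zeta>) \<in> Z \<Longrightarrow> \<zeta> \<in> mat_im P \<Longrightarrow> z \<in> mat_im P \<Longrightarrow> \<exists>x. (x, z) \<in> Z"
  proof -
    note red = reduced_realization[OF A B C ctrl \<A> \<B> E lift P im inj]
    have EP: "E * P \<in> carrier_mat n n\<^sub>v" using E P by simp
    have sound': "x = (E * P) *\<^sub>v v" if "(x, \<zeta>) \<in> Z" "v \<in> carrier_vec n\<^sub>v" "\<zeta> = P *\<^sub>v v" for x \<zeta> v
      using sound[OF that(1)] mat_imI[OF P that(2)] that(3) assoc_mult_mat_vec[OF E P that(2)] by simp
    have "\<exists>!F. F \<in> carrier_mat n n\<^sub>v \<and> (\<forall>(x, \<zeta>) \<in> Z. \<forall>v \<in> carrier_vec n\<^sub>v. \<zeta> = P *\<^sub>v v \<longrightarrow> x = F *\<^sub>v v)"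
      if ex: "\<exists>(x, \<zeta>) \<in> Z. \<exists>v \<in> carrier_vec n\<^sub>v. \<zeta> = P *\<^sub>v v"
    proof (rule unique_matrix_of_surj_pairs[OF EP sound'])
      fix v :: "real vec" assume v: "v \<in> carrier_vec n\<^sub>v"
      from ex obtain x \<zeta> w where xw: "(x, \<zeta>) \<in> Z" "w \<in> carrier_vec n\<^sub>v" "\<zeta> = P *\<^sub>v w" by blast
      show "\<exists>x. (x, P *\<^sub>v v) \<in> Z"
        using full[OF xw(1)] mat_imI[OF P xw(2)] mat_imI[OF P v] xw(3) by simp
    qed
    with red sound' show ?thesis by blast
  qed
  from assms(11) show ?thesis
  proof
    assume "delayed_io_case n m p A B C Z E \<A> \<B> n\<^sub>\<zeta> n\<^sub>v"
    then have Z: "Z = io_pairs A B C" and E: "E = io_M A B C" and \<A>: "\<A> = io_A A B C"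
      and \<B>: "\<B> = io_B n m p" and nz: "n\<^sub>\<zeta> = m * n + p * n" and nv: "n\<^sub>v = n + m * n"
      by (auto simp: delayed_io_case_def algebra_simps)
    note Ac = io_A_carrier and Bc = io_B_carrier
    have P': "P \<in> carrier_mat (m * n + p * n) (n + m * n)" using P nz nv by simp
    have reach_P: "\<exists>v\<in>carrier_vec (n + m * n). reach (io_A A B C) (io_B n m p) u t = P *\<^sub>v v"
      if "\<forall>t. u t \<in> carrier_vec m" for u t
      using reach_in_mat_im_ctrb[OF Ac Bc that, of t] im P' unfolding \<A> \<B> by (metis mat_imE)
    have inj: "w = 0\<^sub>v n\<^sub>v" if "w \<in> carrier_vec n\<^sub>v" "P *\<^sub>v w = 0\<^sub>v n\<^sub>\<zeta>" for w
    proof (rule inj_if_comp_surj[OF P unhistory_carrier[folded nz nv] _ that])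
      fix z :: "real vec" assume "z \<in> carrier_vec n\<^sub>v"
      then obtain u where u: "\<forall>t. u t \<in> carrier_vec m"
        "unhistory *\<^sub>v io_history n m p (delayed_input u) (rest_output u) (n + (n + n)) = z"
        using unhistory_surj[OF ctrl] nv by metis
      obtain v where "v \<in> carrier_vec (n + m * n)" "reach (io_A A B C) (io_B n m p) u (n + n) = P *\<^sub>v v"
        using reach_P[OF u(1)] by blast
      then show "\<exists>v\<in>carrier_vec n\<^sub>v. unhistory *\<^sub>v (P *\<^sub>v v) = z"
        using u(2) reach_eq_history[OF u(1), of "n + n"] nv by metis
    qed
    have sound: "x = E *\<^sub>v \<zeta>" if "(x, \<zeta>) \<in> Z" for x \<zeta>
      using that io_M_history A B C unfolding Z E io_pairs_def by auto
    have full: "\<exists>x. (x, z) \<in> Z" if z: "z \<in> mat_im P" for z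
    proof -
      obtain u where u: "\<forall>t. u t \<in> carrier_vec m" "z = reach (io_A A B C) (io_B n m p) u (m * n + p * n)"
        using z unfolding im \<A> \<B> mat_im_ctrb[OF Ac Bc] by blast
      have "(rest_state u (n + (m * n + p * n)), z) \<in> Z"
        unfolding Z io_pairs_def u(2) reach_eq_history[OF u(1)]
        using rest_trajectory[OF u(1)] A B C by (auto intro!: exI)
      then show ?thesis by blast
    qed
    show ?thesis
      using Ac Bc io_M_carrier io_M_reach inj sound full
      by (intro conclude) (simp_all add: \<A> \<B> E nz)
  next
    assume fc: "filter_case n m p A B C L A\<^sub>\<epsilon> \<epsilon>\<^sub>0 \<eta>\<^sub>\<epsilon> Z E \<A> \<B> n\<^sub>\<zeta> n\<^sub>v"
    interpret filter_lti A B C n m p L A\<^sub>\<epsilon> \<epsilon>\<^sub>0 \<eta>\<^sub>\<epsilon>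
      using fc by unfold_locales (auto simp: filter_case_def)
    have Z: "Z = filter_pairs A B C L A\<^sub>\<epsilon> \<epsilon>\<^sub>0 \<eta>\<^sub>\<epsilon>" and E: "E = filter_S A B C L A\<^sub>\<epsilon> \<epsilon>\<^sub>0 \<eta>\<^sub>\<epsilon>"
      and \<A>: "\<A> = filter_A A B C L A\<^sub>\<epsilon> \<epsilon>\<^sub>0 \<eta>\<^sub>\<epsilon>" and \<B>: "\<B> = filter_Bu n m p" and nz: "n\<^sub>\<zeta> = (m + p + 1) * n"
      and nv: "n\<^sub>v = (if spectrum (map_mat complex_of_real H) \<subseteq> {0} then m * n + n else mat_rank (ctrb \<A> \<B>))"
      using fc unfolding filter_case_def H_def by blast+
    have Ac: "\<A> \<in> carrier_mat n\<^sub>\<zeta> n\<^sub>\<zeta>" and Bc: "\<B> \<in> carrier_mat n\<^sub>\<zeta> m" and Ec: "E \<in> carrier_mat n n\<^sub>\<zeta>"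
      unfolding \<A> \<B> E nz using filter_A_carrier filter_B_carrier filter_S_carrier by auto
    \<comment> \<open>In the nilpotent case \<open>n\<^sub>v\<close> is an explicit number and
      injectivity needs the dimension count; in the other case \<open>n\<^sub>v\<close> is the rank
      by definition, so \<open>P\<close> has full column rank.\<close>
    have inj: "w = 0\<^sub>v n\<^sub>v" if w: "w \<in> carrier_vec n\<^sub>v" "P *\<^sub>v w = 0\<^sub>v n\<^sub>\<zeta>" for w
    proof (cases "spectrum (map_mat complex_of_real H) \<subseteq> {0}")
      case True
      then have nv': "n\<^sub>v = n + m * n" using nv by simp
      have R: "reorder \<in> carrier_mat (m * n + p * n) n\<^sub>\<zeta>" by (simp add: reorder_def nz)
      have UR: "unhistory * reorder \<in> carrier_mat n\<^sub>v n\<^sub>\<zeta>"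
        unfolding nv' by (rule mult_carrier_mat[OF unhistory_carrier R])
      show ?thesis
      proof (rule inj_if_comp_surj[OF P UR _ w])
        fix z :: "real vec" assume "z \<in> carrier_vec n\<^sub>v"
        then obtain u where u: "\<forall>t. u t \<in> carrier_vec m"
          "unhistory *\<^sub>v io_history n m p (delayed_input u) (rest_output u) (n + (n + n)) = z"
          using unhistory_surj[OF ctrl] nv' by metis
        obtain v where v: "v \<in> carrier_vec n\<^sub>v" "reach \<A> \<B> u (n + n) = P *\<^sub>v v"
          using reach_in_mat_im_ctrb[OF Ac Bc u(1), of "n + n"] im P by (metis mat_imE)
        have "(unhistory * reorder) *\<^sub>v (P *\<^sub>v v) = unhistory *\<^sub>v (reorder *\<^sub>v (P *\<^sub>v v))"
          using P v(1) by (intro assoc_mult_mat_vec[OF unhistory_carrier R]) simp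
        also have "\<dots> = z"
          unfolding v(2)[symmetric] \<A> \<B> reorder_reach[OF True u(1)] by (rule u(2))
        finally show "\<exists>v\<in>carrier_vec n\<^sub>v. (unhistory * reorder) *\<^sub>v (P *\<^sub>v v) = z" using v(1) by blast
      qed
    next
      case False
      have "mat_rank P = mat_rank (ctrb \<A> \<B>)"
        using P ctrb_carrier[OF Ac Bc] im by (intro mat_rank_cong_im) auto
      then have "mat_rank P = n\<^sub>v" using nv False by simp
      from inj_if_mat_rank_eq_dim_col[OF P this w] show ?thesis .
    qed
    have sound: "x = E *\<^sub>v \<zeta>" if "(x, \<zeta>) \<in> Z" "\<zeta> \<in> mat_im P" for x \<zeta>
      using companion_vanishes_if_reached[of x \<zeta>] that unfolding Z im \<A> \<B> E by blast
    have full: "\<exists>x. (x, z) \<in> Z" if zs: "(x, \<zeta>) \<in> Z" "\<zeta> \<in> mat_im P" "z \<in> mat_im P" for x \<zeta> z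
    proof -
      obtain t where "companion H ^\<^sub>m t *\<^sub>v unit_vec n (n - 1) = 0\<^sub>v n"
        using companion_vanishes_if_reached[of x \<zeta>] zs(1,2) unfolding Z im \<A> \<B> by blast
      then show ?thesis using reached_in_filter_pairs zs(3) unfolding Z im \<A> \<B> by blast
    qed
    have lift: "E *\<^sub>v reach \<A> \<B> u t = reach A B u t" if "\<forall>t. u t \<in> carrier_vec m" for u t
      unfolding E \<A> \<B> by (rule filter_S_reach[OF that])
    show ?thesis by (rule conclude[OF Ac Bc Ec lift inj sound full])
  qed
qed

end
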